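(* Let $\mathbb{K}\in\{\mathbb{R},\mathbb{C}\}$, let $n\ge m$, let $\mathcal{G}$ be a DAG on the vertices $\{1,\dots,m\}$ and let $f\in\mathbb{K}^{n\times m}$ be a sample. Let $\alpha$ be an MLE given $f$ in the DAG model on $\mathcal{G}$, with edge-weight part $\Lambda=(\lambda_{ij})$. Then: (a) there is a locally closed subvariety $X_f\subseteq\mathbb{K}^{n\times m}$ parametrising stabilisations of $f$ (its points are the $f$-perturbations $f'$, corresponding to the stabilisations $\widetilde f=f+f'$); (b) there is a closed subvariety $X_{f,\alpha}\subseteq X_f$, with defining equations $v_i-\sum_{j\to i}\lambda_{ij}v_j=0$ for every vertex $i$ (where $v_1,\dots,v_m$ are the columns of $f'$), parametrising stabilisations $\widetilde f$ of $f$ such that the MLE given $\widetilde f$ is $\alpha$, so that $X_{f,\alpha}\ne\emptyset$ if and only if $\alpha$ is the MLE given an $f$-stabilisation; (c) there is a closed subvariety $X_{f,\alpha}^{\lim}\subseteq X_f$, with defining equations $c_{i,l}\,\lambda_i-D_{i,l}=0$ for every child vertex $i$ (where $\lambda_i$ is the column vector $(\lambda_{ij})_{j\in\mathrm{pa}(i)}$ and $c_{i,l},D_{i,l}$ are defined from $f'$ in the context), parametrising stabilisations $\widetilde f$ of $f$ such that the limit MLE given $\widetilde f$ is $\alpha$, so that $X_{f,\alpha}^{\lim}\neq\emptyset$ if and only if $\alpha$ is the limit MLE given an $f$-stabilisation.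
   Context: $\mathbb{K}^n,\mathbb{K}^m$ carry the standard inner products $v\cdot w=\sum_k v_kw_k^*$ ($w_k^*$ the complex conjugate), $(\cdot)^{\mathsf T}$ is transpose (conjugate transpose if $\mathbb{K}=\mathbb{C}$), $\langle\cdot\rangle$ denotes linear span, and $\operatorname{adj}$ is the adjugate matrix. For a DAG $\mathcal{G}$ on $\{1,\dots,m\}$, $\mathrm{pa}(i)=\{j: j\to i\}$; a child vertex is a vertex $i$ with $\mathrm{pa}(i)\ne\emptyset$. DAG model on $\mathcal{G}$: parameters are pairs $(\Lambda,\omega)$ with $\Lambda=(\lambda_{ij})\in\mathbb{K}^{m\times m}$ (the edge weights), $\lambda_{ij}=0$ unless $j\to i$, and $\omega\in\mathbb{R}_{>0}^m$ (the variances); they give the mean-zero Gaussian with covariance $(I-\Lambda)^{-1}\mathrm{diag}(\omega)(I-\Lambda)^{-\mathsf T}$. A sample is a matrix $Y\in\mathbb{K}^{n\times m}$ with columns $Y^{(1)},\dots,Y^{(m)}$, viewed as a linear map $\mathbb{K}^m\to\mathbb{K}^n$. An MLE given $Y$ is a parameter pair $(\Lambda,\omega)$ minimising $\sum_{i=1}^m\big(\log\omega_i+\tfrac1{n\omega_i}\|Y^{(i)}-\sum_{j\in\mathrm{pa}(i)}\lambda_{ij}Y^{(j)}\|^2\big)$. Given $f:\mathbb{K}^m\to\mathbb{K}^n$, an $f$-perturbation is a linear map $f':\mathbb{K}^m\to\mathbb{K}^n$ with $\operatorname{im}f'\subseteq(\operatorname{im}f)^\perp$ and $(\ker f')^\perp=\ker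 f$. A stabilisation of $f$, or $f$-stabilisation, is a sum $\widetilde f=f+f'$ with $f'$ an $f$-perturbation. The MLE given a stabilisation is unique, as is the MLE given $\widetilde f(\epsilon):=f+\epsilon f'$ for $\epsilon\neq0$; the limit MLE given $\widetilde f$ is the limit (which exists) as $\epsilon\to0$ of the MLE given $\widetilde f(\epsilon)$. For $f'\in X_f$ and a child vertex $i$, suppose for simplicity of notation that $\mathrm{pa}(i)=\{1,\dots,p\}$. Let $f_j,v_j$ be the columns of $f,f'$, let $A_i$ (resp. $E_i$) be the $n\times p$ matrix with columns $f_1,\dots,f_p$ (resp. $v_1,\dots,v_p$), let $\overline{f_i}$, $\overline{v_i}$ be the orthogonal projections of $f_i$ onto $\langle f_j: j\to i\rangle$ and of $v_i$ onto $\langle v_j: j\to i\rangle$, and let $C_i'(\epsilon)=A_i^{\mathsf T}A_i+\epsilon E_i^{\mathsf T}E_i$. Put $$c_{i,l}=\operatorname{tr}\Big(\Big(\tfrac{d^{l-1}}{d\epsilon^{l-1}}\Big|_{\epsilon=0}\operatorname{adj}C_i'(\epsilon)\Big)E_i^{\mathsf T}E_i\Big),$$ $$D_{i,l}=\Big(\tfrac{d^{l}}{d\epsilon^{l}}\Big|_{\epsilon=0}\operatorname{adj}C_i'(\epsilon)\Big)\begin{pmatrix}f_1\cdot\overline{f_i}\\ \vdots\\ f_p\cdot\overline{f_i}\end{pmatrix}+\Big(\tfrac{d^{l-1}}{d\epsilon^{l-1}}\Big|_{\epsilon=0}\operatorname{adj}C_i'(\epsilon)\Big)\begin{pmatrix}v_1\cdot\overline{v_i}\\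 \vdots\\ v_p\cdot\overline{v_i}\end{pmatrix},$$ where $l$ is the smallest integer in $\{1,\dots,p\}$ with $c_{i,l}\ne0$.
   Formalization: In (c), corrected: the second summand of D_{i,l} gets a factor l; l ranges over {0,…,p} with c_{i,0}=det C_i'(0); the inner products in D_{i,l} are taken in the opposite order (matters for K=C only); for K=C, "closed subvariety" in (c) means real Zariski closed. *)

theory Defs
  imports
    "HOL-Analysis.Analysis"
    "Jordan_Normal_Form.Matrix_Kernel"
    "Jordan_Normal_Form.Schur_Decomposition"
begin

unbundle no vec_syntax

text \<open>
  The scalar field: a common interface for the two cases \<open>\<real>\<close> and \<open>\<complex>\<close>. (By the
  Gelfand--Mazur theorem, every \<^class>\<open>real_normed_field\<close> is isometrically isomorphic to
  one of these two; the extra axiom then forces \<^const>\<open>conjugate\<close> to be complex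
  conjugation.)
\<close>

class real_or_complex = conjugatable_field + real_normed_field +
  assumes mult_conjugate_self: "x * conjugate x = (norm x)\<^sup>2 *\<^sub>R 1"

instance real :: real_or_complex
  by standard (simp add: power2_eq_square)

instance complex :: real_or_complex
  by standard (simp add: complex_norm_square [symmetric] scaleR_conv_of_real)

text \<open>
  The inner product is \<^term>\<open>v \<bullet>c w\<close>, i.e. the sum of \<^term>\<open>v $ k * conjugate (w $ k)\<close>;
  it is linear in the first and conjugate-linear in the second argument.
\<close>

subsection \<open>Orthogonality\<close>

definition orth_compl :: "nat \<Rightarrow> 'a::conjugatable_field vec set \<Rightarrow> 'a vec set" where
  "orth_compl k S = {v \<in> carrier_vec k. \<forall>w\<in>S. v \<bullet>c w = 0}"

definition mat_image :: "'a::comm_ring_1 mat \<Rightarrow> 'a vec set" where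
  "mat_image A = (\<lambda>x. A *\<^sub>v x) ` carrier_vec (dim_col A)"

definition orth_proj :: "nat \<Rightarrow> 'a::conjugatable_field vec set \<Rightarrow> 'a vec \<Rightarrow> 'a vec" where
  "orth_proj k S v = (THE w. w \<in> S \<and> v - w \<in> orth_compl k S)"

subsection \<open>DAG models and maximum likelihood estimation\<close>

text \<open>
  Vertices are \<open>0, \<dots>, m - 1\<close>, and \<open>(j, i) \<in> E\<close> is the edge \<open>j \<rightarrow> i\<close>.
\<close>

definition dag_on :: "nat \<Rightarrow> (nat \<times> nat) set \<Rightarrow> bool" where
  "dag_on m E \<longleftrightarrow> E \<subseteq> {..<m} \<times> {..<m} \<and> acyclic E"

definition pa :: "(nat \<times> nat) set \<Rightarrow> nat \<Rightarrow> nat set" where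
  "pa E i = {j. (j, i) \<in> E}"

definition dag_params ::
  "nat \<Rightarrow> (nat \<times> nat) set \<Rightarrow> ('a::real_or_complex mat \<times> real vec) set" where
  "dag_params m E = {(\<Lambda>, \<omega>).
     \<Lambda> \<in> carrier_mat m m \<and> (\<forall>i<m. \<forall>j<m. j \<notin> pa E i \<longrightarrow> \<Lambda> $$ (i, j) = 0) \<and>
     \<omega> \<in> carrier_vec m \<and> (\<forall>i<m. \<omega> $ i > 0)}"

definition residual ::
  "nat \<Rightarrow> (nat \<times> nat) set \<Rightarrow> 'a::real_or_complex mat \<Rightarrow> 'a mat \<Rightarrow> nat \<Rightarrow> 'a vec" where
  "residual n E \<Lambda> Y i = vec n (\<lambda>k. Y $$ (k, i) - (\<Sum>j\<in>pa E i. \<Lambda> $$ (i, j) * Y $$ (k, j)))"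

definition dag_objective ::
  "nat \<Rightarrow> nat \<Rightarrow> (nat \<times> nat) set \<Rightarrow> 'a::real_or_complex mat \<Rightarrow> 'a mat \<times> real vec \<Rightarrow> real" where
  "dag_objective n m E Y \<alpha> =
     (\<Sum>i<m. ln (snd \<alpha> $ i) +
        1 / (real n * snd \<alpha> $ i) * (\<Sum>k<n. (norm (residual n E (fst \<alpha>) Y i $ k))\<^sup>2))"

definition is_MLE ::
  "nat \<Rightarrow> nat \<Rightarrow> (nat \<times> nat) set \<Rightarrow> 'a::real_or_complex mat \<Rightarrow> 'a mat \<times> real vec \<Rightarrow> bool" where
  "is_MLE n m E Y \<alpha> \<longleftrightarrow> \<alpha> \<in> dag_params m E \<and>
     (\<forall>\<beta>\<in>dag_params m E. dag_objective n m E Y \<alpha> \<le> dag_objective n m E Y \<beta>)"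

definition is_unique_MLE ::
  "nat \<Rightarrow> nat \<Rightarrow> (nat \<times> nat) set \<Rightarrow> 'a::real_or_complex mat \<Rightarrow> 'a mat \<times> real vec \<Rightarrow> bool" where
  "is_unique_MLE n m E Y \<alpha> \<longleftrightarrow> is_MLE n m E Y \<alpha> \<and> (\<forall>\<beta>. is_MLE n m E Y \<beta> \<longrightarrow> \<beta> = \<alpha>)"

subsection \<open>Stabilisations\<close>

definition is_perturbation ::
  "nat \<Rightarrow> nat \<Rightarrow> 'a::real_or_complex mat \<Rightarrow> 'a mat \<Rightarrow> bool" where
  "is_perturbation n m f f' \<longleftrightarrow> f' \<in> carrier_mat n m \<and>
     mat_image f' \<subseteq> orth_compl n (mat_image f) \<and>
     orth_compl m (mat_kernel f') = mat_kernel f"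

definition is_stabilisation ::
  "nat \<Rightarrow> nat \<Rightarrow> 'a::real_or_complex mat \<Rightarrow> 'a mat \<Rightarrow> bool" where
  "is_stabilisation n m f f\<^sub>s \<longleftrightarrow> (\<exists>f'. is_perturbation n m f f' \<and> f\<^sub>s = f + f')"

text \<open>
  For a stabilisation \<open>f\<^sub>s\<close>, the perturbation \<open>f'\<close> is recovered as \<open>f\<^sub>s - f\<close>.
  Convergence of parameters is entrywise.
\<close>

definition is_limit_MLE ::
  "nat \<Rightarrow> nat \<Rightarrow> (nat \<times> nat) set \<Rightarrow> 'a::real_or_complex mat \<Rightarrow> 'a mat \<Rightarrow>
     'a mat \<times> real vec \<Rightarrow> bool" where
  "is_limit_MLE n m E f f\<^sub>s \<alpha> \<longleftrightarrow>
     fst \<alpha> \<in> carrier_mat m m \<and> snd \<alpha> \<in> carrier_vec m \<and>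
     (\<exists>A. (\<forall>\<epsilon>::real. \<epsilon> \<noteq> 0 \<longrightarrow> is_unique_MLE n m E (f + of_real \<epsilon> \<cdot>\<^sub>m (f\<^sub>s - f)) (A \<epsilon>)) \<and>
          (\<forall>i<m. \<forall>j<m. ((\<lambda>\<epsilon>. fst (A \<epsilon>) $$ (i, j)) \<longlongrightarrow> fst \<alpha> $$ (i, j)) (at 0)) \<and>
          (\<forall>i<m. ((\<lambda>\<epsilon>. snd (A \<epsilon>) $ i) \<longlongrightarrow> snd \<alpha> $ i) (at 0)))"

subsection \<open>The quantities \<open>c\<^sub>i\<^sub>,\<^sub>l\<close> and \<open>D\<^sub>i\<^sub>,\<^sub>l\<close>\<close>

text \<open>
  The parents of \<open>i\<close> are enumerated increasingly; this enumeration indexes the columns of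
  \<open>parent_cols E Y i\<close> (which is \<open>A\<^sub>i\<close> for \<open>Y = f\<close> and \<open>E\<^sub>i\<close> for \<open>Y = f'\<close>) and the entries
  of \<open>edge_vec E \<Lambda> i\<close> (which is \<open>\<lambda>\<^sub>i\<close>).
\<close>

definition parents :: "(nat \<times> nat) set \<Rightarrow> nat \<Rightarrow> nat list" where
  "parents E i = sorted_list_of_set (pa E i)"

definition parent_cols :: "(nat \<times> nat) set \<Rightarrow> 'a mat \<Rightarrow> nat \<Rightarrow> 'a mat" where
  "parent_cols E Y i = mat_of_cols (dim_row Y) (map (col Y) (parents E i))"

definition edge_vec :: "(nat \<times> nat) set \<Rightarrow> 'a mat \<Rightarrow> nat \<Rightarrow> 'a vec" where
  "edge_vec E \<Lambda> i = vec_of_list (map (\<lambda>j. \<Lambda> $$ (i, j)) (parents E i))"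

definition C' :: "(nat \<times> nat) set \<Rightarrow> 'a::real_or_complex mat \<Rightarrow> 'a mat \<Rightarrow> nat \<Rightarrow> 'a \<Rightarrow> 'a mat" where
  "C' E f f' i \<epsilon> =
     mat_adjoint (parent_cols E f i) * parent_cols E f i +
     \<epsilon> \<cdot>\<^sub>m (mat_adjoint (parent_cols E f' i) * parent_cols E f' i)"

text \<open>The \<open>l\<close>-th derivative at \<open>0\<close> of the adjugate of \<open>C'\<close>, taken entrywise.\<close>

definition deriv_adj ::
  "(nat \<times> nat) set \<Rightarrow> 'a::real_or_complex mat \<Rightarrow> 'a mat \<Rightarrow> nat \<Rightarrow> nat \<Rightarrow> 'a mat" where
  "deriv_adj E f f' i l = mat (card (pa E i)) (card (pa E i))
     (\<lambda>rs. (deriv ^^ l) (\<lambda>\<epsilon>. adj_mat (C' E f f' i \<epsilon>) $$ rs) 0)"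

text \<open>
  By Jacobi's formula, for \<open>l \<ge> 1\<close> the trace below is the \<open>l\<close>-th derivative at \<open>0\<close> of
  \<open>\<epsilon> \<mapsto> det C'(\<epsilon>)\<close>. The value for \<open>l = 0\<close> extends this to the determinant itself, so the
  index \<open>l\<close> of the first nonzero \<open>c\<^sub>i\<^sub>,\<^sub>l\<close> is the order of vanishing of \<open>det C'(\<epsilon>)\<close>: it is
  \<open>0\<close> if the parent columns of \<open>f\<close> are linearly independent (no rule of l'Hospital is
  needed then, and the trace formula would give a wrong \<open>\<lambda>\<^sub>i\<close>), and otherwise
  it is the smallest \<open>l \<in> {1..p}\<close> for which the trace is nonzero.
\<close>

definition c_coeff ::
  "(nat \<times> nat) set \<Rightarrow> 'a::real_or_complex mat \<Rightarrow> 'a mat \<Rightarrow> nat \<Rightarrow> nat \<Rightarrow> 'a" where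
  "c_coeff E f f' i l =
     (if l = 0 then Determinant.det (C' E f f' i 0)
      else sum_list (diag_mat (deriv_adj E f f' i (l - 1) *
             (mat_adjoint (parent_cols E f' i) * parent_cols E f' i))))"

definition vanishing_order ::
  "(nat \<times> nat) set \<Rightarrow> 'a::real_or_complex mat \<Rightarrow> 'a mat \<Rightarrow> nat \<Rightarrow> nat" where
  "vanishing_order E f f' i = (LEAST l. l \<in> {0..card (pa E i)} \<and> c_coeff E f f' i l \<noteq> 0)"

text \<open>
  Inner products of the projected column \<open>i\<close> of \<open>Y\<close> with its parent columns. The projection
  is the first argument of \<open>\<bullet>c\<close>, so that this is the right-hand side
  \<open>(mat_adjoint A) *\<^sub>v (proj)\<close> of the normal equations, \<open>A = parent_cols E Y i\<close>; the opposite
  order would give its complex conjugate.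
\<close>

definition proj_products :: "(nat \<times> nat) set \<Rightarrow> 'a::real_or_complex mat \<Rightarrow> nat \<Rightarrow> 'a vec" where
  "proj_products E Y i =
     (let proj = orth_proj (dim_row Y)
                   (LinearCombinations.module.span class_ring
                      (module_vec TYPE('a) (dim_row Y)) (col Y ` pa E i)) (col Y i)
      in vec_of_list (map (\<lambda>j. proj \<bullet>c col Y j) (parents E i)))"

text \<open>
  \<open>D_coeff E f f' i l\<close> is the \<open>l\<close>-th derivative at \<open>0\<close> of
  \<open>\<epsilon> \<mapsto> adj C'(\<epsilon>) (proj_products f + \<epsilon> proj_products f')\<close>; the factor \<open>l\<close> comes from the
  product rule (and makes the second summand vanish for \<open>l = 0\<close>).
\<close>

definition D_coeff ::
  "(nat \<times> nat) set \<Rightarrow> 'a::real_or_complex mat \<Rightarrow> 'a mat \<Rightarrow> nat \<Rightarrow> nat \<Rightarrow> 'a vec" where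
  "D_coeff E f f' i l =
     deriv_adj E f f' i l *\<^sub>v proj_products E f i +
     of_nat l \<cdot>\<^sub>v (deriv_adj E f f' i (l - 1) *\<^sub>v proj_products E f' i)"

subsection \<open>Subvarieties of matrix space\<close>

text \<open>The algebra of functions generated by \<open>G\<close>.\<close>

inductive_set polynomials_in :: "('b \<Rightarrow> 'a::comm_ring_1) set \<Rightarrow> ('b \<Rightarrow> 'a) set"
  for G :: "('b \<Rightarrow> 'a) set" where
  const: "(\<lambda>_. a) \<in> polynomials_in G"
| gen: "g \<in> G \<Longrightarrow> g \<in> polynomials_in G"
| add: "p \<in> polynomials_in G \<Longrightarrow> q \<in> polynomials_in G \<Longrightarrow> (\<lambda>x. p x + q x) \<in> polynomials_in G"
| mult: "p \<in> polynomials_in G \<Longrightarrow> q \<in> polynomials_in G \<Longrightarrow> (\<lambda>x. p x * q x) \<in> polynomials_in G"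

definition entries :: "nat \<Rightarrow> nat \<Rightarrow> ('a mat \<Rightarrow> 'a) set" where
  "entries n m = {(\<lambda>X. X $$ (k, j)) |k j. k < n \<and> j < m}"

text \<open>
  Polynomials in the entries and their conjugates are the real polynomial functions. They give
  the Zariski topology of the real vector space underlying the matrix space; for the real field
  this is the same as the one given by \<^const>\<open>entries\<close>.
\<close>

definition real_entries :: "nat \<Rightarrow> nat \<Rightarrow> ('a::conjugate mat \<Rightarrow> 'a) set" where
  "real_entries n m =
     entries n m \<union> {(\<lambda>X. conjugate (X $$ (k, j))) |k j. k < n \<and> j < m}"

definition zariski_closed ::
  "('a::comm_ring_1 mat \<Rightarrow> 'a) set \<Rightarrow> nat \<Rightarrow> nat \<Rightarrow> 'a mat set \<Rightarrow> bool" where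
  "zariski_closed G n m Z \<longleftrightarrow>
     (\<exists>P \<subseteq> polynomials_in G. Z = {X \<in> carrier_mat n m. \<forall>p\<in>P. p X = 0})"

definition zariski_locally_closed ::
  "('a::comm_ring_1 mat \<Rightarrow> 'a) set \<Rightarrow> nat \<Rightarrow> nat \<Rightarrow> 'a mat set \<Rightarrow> bool" where
  "zariski_locally_closed G n m Z \<longleftrightarrow>
     (\<exists>V W. zariski_closed G n m V \<and> zariski_closed G n m W \<and> Z = V - W)"

definition zariski_closed_in ::
  "('a::comm_ring_1 mat \<Rightarrow> 'a) set \<Rightarrow> nat \<Rightarrow> nat \<Rightarrow> 'a mat set \<Rightarrow> 'a mat set \<Rightarrow> bool" where
  "zariski_closed_in G n m X Z \<longleftrightarrow> (\<exists>V. zariski_closed G n m V \<and> Z = X \<inter> V)"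

subsection \<open>The three varieties of perturbations\<close>

definition X_pert :: "nat \<Rightarrow> nat \<Rightarrow> 'a::real_or_complex mat \<Rightarrow> 'a mat set" where
  "X_pert n m f = {f'. is_perturbation n m f f'}"

definition X_MLE ::
  "nat \<Rightarrow> nat \<Rightarrow> (nat \<times> nat) set \<Rightarrow> 'a::real_or_complex mat \<Rightarrow> 'a mat \<Rightarrow> 'a mat set" where
  "X_MLE n m E f \<Lambda> = {f' \<in> X_pert n m f. \<forall>i<m. residual n E \<Lambda> f' i = 0\<^sub>v n}"

definition X_lim ::
  "nat \<Rightarrow> nat \<Rightarrow> (nat \<times> nat) set \<Rightarrow> 'a::real_or_complex mat \<Rightarrow> 'a mat \<Rightarrow> 'a mat set" where
  "X_lim n m E f \<Lambda> = {f' \<in> X_pert n m f. \<forall>i<m. pa E i \<noteq> {} \<longrightarrow>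
     (let l = vanishing_order E f f' i
      in c_coeff E f f' i l \<cdot>\<^sub>v edge_vec E \<Lambda> i - D_coeff E f f' i l = 0\<^sub>v (card (pa E i)))}"

end

theory Submission
  imports Defs
begin

text \<open>
  The model separates over vertices: an MLE consists of least squares solutions of the columns
  on their parent columns, with the residual variances. As \<open>im f'\<close> is orthogonal to \<open>im f\<close>,
  the residual of \<open>f + \<epsilon> f'\<close> splits orthogonally into those of \<open>f\<close> and \<open>\<epsilon> f'\<close>, so \<open>\<alpha>\<close> stays an MLE
  iff the residuals of \<open>f'\<close> vanish, and \<open>f + \<epsilon> f'\<close> is injective, which makes the MLE unique.

  For the limit, let \<open>A, B\<close> be the parent columns of vertex \<open>i\<close> in \<open>f, f'\<close> and \<open>h\<close> its residual in
  \<open>f'\<close>. The deviation \<open>y(\<epsilon>)\<close> of the edge weights from \<open>\<lambda>\<^sub>i\<close> solves \<open>C'(t) y = t B\<^sup>* h\<close> with \<open>t = \<epsilon>\<^sup>2\<close>. By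
  Cramer's rule \<open>y\<close> is a quotient of polynomials in \<open>t\<close>, and it is bounded by an energy estimate; hence
  its limit is the quotient of the coefficients at the order of vanishing \<open>l\<close> of \<open>det C'(t)\<close>. By
  Jacobi's formula \<open>c\<^sub>i\<^sub>,\<^sub>l \<lambda>\<^sub>i - D\<^sub>i\<^sub>,\<^sub>l\<close> is, up to a nonzero factor, the numerator of this quotient. The limit
  vanishes iff \<open>h\<close> is orthogonal to \<open>B (ker A)\<close>. This last condition is Zariski closed, whereas
  the equations themselves involve the index \<open>l\<close>, which varies with \<open>f'\<close>.
\<close>

subsection \<open>Inner products\<close>

text \<open>Below, \<open>X^H\<close> is the adjoint of \<open>X\<close>. The parameter is
  \<open>t = \<epsilon>\<^sup>2\<close> because the images of \<open>A\<close> and \<open>B\<close>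
  are orthogonal: the cross terms of \<open>(A + \<epsilon> B)^H (A + \<epsilon> B)\<close> vanish,
  and the positive weight \<open>t\<close> keeps the Gram matrix definite. The obstacle is that
  \<open>A^H A\<close> may be singular, so that Cramer's quotient is 0/0 at \<open>t = 0\<close>.
  The orders of numerator and denominator are not compared algebraically. Pairing the equation for
  \<open>y\<close> with \<open>y\<close> gives \<open>|A y|^2 + t |B y|^2 = t <h, B y>\<close>,
  hence \<open>|B y| \<le> |h|\<close> and \<open>|A y|^2 \<le> t |h|^2\<close>. Since
  \<open>A\<close> and \<open>B\<close> are jointly injective, \<open>y\<close> is bounded, and a
  bounded quotient has no pole. The same estimate puts the limit in \<open>ker A\<close>, and
  testing against \<open>ker A\<close> shows that \<open>B\<close> maps it to the orthogonal
  projection of \<open>h\<close> onto \<open>B (ker A)\<close>. Two Zariski topologies occur because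
  (a) and (b) pair \<open>f'\<close> with fixed vectors only, whereas in (c) both \<open>h\<close>
  and \<open>B\<close> depend on \<open>f'\<close> and the inner product conjugates one of
  them.\<close>

lemma conjugate_of_real [simp]: "conjugate (of_real r :: 'a::real_or_complex) = of_real r"
proof (cases "r = 0")
  case False
  \<comment> \<open>The norm axiom of the class is what ties \<open>conjugate\<close> to the reals;
    cancelling a nonzero \<open>r\<close> then determines it there.\<close>
  have "of_real r * conjugate (of_real r :: 'a) = of_real r * of_real r"
    by (simp add: mult_conjugate_self scaleR_conv_of_real power2_eq_square)
  then show ?thesis using False by simp
qed simp

lemma conjugate_minus: "conjugate (x - y :: 'a::conjugatable_ring) = conjugate x - conjugate y"
  using conjugate_dist_add[of x "- y"] by (simp add: conjugate_neg)

text \<open>Real-valued, so that it can be ordered and minimised; \<open>v \<bullet>c v\<close> is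
  the same number inside the scalar field.\<close>

definition nsq :: "'a::real_normed_vector vec \<Rightarrow> real" where
  "nsq v = (\<Sum>k<dim_vec v. (norm (v $ k))\<^sup>2)"

lemma nsq_nonneg [simp]: "nsq v \<ge> 0"
  by (simp add: nsq_def sum_nonneg)

lemma nsq_eq_0_iff: "v \<in> carrier_vec n \<Longrightarrow> nsq v = 0 \<longleftrightarrow> v = 0\<^sub>v n"
  by (auto simp: nsq_def sum_nonneg_eq_0_iff)

lemma cscalar_prod_sum:
  "u \<in> carrier_vec n \<Longrightarrow> v \<in> carrier_vec n \<Longrightarrow> u \<bullet>c v = (\<Sum>k<n. u $ k * conjugate (v $ k))"
  by (simp add: scalar_prod_def atLeast0LessThan)

lemma cscalar_prod_self: "v \<bullet>c v = of_real (nsq (v :: 'a::real_or_complex vec))"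
  by (simp add: scalar_prod_def nsq_def mult_conjugate_self scaleR_conv_of_real atLeast0LessThan)

lemma cscalar_prod_commute:
  fixes u v :: "'a::conjugatable_field vec"
  assumes "u \<in> carrier_vec n" "v \<in> carrier_vec n"
  shows "conjugate (u \<bullet>c v) = v \<bullet>c u"
  using assms by (simp add: cscalar_prod_sum[of _ n] sum_conjugate conjugate_dist_mul mult.commute)

lemma cscalar_prod_eq_0_commute:
  fixes u v :: "'a::conjugatable_field vec"
  assumes "u \<in> carrier_vec n" "v \<in> carrier_vec n"
  shows "u \<bullet>c v = 0 \<longleftrightarrow> v \<bullet>c u = 0"
  by (metis assms conjugate_zero_iff cscalar_prod_commute)

lemma mat_adjoint_carrier [simp]:
  "A \<in> carrier_mat n p \<Longrightarrow> mat_adjoint A \<in> carrier_mat p n"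
  by (auto simp: mat_adjoint_def)

lemma mat_adjoint_dim [simp]:
  "dim_row (mat_adjoint A) = dim_col A" "dim_col (mat_adjoint A) = dim_row A"
  by (auto simp: mat_adjoint_def)

lemma mat_adjoint_index:
  "A \<in> carrier_mat n p \<Longrightarrow> i < p \<Longrightarrow> k < n \<Longrightarrow> mat_adjoint A $$ (i, k) = conjugate (A $$ (k, i))"
  by (simp add: mat_adjoint_def mat_of_rows_index)

lemma mat_adjoint_adjoint [simp]: "mat_adjoint (mat_adjoint A) = A"
  by (rule eq_matI) (auto simp: mat_adjoint_index[of _ "dim_col A" "dim_row A"] mat_adjoint_index[of A "dim_row A" "dim_col A"])

lemma mat_adjoint_add:
  "A \<in> carrier_mat n p \<Longrightarrow> B \<in> carrier_mat n p \<Longrightarrow> mat_adjoint (A + B) = mat_adjoint A + mat_adjoint B"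
  by (rule eq_matI) (auto simp: mat_adjoint_index[of _ n p] conjugate_dist_add)

lemma mat_adjoint_smult:
  "mat_adjoint (c \<cdot>\<^sub>m A) = conjugate c \<cdot>\<^sub>m mat_adjoint A"
  by (rule eq_matI) (auto simp: mat_adjoint_index[of _ "dim_row A" "dim_col A"] conjugate_dist_mul)

lemma mult_mat_vec_sum:
  "A \<in> carrier_mat n p \<Longrightarrow> x \<in> carrier_vec p \<Longrightarrow> k < n \<Longrightarrow> (A *\<^sub>v x) $ k = (\<Sum>j<p. A $$ (k, j) * x $ j)"
  by (simp add: scalar_prod_def atLeast0LessThan)

lemma cscalar_prod_mult_mat_vec:
  fixes A :: "'a::conjugatable_field mat"
  assumes "A \<in> carrier_mat n p" "x \<in> carrier_vec p" "y \<in> carrier_vec n"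
  shows "(A *\<^sub>v x) \<bullet>c y = x \<bullet>c (mat_adjoint A *\<^sub>v y)"
proof -
  have "(A *\<^sub>v x) \<bullet>c y = (\<Sum>k<n. \<Sum>j<p. A $$ (k, j) * x $ j * conjugate (y $ k))"
    using assms by (simp add: cscalar_prod_sum[of _ n] mult_mat_vec_sum[of A n p] sum_distrib_right del: index_mult_mat_vec)
  also have "\<dots> = (\<Sum>j<p. \<Sum>k<n. A $$ (k, j) * x $ j * conjugate (y $ k))"
    by (rule sum.swap)
  also have "\<dots> = x \<bullet>c (mat_adjoint A *\<^sub>v y)"
    using assms mat_adjoint_carrier[OF assms(1)] mult_mat_vec_carrier[OF mat_adjoint_carrier[OF assms(1)] assms(3)]
    by (simp add: cscalar_prod_sum[of _ p] mult_mat_vec_sum[of "mat_adjoint A" p n] sum_conjugate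
        sum_distrib_left mat_adjoint_index[of A n p] conjugate_dist_mul mult_ac del: index_mult_mat_vec)
  finally show ?thesis .
qed

lemma cscalar_prod_mult_mat_vec_right:
  fixes A :: "'a::conjugatable_field mat"
  assumes "A \<in> carrier_mat n p" "x \<in> carrier_vec p" "y \<in> carrier_vec n"
  shows "y \<bullet>c (A *\<^sub>v x) = (mat_adjoint A *\<^sub>v y) \<bullet>c x"
  using cscalar_prod_mult_mat_vec[of "mat_adjoint A" p n y x] assms by simp

text \<open>The kernel of \<open>A^H\<close> is the orthogonal complement of the image of
  \<open>A\<close>. For the converse the test vector is \<open>A^H r\<close> itself, which gives
  \<open>|A^H r|^2 = 0\<close>.\<close>

lemma adjoint_mult_eq_0_iff:
  fixes A :: "'a::real_or_complex mat"
  assumes A: "A \<in> carrier_mat n p" and r: "r \<in> carrier_vec n"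
  shows "mat_adjoint A *\<^sub>v r = 0\<^sub>v p \<longleftrightarrow> (\<forall>x\<in>carrier_vec p. r \<bullet>c (A *\<^sub>v x) = 0)"
proof
  assume "mat_adjoint A *\<^sub>v r = 0\<^sub>v p"
  then show "\<forall>x\<in>carrier_vec p. r \<bullet>c (A *\<^sub>v x) = 0"
    using assms by (simp add: cscalar_prod_mult_mat_vec_right)
next
  let ?z = "mat_adjoint A *\<^sub>v r"
  assume *: "\<forall>x\<in>carrier_vec p. r \<bullet>c (A *\<^sub>v x) = 0"
  have z: "?z \<in> carrier_vec p" using assms by (metis mat_adjoint_carrier mult_mat_vec_carrier)
  then have "?z \<bullet>c ?z = 0" using * assms by (simp add: cscalar_prod_mult_mat_vec_right)
  then show "?z = 0\<^sub>v p" using nsq_eq_0_iff[OF z] by (simp add: cscalar_prod_self)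
qed

text \<open>The abstract scalar field comes without a real part. Asking that the inner product be
  \<open>of_real c\<close> replaces it; this covers Pythagoras (\<open>c = 0\<close>) as well as the
  two places where the cross term is a nonzero real.\<close>

lemma nsq_add:
  fixes u v :: "'a::real_or_complex vec"
  assumes uv: "u \<in> carrier_vec n" "v \<in> carrier_vec n" and c: "u \<bullet>c v = of_real c"
  shows "nsq (u + v) = nsq u + nsq v + 2 * c"
proof -
  have vu: "v \<bullet>c u = of_real c"
    using cscalar_prod_commute[OF uv] c by simp
  have "(u + v) \<bullet>c (u + v) = u \<bullet>c u + u \<bullet>c v + (v \<bullet>c u + v \<bullet>c v)"
    using uv by (simp add: conjugate_add_vec[of _ n] add_scalar_prod_distrib[of _ n] scalar_prod_add_distrib[of _ n])
  then have "(of_real (nsq (u + v)) :: 'a) = of_real (nsq u + nsq v + 2 * c)"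
    by (simp add: c vu cscalar_prod_self)
  then show ?thesis by (simp only: of_real_eq_iff)
qed

lemma nsq_smult: "nsq (c \<cdot>\<^sub>v (v :: 'a::real_or_complex vec)) = (norm c)\<^sup>2 * nsq v"
  by (simp add: nsq_def norm_mult power_mult_distrib sum_distrib_left)

subsection \<open>Normal equations\<close>

text \<open>One direction is Pythagoras. For the other, a nonzero \<open>z = A^H r\<close> would be
  a direction of strict descent.\<close>

lemma normal_equation_iff_minimal:
  fixes A :: "'a::real_or_complex mat"
  assumes A: "A \<in> carrier_mat n p" and a: "a \<in> carrier_vec n" and x: "x \<in> carrier_vec p"
  shows "mat_adjoint A *\<^sub>v (a - A *\<^sub>v x) = 0\<^sub>v p \<longleftrightarrow>
    (\<forall>y\<in>carrier_vec p. nsq (a - A *\<^sub>v x) \<le> nsq (a - A *\<^sub>v y))"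
proof -
  define r where "r = a - A *\<^sub>v x"
  have r: "r \<in> carrier_vec n" using assms by (auto simp: r_def)
  have move: "a - A *\<^sub>v y = r + A *\<^sub>v (x - y)" if "y \<in> carrier_vec p" for y
    using that assms unfolding r_def
    by (simp add: mult_minus_distrib_mat_vec[of A n p], intro eq_vecI) auto
  show ?thesis unfolding r_def[symmetric]
  proof
    assume 0: "mat_adjoint A *\<^sub>v r = 0\<^sub>v p"
    show "\<forall>y\<in>carrier_vec p. nsq r \<le> nsq (a - A *\<^sub>v y)"
    proof
      fix y :: "'a vec" assume y: "y \<in> carrier_vec p"
      have "r \<bullet>c (A *\<^sub>v (x - y)) = of_real 0"
        using 0 adjoint_mult_eq_0_iff[OF A r] x y by simp
      then have "nsq (r + A *\<^sub>v (x - y)) = nsq r + nsq (A *\<^sub>v (x - y)) + 2 * 0"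
        using A x y by (intro nsq_add[OF r]) auto
      then show "nsq r \<le> nsq (a - A *\<^sub>v y)" by (simp add: move[OF y])
    qed
  next
    assume min: "\<forall>y\<in>carrier_vec p. nsq r \<le> nsq (a - A *\<^sub>v y)"
    let ?z = "mat_adjoint A *\<^sub>v r"
    have z: "?z \<in> carrier_vec p" using A r by (metis mat_adjoint_carrier mult_mat_vec_carrier)
    have Az: "A *\<^sub>v ?z \<in> carrier_vec n" using A z by auto
    \<comment> \<open>Minimality is compared at the point \<open>x + t z\<close>. A real step
      \<open>t\<close> keeps the cross term real, so that \<open>nsq_add\<close> applies.\<close>
    have le: "2 * t * nsq ?z \<le> t\<^sup>2 * nsq (A *\<^sub>v ?z)" for t
    proof -
      let ?s = "of_real (- t) :: 'a"
      let ?y = "x - ?s \<cdot>\<^sub>v ?z"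
      have y: "?y \<in> carrier_vec p" using x z by auto
      have xy: "x - ?y = ?s \<cdot>\<^sub>v ?z" using x z by (intro eq_vecI) auto
      have "a - A *\<^sub>v ?y = r + ?s \<cdot>\<^sub>v (A *\<^sub>v ?z)"
        unfolding move[OF y] xy by (simp only: mult_mat_vec[OF A z])
      moreover have "r \<bullet>c (?s \<cdot>\<^sub>v (A *\<^sub>v ?z)) = of_real (- t * nsq ?z)"
        using cscalar_prod_mult_mat_vec_right[OF A z r] r Az
        by (simp add: conjugate_smult_vec conjugate_neg cscalar_prod_self)
      ultimately have "nsq (a - A *\<^sub>v ?y) = nsq r + t\<^sup>2 * nsq (A *\<^sub>v ?z) + 2 * (- t * nsq ?z)"
        using nsq_add[of r n "?s \<cdot>\<^sub>v (A *\<^sub>v ?z)" "- t * nsq ?z"] r Az by (simp add: nsq_smult)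
      moreover have "nsq r \<le> nsq (a - A *\<^sub>v ?y)" using min y by blast
      ultimately show ?thesis by simp
    qed
    \<comment> \<open>Nearly the minimiser of the quadratic in \<open>t\<close>; the
      \<open>+ 1\<close> keeps the denominator positive when \<open>A z = 0\<close>.\<close>
    let ?t = "nsq ?z / (nsq (A *\<^sub>v ?z) + 1)"
    have pos: "nsq (A *\<^sub>v ?z) + 1 > 0" by (simp add: add_nonneg_pos)
    have "2 * ?t * nsq ?z \<le> ?t * (?t * nsq (A *\<^sub>v ?z))"
      using le[of ?t] by (simp add: power2_eq_square)
    also have "\<dots> \<le> ?t * nsq ?z"
      using pos by (intro mult_left_mono) (auto simp: field_simps)
    finally have "?t * nsq ?z \<le> 0" by simp
    then have "nsq ?z \<le> 0" using pos by (auto simp: divide_le_0_iff mult_le_0_iff)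
    then have "nsq ?z = 0" using nsq_nonneg[of ?z] by linarith
    then show "?z = 0\<^sub>v p" using nsq_eq_0_iff[OF z] by simp
  qed
qed

text \<open>
  One Gram--Schmidt step: \<open>r\<close> and \<open>s\<close> are the residuals of \<open>a\<close> and of the new vector with
  respect to the previous ones, and \<open>r - (r \<bullet> s / s \<bullet> s) s\<close> is the new residual of \<open>a\<close>.
\<close>
lemma ex_orthogonal_residual:
  fixes v :: "nat \<Rightarrow> nat \<Rightarrow> 'a::real_or_complex"
  shows "\<exists>c. \<forall>i<p. (\<Sum>k<n. (a k - (\<Sum>j<p. c j * v j k)) * conjugate (v i k)) = 0"
proof (induction p arbitrary: a)
  case (Suc p)
  define ip where "ip x y = (\<Sum>k<n. x k * conjugate (y k))" for x y :: "nat \<Rightarrow> 'a"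
  have ip_diff: "ip (\<lambda>k. x k - t * y k) z = ip x z - t * ip y z" for x y z t
    by (simp add: ip_def left_diff_distrib sum_subtractf sum_distrib_left mult.assoc)
  have ip_eq_0: "ip x x = 0 \<Longrightarrow> k < n \<Longrightarrow> x k = 0" for x k
  proof -
    assume "ip x x = 0" "k < n"
    then have "(of_real (\<Sum>k<n. (norm (x k))\<^sup>2) :: 'a) = 0"
      by (simp add: ip_def mult_conjugate_self scaleR_conv_of_real)
    then have "(\<Sum>k<n. (norm (x k))\<^sup>2) = 0" by (simp only: of_real_eq_0_iff)
    then show "x k = 0" using \<open>k < n\<close> by (simp add: sum_nonneg_eq_0_iff)
  qed
  obtain c where c: "\<forall>i<p. ip (\<lambda>k. a k - (\<Sum>j<p. c j * v j k)) (v i) = 0"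
    using Suc.IH[of a] unfolding ip_def by blast
  obtain d where d: "\<forall>i<p. ip (\<lambda>k. v p k - (\<Sum>j<p. d j * v j k)) (v i) = 0"
    using Suc.IH[of "v p"] unfolding ip_def by blast
  define r where "r = (\<lambda>k. a k - (\<Sum>j<p. c j * v j k))"
  define s where "s = (\<lambda>k. v p k - (\<Sum>j<p. d j * v j k))"
  define t where "t = ip r s / ip s s"
  \<comment> \<open>The vector \<open>s\<close> differs from \<open>v p\<close> by a combination of
    the earlier vectors, which \<open>x\<close> does not see.\<close>
  have vp: "ip x (v p) = ip x s" if "\<forall>i<p. ip x (v i) = 0" for x
  proof -
    have "ip x s = ip x (v p) - (\<Sum>k<n. \<Sum>j<p. conjugate (d j) * (x k * conjugate (v j k)))"
      by (simp add: ip_def s_def conjugate_minus sum_conjugate conjugate_dist_mul right_diff_distrib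
          sum_subtractf sum_distrib_left mult_ac)
    also have "(\<Sum>k<n. \<Sum>j<p. conjugate (d j) * (x k * conjugate (v j k))) = (\<Sum>j<p. conjugate (d j) * ip x (v j))"
      unfolding ip_def sum_distrib_left by (rule sum.swap)
    also have "\<dots> = 0" using that by simp
    finally show ?thesis by simp
  qed
  have orth: "\<forall>i<p. ip (\<lambda>k. r k - t * s k) (v i) = 0"
    using c d by (simp add: ip_diff r_def[symmetric] s_def[symmetric])
  have "ip (\<lambda>k. r k - t * s k) s = 0"
  proof (cases "ip s s = 0")
    \<comment> \<open>The new vector depends on the earlier ones. Then \<open>s\<close> vanishes and
      \<open>t = 0\<close> by the convention for division by zero, so the residual stays
      unchanged.\<close>
    case True
    then have "s k = 0" if "k < n" for k using ip_eq_0 that by blast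
    then have "ip r s = 0" by (simp add: ip_def)
    then show ?thesis by (simp add: ip_diff t_def)
  next
    case False
    then show ?thesis by (simp only: ip_diff) (simp add: t_def)
  qed
  then have "\<forall>i<Suc p. ip (\<lambda>k. r k - t * s k) (v i) = 0"
    using orth vp[OF orth] by (auto simp: less_Suc_eq)
  moreover have "r k - t * s k = a k - (\<Sum>j<Suc p. (if j < p then c j - t * d j else t) * v j k)" for k
  proof -
    have "(\<Sum>j<Suc p. (if j < p then c j - t * d j else t) * v j k) = (\<Sum>j<p. (c j - t * d j) * v j k) + t * v p k"
      by simp
    then show ?thesis
      by (simp add: r_def s_def algebra_simps sum_subtractf sum_distrib_left)
  qed
  ultimately show ?case
    unfolding ip_def by (intro exI[of _ "\<lambda>j. if j < p then c j - t * d j else t"]) (simp del: sum.lessThan_Suc)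
qed simp

text \<open>Existence is wanted for \<open>A\<close> of arbitrary rank, hence Gram-Schmidt and not
  an inverse of \<open>A^H A\<close>.\<close>

lemma ex_normal_solution:
  fixes A :: "'a::real_or_complex mat"
  assumes A: "A \<in> carrier_mat n p" and a: "a \<in> carrier_vec n"
  obtains x where "x \<in> carrier_vec p" "mat_adjoint A *\<^sub>v (a - A *\<^sub>v x) = 0\<^sub>v p"
proof -
  obtain c where c: "\<forall>i<p. (\<Sum>k<n. (a $ k - (\<Sum>j<p. c j * A $$ (k, j))) * conjugate (A $$ (k, i))) = 0"
    using ex_orthogonal_residual[where p = p and n = n and a = "\<lambda>k. a $ k" and v = "\<lambda>j k. A $$ (k, j)"] by blast
  let ?x = "vec p c"
  have x: "?x \<in> carrier_vec p" by simp
  have Ax: "a - A *\<^sub>v ?x \<in> carrier_vec n" using A a by auto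
  have "mat_adjoint A *\<^sub>v (a - A *\<^sub>v ?x) = 0\<^sub>v p"
  proof (rule eq_vecI)
    fix i assume "i < dim_vec (0\<^sub>v p)"
    then have i: "i < p" by simp
    have "(mat_adjoint A *\<^sub>v (a - A *\<^sub>v ?x)) $ i = (\<Sum>k<n. mat_adjoint A $$ (i, k) * (a - A *\<^sub>v ?x) $ k)"
      by (rule mult_mat_vec_sum[OF mat_adjoint_carrier[OF A] Ax i])
    also have "\<dots> = (\<Sum>k<n. (a $ k - (\<Sum>j<p. c j * A $$ (k, j))) * conjugate (A $$ (k, i)))"
    proof (rule sum.cong[OF refl])
      fix k assume "k \<in> {..<n}"
      then have k: "k < n" by simp
      have "(A *\<^sub>v ?x) $ k = (\<Sum>j<p. c j * A $$ (k, j))"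
        by (simp only: mult_mat_vec_sum[OF A x k]) (simp add: mult.commute)
      then have "(a - A *\<^sub>v ?x) $ k = a $ k - (\<Sum>j<p. c j * A $$ (k, j))"
        using k A by simp
      then show "mat_adjoint A $$ (i, k) * (a - A *\<^sub>v ?x) $ k = (a $ k - (\<Sum>j<p. c j * A $$ (k, j))) * conjugate (A $$ (k, i))"
        using i k by (simp only: mat_adjoint_index[OF A i k] mult.commute)
    qed
    finally show "(mat_adjoint A *\<^sub>v (a - A *\<^sub>v ?x)) $ i = 0\<^sub>v p $ i" using c i by simp
  qed (use A in simp)
  then show ?thesis using that x by blast
qed

subsection \<open>Polynomial matrices\<close>

text \<open>Jacobi's formula. The product rule in the Leibniz expansion differentiates one row at a
  time (\<open>Q a\<close>); Laplace expansion along that row uses cofactors from which the row is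
  deleted, so they are those of \<open>P\<close>.\<close>

lemma pderiv_det:
  fixes P :: "'a::idom poly mat"
  assumes P: "P \<in> carrier_mat n n"
  shows "pderiv (Determinant.det P) = (\<Sum>i<n. \<Sum>j<n. pderiv (P $$ (i, j)) * adj_mat P $$ (j, i))"
proof -
  let ?S = "{q. q permutes {0..<n}}"
  define Q where "Q a = mat n n (\<lambda>(i, j). if i = a then pderiv (P $$ (i, j)) else P $$ (i, j))" for a
  have Q: "Q a \<in> carrier_mat n n" for a by (simp add: Q_def)
  have sgn: "pderiv (signof q * x) = signof q * pderiv x" for q :: "nat \<Rightarrow> nat" and x :: "'a poly"
    by (cases q rule: sign_cases) (simp_all add: pderiv_minus)
  have row: "(\<Prod>i\<in>{0..<n} - {a}. P $$ (i, q i)) * pderiv (P $$ (a, q a)) = (\<Prod>i=0..<n. Q a $$ (i, q i))"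
    if "q \<in> ?S" "a \<in> {0..<n}" for q a
  proof -
    have lt: "q i < n" if "i < n" for i using \<open>q \<in> ?S\<close> permutes_in_image[of q "{0..<n}" i] that by auto
    have "(\<Prod>i=0..<n. Q a $$ (i, q i)) = Q a $$ (a, q a) * (\<Prod>i\<in>{0..<n} - {a}. Q a $$ (i, q i))"
      using that by (intro prod.remove) auto
    also have "(\<Prod>i\<in>{0..<n} - {a}. Q a $$ (i, q i)) = (\<Prod>i\<in>{0..<n} - {a}. P $$ (i, q i))"
      by (rule prod.cong) (auto simp: Q_def lt)
    also have "Q a $$ (a, q a) = pderiv (P $$ (a, q a))" using that lt by (auto simp: Q_def)
    finally show ?thesis by (simp add: mult.commute)
  qed
  have "pderiv (Determinant.det P) =
      (\<Sum>q\<in>?S. \<Sum>a\<in>{0..<n}. signof q * (\<Prod>i=0..<n. Q a $$ (i, q i)))"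
    unfolding det_def'[OF P] pderiv_sum sgn pderiv_prod
    by (intro sum.cong refl) (simp add: sum_distrib_left row)
  also have "\<dots> = (\<Sum>a\<in>{0..<n}. \<Sum>q\<in>?S. signof q * (\<Prod>i=0..<n. Q a $$ (i, q i)))"
    by (rule sum.swap)
  also have "\<dots> = (\<Sum>a<n. Determinant.det (Q a))"
    by (simp add: det_def'[OF Q] atLeast0LessThan)
  also have "\<dots> = (\<Sum>i<n. \<Sum>j<n. pderiv (P $$ (i, j)) * adj_mat P $$ (j, i))"
  proof (intro sum.cong refl)
    fix a assume "a \<in> {..<n}"
    then have a: "a < n" by simp
    have del_eq: "mat_delete (Q a) a j = mat_delete P a j" if "j < n" for j
      using P a that by (intro eq_matI) (auto simp: mat_delete_def Q_def)
    have "Determinant.det (Q a) = (\<Sum>j<n. Q a $$ (a, j) * cofactor (Q a) a j)"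
      by (rule laplace_expansion_row[OF Q a])
    also have "\<dots> = (\<Sum>j<n. pderiv (P $$ (a, j)) * adj_mat P $$ (j, a))"
    proof (intro sum.cong refl)
      fix j assume "j \<in> {..<n}"
      then have j: "j < n" by simp
      have "cofactor (Q a) a j = adj_mat P $$ (j, a)"
        using a j P by (simp add: cofactor_def del_eq adj_mat_def)
      moreover have "Q a $$ (a, j) = pderiv (P $$ (a, j))" using a j by (simp add: Q_def)
      ultimately show "Q a $$ (a, j) * cofactor (Q a) a j = pderiv (P $$ (a, j)) * adj_mat P $$ (j, a)"
        by simp
    qed
    finally show "Determinant.det (Q a) = \<dots>" .
  qed
  finally show ?thesis .
qed

text \<open>Wanted for evaluation at \<open>t\<close>: it carries the adjugate of a polynomial
  matrix to the adjugate of the evaluated matrix.\<close>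

lemma (in comm_ring_hom) hom_adj_mat:
  assumes "A \<in> carrier_mat n n"
  shows "adj_mat (map_mat hom A) = map_mat hom (adj_mat A)"
proof -
  have "mat_delete (map_mat hom A) i j = map_mat hom (mat_delete A i j)" if "i < n" "j < n" for i j
    using assms that by (intro eq_matI) (auto simp: mat_delete_def)
  then show ?thesis using assms
    by (intro eq_matI) (auto simp: adj_mat_def cofactor_def hom_distribs)
qed

lemma higher_deriv_poly:
  "(deriv ^^ l) (poly p) = poly ((pderiv ^^ l) (p :: 'a::real_normed_field poly))"
proof (induction l)
  case (Suc l)
  have "deriv (poly q) = poly (pderiv q)" for q :: "'a poly"
    by (rule ext) (rule DERIV_imp_deriv[OF poly_DERIV])
  then show ?case by (simp add: Suc)
qed simp

text \<open>The Taylor coefficient at 0. It translates the quantities defined by iterated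
  \<open>deriv\<close> into coefficients, where orders of vanishing are easy to handle.\<close>

lemma higher_deriv_poly_0:
  "(deriv ^^ l) (poly p) 0 = fact l * coeff (p :: 'a::real_normed_field poly) l"
  by (simp add: higher_deriv_poly poly_0_coeff_0 coeff_higher_pderiv pochhammer_fact)

lemma poly_eq_monom_mult:
  fixes p :: "'a::idom poly"
  assumes "\<And>k. k < l \<Longrightarrow> coeff p k = 0"
  obtains q where "p = monom 1 l * q" "poly q 0 = coeff p l"
proof -
  have "p = monom 1 l * poly_shift l p"
    by (rule poly_eqI) (auto simp: coeff_monom_mult coeff_poly_shift assms)
  then show ?thesis
    by (rule that) (simp add: poly_0_coeff_0 coeff_poly_shift)
qed

lemma tendsto_poly_of_real_power2:
  fixes p :: "'a::real_normed_field poly"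
  shows "((\<lambda>\<epsilon>. poly p (of_real (\<epsilon>\<^sup>2))) \<longlongrightarrow> poly p 0) (at (0::real))"
proof -
  have "((\<lambda>\<epsilon>::real. of_real (\<epsilon>\<^sup>2) :: 'a) \<longlongrightarrow> of_real (0\<^sup>2)) (at 0)"
    by (intro tendsto_intros)
  then show ?thesis
    using isCont_tendsto_compose[OF poly_isCont, of "\<lambda>\<epsilon>::real. of_real (\<epsilon>\<^sup>2) :: 'a" 0 "at 0" p] by simp
qed

text \<open>A quotient of polynomials that stays bounded has no pole, so its limit is read off the
  coefficients at the order of vanishing \<open>l\<close> of the denominator.\<close>
lemma tendsto_bounded_poly_quotient:
  fixes g d :: "'a::real_normed_field poly"
  assumes low: "\<And>k. k < l \<Longrightarrow> coeff d k = 0" and nz: "coeff d l \<noteq> 0"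
    and bound: "\<forall>\<^sub>F \<epsilon> in at (0::real).
      norm (poly g (of_real (\<epsilon>\<^sup>2))) \<le> K * norm (poly d (of_real (\<epsilon>\<^sup>2)))"
  shows "((\<lambda>\<epsilon>::real. poly g (of_real (\<epsilon>\<^sup>2)) / poly d (of_real (\<epsilon>\<^sup>2))) \<longlongrightarrow> coeff g l / coeff d l) (at 0)"
proof -
  obtain d' where d': "d = monom 1 l * d'" "poly d' 0 = coeff d l"
    using low by (rule poly_eq_monom_mult)
  \<comment> \<open>Divide the bound by \<open>t^k\<close>, where \<open>k < l\<close> and the
    coefficients below \<open>k\<close> vanish. As \<open>t\<close> tends to 0, the left side tends
    to the norm of \<open>coeff g k\<close>, while the right side keeps a factor
    \<open>t^(l - k)\<close> and tends to 0.\<close>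
  have glow: "coeff g k = 0" if "k < l" for k
    using that
  proof (induction k rule: less_induct)
    case (less k)
    then have "coeff g j = 0" if "j < k" for j using that order.strict_trans by blast
    then obtain g' where g': "g = monom 1 k * g'" "poly g' 0 = coeff g k"
      by (rule poly_eq_monom_mult)
    have le: "norm (poly g' (of_real (\<epsilon>\<^sup>2))) \<le> K * norm (poly (monom 1 (l - k) * d') (of_real (\<epsilon>\<^sup>2)))"
      if "\<epsilon> \<noteq> 0" and bnd: "norm (poly g (of_real (\<epsilon>\<^sup>2))) \<le> K * norm (poly d (of_real (\<epsilon>\<^sup>2)))"
      for \<epsilon> :: real
    proof -
      let ?t = "of_real (\<epsilon>\<^sup>2) :: 'a"
      have "d = monom 1 k * (monom 1 (l - k) * d')"
        using less.prems by (simp add: d'(1) mult_monom flip: mult.assoc)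
      then have "norm ?t ^ k * norm (poly g' ?t) \<le> norm ?t ^ k * (K * norm (poly (monom 1 (l - k) * d') ?t))"
        using bnd by (simp add: g'(1) poly_monom norm_mult norm_power mult_ac)
      then show ?thesis by (rule mult_left_le_imp_le) (use that(1) in simp)
    qed
    have lim: "((\<lambda>\<epsilon>::real. norm (poly g' (of_real (\<epsilon>\<^sup>2)))) \<longlongrightarrow> norm (poly g' 0)) (at 0)"
      "((\<lambda>\<epsilon>::real. K * norm (poly (monom 1 (l - k) * d') (of_real (\<epsilon>\<^sup>2)))) \<longlongrightarrow>
        K * norm (poly (monom 1 (l - k) * d') 0)) (at 0)"
      by (intro tendsto_mult tendsto_const tendsto_norm tendsto_poly_of_real_power2)+
    have ev: "\<forall>\<^sub>F \<epsilon> in at (0::real). norm (poly g' (of_real (\<epsilon>\<^sup>2)))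
        \<le> K * norm (poly (monom 1 (l - k) * d') (of_real (\<epsilon>\<^sup>2)))"
      using bound eventually_neq_at_within[of 0 0 UNIV] by eventually_elim (rule le)
    have "norm (poly g' 0) \<le> K * norm (poly (monom 1 (l - k) * d') 0)"
      by (rule tendsto_le[OF _ lim(2,1) ev]) simp
    then show "coeff g k = 0" using less.prems by (simp add: g'(2) poly_monom zero_power)
  qed
  obtain g' where g': "g = monom 1 l * g'" "poly g' 0 = coeff g l"
    using glow by (rule poly_eq_monom_mult)
  have "((\<lambda>\<epsilon>::real. poly g' (of_real (\<epsilon>\<^sup>2)) / poly d' (of_real (\<epsilon>\<^sup>2))) \<longlongrightarrow> poly g' 0 / poly d' 0) (at 0)"
    by (intro tendsto_divide tendsto_poly_of_real_power2) (simp add: d'(2) nz)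
  then show ?thesis unfolding g'(2) d'(2)
    by (rule Lim_transform_eventually)
      (auto simp: eventually_at_filter g'(1) d'(1) poly_monom)
qed

subsection \<open>Least squares under an orthogonal perturbation\<close>

lemma norm_mult_mat_vec_le:
  fixes L :: "'a::real_or_complex mat"
  assumes L: "L \<in> carrier_mat p n" and v: "v \<in> carrier_vec n" and i: "i < p"
  shows "norm ((L *\<^sub>v v) $ i) \<le> (\<Sum>k<n. norm (L $$ (i, k))) * sqrt (nsq v)"
proof -
  have le: "norm (v $ k) \<le> sqrt (nsq v)" if "k < n" for k
    using v that by (intro real_le_rsqrt) (auto simp: nsq_def intro!: member_le_sum)
  have "norm ((L *\<^sub>v v) $ i) \<le> (\<Sum>k<n. norm (L $$ (i, k) * v $ k))"
    unfolding mult_mat_vec_sum[OF L v i] by (rule norm_sum)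
  also have "\<dots> \<le> (\<Sum>k<n. norm (L $$ (i, k)) * sqrt (nsq v))"
    by (intro sum_mono) (simp add: norm_mult mult_left_mono le)
  finally show ?thesis by (simp add: sum_distrib_right)
qed

lemma smult_mat_mult_vec:
  fixes M :: "'a::comm_ring_1 mat"
  shows "v \<in> carrier_vec (dim_col M) \<Longrightarrow> (c \<cdot>\<^sub>m M) *\<^sub>v v = c \<cdot>\<^sub>v (M *\<^sub>v v)"
  by (intro eq_vecI) auto

lemma mult_mat_index_sum:
  "M \<in> carrier_mat q p \<Longrightarrow> N \<in> carrier_mat p r \<Longrightarrow> i < q \<Longrightarrow> j < r \<Longrightarrow>
    (M * N) $$ (i, j) = (\<Sum>k<p. M $$ (i, k) * N $$ (k, j))"
  by (simp add: scalar_prod_def atLeast0LessThan)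

lemma comm_ring_hom_poly: "comm_ring_hom (\<lambda>q. poly q (t :: 'a::comm_ring_1))"
  by unfold_locales auto

text \<open>One vertex of the model. \<open>x\<^sub>0\<close> is one of possibly many least squares
  solutions of the unperturbed problem, and the question is whether the perturbation selects it.
  Orthogonality of the two images is built into \<open>gram\<close>, which has no cross
  terms.\<close>

locale perturbed_least_squares =
  fixes n p :: nat and A B :: "'a::real_or_complex mat" and a b x\<^sub>0 :: "'a vec"
  assumes A: "A \<in> carrier_mat n p" and B: "B \<in> carrier_mat n p"
    and a: "a \<in> carrier_vec n" and b: "b \<in> carrier_vec n" and x\<^sub>0: "x\<^sub>0 \<in> carrier_vec p"
    and normal: "mat_adjoint A *\<^sub>v (a - A *\<^sub>v x\<^sub>0) = 0\<^sub>v p"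
    and inj: "\<And>x. x \<in> carrier_vec p \<Longrightarrow> A *\<^sub>v x = 0\<^sub>v n \<Longrightarrow> B *\<^sub>v x = 0\<^sub>v n \<Longrightarrow> x = 0\<^sub>v p"
begin

definition gram :: "'a \<Rightarrow> 'a mat" where
  "gram t = mat_adjoint A * A + t \<cdot>\<^sub>m (mat_adjoint B * B)"

definition h :: "'a vec" where "h = b - B *\<^sub>v x\<^sub>0"

definition w :: "'a vec" where "w = mat_adjoint B *\<^sub>v h"

text \<open>\<open>gram\<close> with \<open>t\<close> as an indeterminate, so that its determinant
  and adjugate are polynomials.\<close>

definition P :: "'a poly mat" where
  "P = mat p p (\<lambda>rs. [:(mat_adjoint A * A) $$ rs, (mat_adjoint B * B) $$ rs:])"

definition d :: "'a poly" where "d = Determinant.det P"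

text \<open>Cramer's numerator for the system with right-hand side \<open>t w\<close>;
  \<open>pCons 0\<close> is the factor \<open>t\<close>.\<close>

definition g :: "nat \<Rightarrow> 'a poly" where
  "g i = pCons 0 (\<Sum>j<p. Polynomial.smult (w $ j) (adj_mat P $$ (i, j)))"

lemma adjoint_carrier [simp]: "mat_adjoint A \<in> carrier_mat p n" "mat_adjoint B \<in> carrier_mat p n"
  using A B by simp_all

lemma gram_carrier [simp]: "gram t \<in> carrier_mat p p"
  using adjoint_carrier A B unfolding gram_def by (intro add_carrier_mat smult_carrier_mat mult_carrier_mat)

lemma h_carrier [simp]: "h \<in> carrier_vec n"
  using b B x\<^sub>0 by (auto simp: h_def)

lemma w_carrier [simp]: "w \<in> carrier_vec p"
  unfolding w_def by (rule mult_mat_vec_carrier[OF adjoint_carrier(2) h_carrier])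

lemma P_carrier [simp]: "P \<in> carrier_mat p p"
  by (simp add: P_def)

lemma dims [simp]:
  "dim_row A = n" "dim_col A = p" "dim_row B = n" "dim_col B = p" "dim_vec h = n" "dim_vec w = p"
  "dim_vec x\<^sub>0 = p" "dim_row (gram t) = p" "dim_col (gram t) = p"
  using A B x\<^sub>0 carrier_vecD[OF h_carrier] carrier_vecD[OF w_carrier] carrier_matD[OF gram_carrier[of t]] by auto

lemma gram_eq_poly: "gram t = map_mat (\<lambda>q. poly q t) P"
  using A B by (intro eq_matI) (auto simp: gram_def P_def)

lemma poly_d: "poly d t = Determinant.det (gram t)"
  unfolding gram_eq_poly d_def comm_ring_hom.hom_det[OF comm_ring_hom_poly] ..

lemma poly_adj: "i < p \<Longrightarrow> j < p \<Longrightarrow> poly (adj_mat P $$ (i, j)) t = adj_mat (gram t) $$ (i, j)"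
  unfolding gram_eq_poly comm_ring_hom.hom_adj_mat[OF comm_ring_hom_poly P_carrier]
  using adj_mat(1)[OF P_carrier] by simp

lemma adj_carrier [simp]:
  "adj_mat (gram t) \<in> carrier_mat p p" "dim_row (adj_mat (gram t)) = p" "dim_col (adj_mat (gram t)) = p"
  using adj_mat(1)[OF gram_carrier] by auto

lemma gram_mult_vec:
  assumes y: "y \<in> carrier_vec p"
  shows "gram t *\<^sub>v y = mat_adjoint A *\<^sub>v (A *\<^sub>v y) + t \<cdot>\<^sub>v (mat_adjoint B *\<^sub>v (B *\<^sub>v y))"
proof -
  have "gram t *\<^sub>v y = (mat_adjoint A * A) *\<^sub>v y + (t \<cdot>\<^sub>m (mat_adjoint B * B)) *\<^sub>v y"
    unfolding gram_def
    by (rule add_mult_distrib_mat_vec[OF mult_carrier_mat[OF adjoint_carrier(1) A] smult_carrier_mat[OF mult_carrier_mat[OF adjoint_carrier(2) B]] y])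
  also have "(t \<cdot>\<^sub>m (mat_adjoint B * B)) *\<^sub>v y = t \<cdot>\<^sub>v ((mat_adjoint B * B) *\<^sub>v y)"
    using y B by (intro eq_vecI) auto
  finally show ?thesis
    by (simp add: assoc_mult_mat_vec[OF adjoint_carrier(1) A y] assoc_mult_mat_vec[OF adjoint_carrier(2) B y])
qed

lemma gram_cscalar_prod:
  assumes y: "y \<in> carrier_vec p" and z: "z \<in> carrier_vec p"
  shows "(gram t *\<^sub>v y) \<bullet>c z = (A *\<^sub>v y) \<bullet>c (A *\<^sub>v z) + t * ((B *\<^sub>v y) \<bullet>c (B *\<^sub>v z))"
proof -
  have c: "A *\<^sub>v y \<in> carrier_vec n" "B *\<^sub>v y \<in> carrier_vec n"
    "mat_adjoint A *\<^sub>v (A *\<^sub>v y) \<in> carrier_vec p" "mat_adjoint B *\<^sub>v (B *\<^sub>v y) \<in> carrier_vec p"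
    using A B y adjoint_carrier by (metis mult_mat_vec_carrier)+
  then show ?thesis
    unfolding gram_mult_vec[OF y]
    using cscalar_prod_mult_mat_vec_right[OF A z c(1)] cscalar_prod_mult_mat_vec_right[OF B z c(2)] z
    by (simp add: add_scalar_prod_distrib[of _ p] smult_scalar_prod_distrib[of _ p])
qed

text \<open>Pairing with \<open>y\<close> gives \<open>|A y|^2 + \<epsilon>^2 |B y|^2 = 0\<close>.
  The positive weight makes both terms vanish, and joint injectivity finishes.\<close>

lemma gram_injective:
  assumes \<epsilon>: "\<epsilon> \<noteq> 0" and y: "y \<in> carrier_vec p" and 0: "gram (of_real (\<epsilon>\<^sup>2)) *\<^sub>v y = 0\<^sub>v p"
  shows "y = 0\<^sub>v p"
proof -
  have "of_real (nsq (A *\<^sub>v y) + \<epsilon>\<^sup>2 * nsq (B *\<^sub>v y)) = (0 :: 'a)"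
    using gram_cscalar_prod[OF y y, of "of_real (\<epsilon>\<^sup>2)"] y by (simp add: 0 cscalar_prod_self del: of_real_power)
  then have "nsq (A *\<^sub>v y) + \<epsilon>\<^sup>2 * nsq (B *\<^sub>v y) = 0" by (simp only: of_real_eq_0_iff)
  then have "nsq (A *\<^sub>v y) = 0" "nsq (B *\<^sub>v y) = 0"
    using \<epsilon> by (auto simp: add_nonneg_eq_0_iff)
  then show ?thesis
    using A B y nsq_eq_0_iff[of "A *\<^sub>v y" n] nsq_eq_0_iff[of "B *\<^sub>v y" n] by (intro inj) auto
qed

lemma poly_d_nonzero: "\<epsilon> \<noteq> 0 \<Longrightarrow> poly d (of_real (\<epsilon>\<^sup>2)) \<noteq> 0"
  unfolding poly_d using det_0_iff_vec_prod_zero_field[OF gram_carrier] gram_injective by blast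

lemma d_nonzero: "d \<noteq> 0"
  using poly_d_nonzero[of 1] by auto

text \<open>The deviation from \<open>x\<^sub>0\<close> of the least squares solution for \<open>A + \<epsilon> B\<close>, by Cramer's rule.\<close>
definition y :: "real \<Rightarrow> 'a vec" where
  "y \<epsilon> = vec p (\<lambda>i. poly (g i) (of_real (\<epsilon>\<^sup>2)) / poly d (of_real (\<epsilon>\<^sup>2)))"

lemma y_carrier [simp]: "y \<epsilon> \<in> carrier_vec p" "dim_vec (y \<epsilon>) = p"
  by (simp_all add: y_def)

lemma poly_g: "i < p \<Longrightarrow> poly (g i) t = t * (adj_mat (gram t) *\<^sub>v w) $ i"
  unfolding mult_mat_vec_sum[OF adj_carrier(1) w_carrier]
  by (simp add: g_def poly_sum poly_adj sum_distrib_left mult_ac)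

lemma gram_mult_y:
  assumes "\<epsilon> \<noteq> 0"
  shows "gram (of_real (\<epsilon>\<^sup>2)) *\<^sub>v y \<epsilon> = of_real (\<epsilon>\<^sup>2) \<cdot>\<^sub>v w"
proof -
  let ?t = "of_real (\<epsilon>\<^sup>2) :: 'a"
  let ?D = "poly d ?t"
  have D: "?D \<noteq> 0" by (rule poly_d_nonzero[OF assms])
  have adjw: "adj_mat (gram ?t) *\<^sub>v w \<in> carrier_vec p"
    by (rule mult_mat_vec_carrier[OF adj_carrier(1) w_carrier])
  have "y \<epsilon> = (?t / ?D) \<cdot>\<^sub>v (adj_mat (gram ?t) *\<^sub>v w)"
    using adjw by (intro eq_vecI) (auto simp: y_def poly_g simp del: index_mult_mat_vec of_real_power)
  then have "gram ?t *\<^sub>v y \<epsilon> = (?t / ?D) \<cdot>\<^sub>v (gram ?t *\<^sub>v (adj_mat (gram ?t) *\<^sub>v w))"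
    by (simp only: mult_mat_vec[OF gram_carrier adjw])
  also have "gram ?t *\<^sub>v (adj_mat (gram ?t) *\<^sub>v w) = (?D \<cdot>\<^sub>m 1\<^sub>m p) *\<^sub>v w"
    by (simp add: assoc_mult_mat_vec[OF gram_carrier adj_carrier(1) w_carrier, symmetric] adj_mat(2)[OF gram_carrier] poly_d)
  also have "\<dots> = ?D \<cdot>\<^sub>v w"
    using w_carrier by (simp add: smult_mat_mult_vec)
  finally show ?thesis using D by (simp add: smult_smult_assoc del: of_real_power)
qed

lemma gram_mult_unique:
  assumes "\<epsilon> \<noteq> 0" and z: "z \<in> carrier_vec p" and eq: "gram (of_real (\<epsilon>\<^sup>2)) *\<^sub>v z = of_real (\<epsilon>\<^sup>2) \<cdot>\<^sub>v w"
  shows "z = y \<epsilon>"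
proof -
  have "gram (of_real (\<epsilon>\<^sup>2)) *\<^sub>v (z - y \<epsilon>) = 0\<^sub>v p"
    unfolding mult_minus_distrib_mat_vec[OF gram_carrier z y_carrier(1)] eq gram_mult_y[OF assms(1)]
    by (intro eq_vecI) auto
  then have 0: "z - y \<epsilon> = 0\<^sub>v p"
    by (rule gram_injective[OF assms(1) minus_carrier_vec[OF z y_carrier(1)]])
  have "z = (z - y \<epsilon>) + y \<epsilon>" using z by (intro eq_vecI) auto
  also have "\<dots> = y \<epsilon>" unfolding 0 by simp
  finally show ?thesis .
qed

text \<open>Joint injectivity means that \<open>A\<close> stacked on \<open>B\<close> has full
  column rank. A left inverse is the inverse of \<open>A^H A + B^H B\<close>, written through the
  adjugate of \<open>gram 1\<close>, times the row of blocks \<open>A^H\<close>, \<open>B^H\<close>.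
  It turns bounds on \<open>A y\<close> and \<open>B y\<close> into bounds on
  \<open>y\<close>.\<close>

lemma ex_left_inverse:
  obtains L\<^sub>1 L\<^sub>2 where "L\<^sub>1 \<in> carrier_mat p n" "L\<^sub>2 \<in> carrier_mat p n"
    "\<And>z. z \<in> carrier_vec p \<Longrightarrow> z = L\<^sub>1 *\<^sub>v (A *\<^sub>v z) + L\<^sub>2 *\<^sub>v (B *\<^sub>v z)"
proof -
  let ?D = "poly d 1" and ?J = "adj_mat (gram 1)"
  have D: "?D \<noteq> 0" using poly_d_nonzero[of 1] by simp
  let ?K = "(1 / ?D) \<cdot>\<^sub>m ?J"
  have K: "?K \<in> carrier_mat p p" by simp
  have "z = (?K * mat_adjoint A) *\<^sub>v (A *\<^sub>v z) + (?K * mat_adjoint B) *\<^sub>v (B *\<^sub>v z)" if z: "z \<in> carrier_vec p" for z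
  proof -
    have Az: "A *\<^sub>v z \<in> carrier_vec n" "B *\<^sub>v z \<in> carrier_vec n" using A B z by auto
    have c: "mat_adjoint A *\<^sub>v (A *\<^sub>v z) \<in> carrier_vec p" "mat_adjoint B *\<^sub>v (B *\<^sub>v z) \<in> carrier_vec p"
      using mult_mat_vec_carrier[OF adjoint_carrier(1) Az(1)] mult_mat_vec_carrier[OF adjoint_carrier(2) Az(2)] by auto
    have "z = (1 / ?D) \<cdot>\<^sub>v ((?D \<cdot>\<^sub>m 1\<^sub>m p) *\<^sub>v z)"
      using z D by (simp add: smult_mat_mult_vec smult_smult_assoc)
    also have "?D \<cdot>\<^sub>m 1\<^sub>m p = ?J * gram 1"
      by (simp add: adj_mat(3)[OF gram_carrier] poly_d)
    also have "(1 / ?D) \<cdot>\<^sub>v ((?J * gram 1) *\<^sub>v z) = ?K *\<^sub>v (gram 1 *\<^sub>v z)"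
      using mult_mat_vec_carrier[OF gram_carrier z, of 1]
      by (simp only: assoc_mult_mat_vec[OF adj_carrier(1) gram_carrier z]) (simp add: smult_mat_mult_vec)
    also have "gram 1 *\<^sub>v z = mat_adjoint A *\<^sub>v (A *\<^sub>v z) + mat_adjoint B *\<^sub>v (B *\<^sub>v z)"
      using gram_mult_vec[OF z, of 1] c by simp
    finally show ?thesis
      by (simp only: mult_add_distrib_mat_vec[OF K c] assoc_mult_mat_vec[OF K adjoint_carrier(1) Az(1)]
          assoc_mult_mat_vec[OF K adjoint_carrier(2) Az(2)])
  qed
  then show ?thesis
    by (rule that[of "?K * mat_adjoint A" "?K * mat_adjoint B", rotated 2])
      (use mult_carrier_mat[OF K adjoint_carrier(1)] mult_carrier_mat[OF K adjoint_carrier(2)] in auto)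
qed

text \<open>Weak form of the equation for \<open>y\<close>. Testing with \<open>z = y\<close> gives
  the energy identity; testing with \<open>z\<close> in \<open>ker A\<close> removes the first term
  and lets \<open>\<epsilon>\<^sup>2\<close> cancel.\<close>

lemma smult_mult_cscalar_y:
  assumes "\<epsilon> \<noteq> 0" and z: "z \<in> carrier_vec p"
  shows "(A *\<^sub>v y \<epsilon>) \<bullet>c (A *\<^sub>v z) + of_real (\<epsilon>\<^sup>2) * ((B *\<^sub>v y \<epsilon>) \<bullet>c (B *\<^sub>v z)) = of_real (\<epsilon>\<^sup>2) * (h \<bullet>c (B *\<^sub>v z))"
  unfolding gram_cscalar_prod[OF y_carrier(1) z, symmetric] gram_mult_y[OF assms(1)]
  using z w_carrier cscalar_prod_mult_mat_vec_right[OF B z h_carrier]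
  by (simp add: smult_scalar_prod_distrib[of _ p] w_def)

text \<open>By the energy identity, \<open>r = h - B y\<close> has inner product
  \<open>|A y|^2 / \<epsilon>^2\<close> with \<open>B y\<close>. This is a nonnegative real, so
  expanding \<open>|h|^2 = |r + B y|^2\<close> gives a sum of nonnegative terms.\<close>

lemma nsq_y_bounds:
  assumes "\<epsilon> \<noteq> 0"
  shows "nsq (B *\<^sub>v y \<epsilon>) \<le> nsq h" "nsq (A *\<^sub>v y \<epsilon>) \<le> \<epsilon>\<^sup>2 * nsq h"
proof -
  define r where "r = h - B *\<^sub>v y \<epsilon>"
  have By: "B *\<^sub>v y \<epsilon> \<in> carrier_vec n" by (rule mult_mat_vec_carrier[OF B y_carrier(1)])
  have r: "r \<in> carrier_vec n" using By by (simp add: r_def)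
  have h: "h = r + B *\<^sub>v y \<epsilon>" using By h_carrier by (intro eq_vecI) (auto simp: r_def)
  have "of_real (\<epsilon>\<^sup>2) * (r \<bullet>c (B *\<^sub>v y \<epsilon>)) = of_real (nsq (A *\<^sub>v y \<epsilon>))"
    using smult_mult_cscalar_y[OF assms y_carrier(1)[of \<epsilon>]] By h_carrier
    by (simp add: r_def minus_scalar_prod_distrib[of _ n] cscalar_prod_self algebra_simps)
  then have "r \<bullet>c (B *\<^sub>v y \<epsilon>) = of_real (nsq (A *\<^sub>v y \<epsilon>) / \<epsilon>\<^sup>2)"
    using assms by (simp add: field_simps)
  then have "nsq h = nsq r + nsq (B *\<^sub>v y \<epsilon>) + 2 * (nsq (A *\<^sub>v y \<epsilon>) / \<epsilon>\<^sup>2)"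
    unfolding h by (rule nsq_add[OF r By])
  moreover have "nsq (A *\<^sub>v y \<epsilon>) / \<epsilon>\<^sup>2 \<ge> 0" by simp
  ultimately have "nsq (B *\<^sub>v y \<epsilon>) \<le> nsq h" "nsq (A *\<^sub>v y \<epsilon>) / \<epsilon>\<^sup>2 \<le> nsq h"
    using nsq_nonneg[of r] nsq_nonneg[of "B *\<^sub>v y \<epsilon>"] by linarith+
  then show "nsq (B *\<^sub>v y \<epsilon>) \<le> nsq h" "nsq (A *\<^sub>v y \<epsilon>) \<le> \<epsilon>\<^sup>2 * nsq h"
    using assms by (simp_all add: divide_le_eq mult.commute)
qed

text \<open>The range \<open>\<bar>\<epsilon>\<bar> \<le> 1\<close> turns the bound
  \<open>\<epsilon>^2 |h|^2\<close> on \<open>|A y|^2\<close> into one that is uniform in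
  \<open>\<epsilon>\<close>.\<close>

lemma y_bounded:
  obtains K where "\<And>\<epsilon> i. \<epsilon> \<noteq> 0 \<Longrightarrow> \<bar>\<epsilon>\<bar> \<le> 1 \<Longrightarrow> i < p \<Longrightarrow> norm (y \<epsilon> $ i) \<le> K i"
proof -
  obtain L\<^sub>1 L\<^sub>2 where L: "L\<^sub>1 \<in> carrier_mat p n" "L\<^sub>2 \<in> carrier_mat p n"
    and inv: "\<And>z. z \<in> carrier_vec p \<Longrightarrow> z = L\<^sub>1 *\<^sub>v (A *\<^sub>v z) + L\<^sub>2 *\<^sub>v (B *\<^sub>v z)"
    using ex_left_inverse by blast
  let ?s = "\<lambda>L i. \<Sum>k<n. norm (L $$ (i, k))"
  have "norm (y \<epsilon> $ i) \<le> ?s L\<^sub>1 i * sqrt (nsq h) + ?s L\<^sub>2 i * sqrt (nsq h)"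
    if \<epsilon>: "\<epsilon> \<noteq> 0" "\<bar>\<epsilon>\<bar> \<le> 1" and i: "i < p" for \<epsilon> i
  proof -
    have Ay: "A *\<^sub>v y \<epsilon> \<in> carrier_vec n" "B *\<^sub>v y \<epsilon> \<in> carrier_vec n"
      using mult_mat_vec_carrier[OF A y_carrier(1)] mult_mat_vec_carrier[OF B y_carrier(1)] by auto
    have "nsq (A *\<^sub>v y \<epsilon>) \<le> \<epsilon>\<^sup>2 * nsq h" by (rule nsq_y_bounds(2)[OF \<epsilon>(1)])
    also have "\<dots> \<le> 1 * nsq h" using \<epsilon>(2) by (intro mult_right_mono) (auto simp: abs_square_le_1)
    finally have le: "nsq (A *\<^sub>v y \<epsilon>) \<le> nsq h" "nsq (B *\<^sub>v y \<epsilon>) \<le> nsq h"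
      using nsq_y_bounds(1)[OF \<epsilon>(1)] by simp_all
    have "y \<epsilon> $ i = (L\<^sub>1 *\<^sub>v (A *\<^sub>v y \<epsilon>)) $ i + (L\<^sub>2 *\<^sub>v (B *\<^sub>v y \<epsilon>)) $ i"
      using inv[OF y_carrier(1)[of \<epsilon>]] i L by (metis carrier_matD(1) dim_mult_mat_vec index_add_vec(1))
    also have "norm \<dots> \<le> norm ((L\<^sub>1 *\<^sub>v (A *\<^sub>v y \<epsilon>)) $ i) + norm ((L\<^sub>2 *\<^sub>v (B *\<^sub>v y \<epsilon>)) $ i)"
      by (rule norm_triangle_ineq)
    also have "\<dots> \<le> ?s L\<^sub>1 i * sqrt (nsq (A *\<^sub>v y \<epsilon>)) + ?s L\<^sub>2 i * sqrt (nsq (B *\<^sub>v y \<epsilon>))"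
      by (intro add_mono norm_mult_mat_vec_le[OF L(1) Ay(1) i] norm_mult_mat_vec_le[OF L(2) Ay(2) i])
    also have "\<dots> \<le> ?s L\<^sub>1 i * sqrt (nsq h) + ?s L\<^sub>2 i * sqrt (nsq h)"
      by (intro add_mono mult_left_mono real_sqrt_le_mono le sum_nonneg) auto
    finally show ?thesis .
  qed
  then show ?thesis by (rule that)
qed

section \<open>The limit of the deviation\<close>

definition l :: nat where "l = (LEAST k. coeff d k \<noteq> 0)"

lemma coeff_d_l: "coeff d l \<noteq> 0" "k < l \<Longrightarrow> coeff d k = 0"
proof -
  show "coeff d l \<noteq> 0" unfolding l_def
    by (rule LeastI_ex) (use d_nonzero leading_coeff_0_iff in blast)
  show "k < l \<Longrightarrow> coeff d k = 0" unfolding l_def using not_less_Least by blast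
qed

text \<open>Ensures that the first nonzero coefficient of the determinant lies in the range
  \<open>{0..p}\<close> searched by \<open>vanishing_order\<close>.\<close>

lemma degree_d: "degree d \<le> p"
  unfolding d_def using degree_det_le[of p P 1] by (simp add: P_def)

definition y\<^sub>0 :: "'a vec" where "y\<^sub>0 = vec p (\<lambda>i. coeff (g i) l / coeff d l)"

lemma y\<^sub>0_carrier [simp]: "y\<^sub>0 \<in> carrier_vec p" "dim_vec y\<^sub>0 = p"
  by (simp_all add: y\<^sub>0_def)

lemma y_tendsto:
  assumes i: "i < p"
  shows "((\<lambda>\<epsilon>. y \<epsilon> $ i) \<longlongrightarrow> y\<^sub>0 $ i) (at 0)"
proof -
  obtain K where K: "\<And>\<epsilon> i. \<epsilon> \<noteq> 0 \<Longrightarrow> \<bar>\<epsilon>\<bar> \<le> 1 \<Longrightarrow> i < p \<Longrightarrow> norm (y \<epsilon> $ i) \<le> K i"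
    using y_bounded by blast
  have "((\<lambda>\<epsilon>::real. poly (g i) (of_real (\<epsilon>\<^sup>2)) / poly d (of_real (\<epsilon>\<^sup>2))) \<longlongrightarrow> coeff (g i) l / coeff d l) (at 0)"
  proof (rule tendsto_bounded_poly_quotient)
    have "\<forall>\<^sub>F \<epsilon> in at (0::real). \<epsilon> \<noteq> 0" by (rule eventually_neq_at_within)
    moreover have "\<forall>\<^sub>F \<epsilon> in at (0::real). \<bar>\<epsilon>\<bar> \<le> 1"
      unfolding eventually_at by (intro exI[of _ 1]) (auto simp: dist_real_def)
    ultimately show "\<forall>\<^sub>F \<epsilon> in at (0::real). norm (poly (g i) (of_real (\<epsilon>\<^sup>2))) \<le> K i * norm (poly d (of_real (\<epsilon>\<^sup>2)))"
    proof eventually_elim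
      case (elim \<epsilon>)
      have "norm (poly (g i) (of_real (\<epsilon>\<^sup>2))) / norm (poly d (of_real (\<epsilon>\<^sup>2))) \<le> K i"
        using K[OF elim i] i by (simp add: y_def norm_divide del: of_real_power)
      then show ?case using poly_d_nonzero[OF elim(1)] by (simp add: divide_le_eq del: of_real_power)
    qed
  qed (use coeff_d_l in auto)
  then show ?thesis using i by (simp add: y_def y\<^sub>0_def)
qed

lemma mult_y_tendsto:
  assumes M: "M \<in> carrier_mat q p" and k: "k < q"
  shows "((\<lambda>\<epsilon>. (M *\<^sub>v y \<epsilon>) $ k) \<longlongrightarrow> (M *\<^sub>v y\<^sub>0) $ k) (at 0)"
  unfolding mult_mat_vec_sum[OF M y_carrier(1) k] mult_mat_vec_sum[OF M y\<^sub>0_carrier(1) k]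
  by (intro tendsto_intros y_tendsto) auto

lemma cscalar_mult_y_tendsto:
  assumes M: "M \<in> carrier_mat n p" and v: "v \<in> carrier_vec n"
  shows "((\<lambda>\<epsilon>. (M *\<^sub>v y \<epsilon>) \<bullet>c v) \<longlongrightarrow> (M *\<^sub>v y\<^sub>0) \<bullet>c v) (at 0)"
  unfolding cscalar_prod_sum[OF mult_mat_vec_carrier[OF M y_carrier(1)] v]
    cscalar_prod_sum[OF mult_mat_vec_carrier[OF M y\<^sub>0_carrier(1)] v]
  by (intro tendsto_intros mult_y_tendsto[OF M]) auto

text \<open>By the energy bound, \<open>A y\<close> is of order
  \<open>\<bar>\<epsilon>\<bar>\<close>.\<close>

lemma A_y\<^sub>0: "A *\<^sub>v y\<^sub>0 = 0\<^sub>v n"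
proof (rule eq_vecI)
  fix k assume "k < dim_vec (0\<^sub>v n)"
  then have k: "k < n" by simp
  have "((\<lambda>\<epsilon>. (A *\<^sub>v y \<epsilon>) $ k) \<longlongrightarrow> 0) (at 0)"
  proof (rule Lim_null_comparison)
    have "norm ((A *\<^sub>v y \<epsilon>) $ k) \<le> \<bar>\<epsilon>\<bar> * sqrt (nsq h)" if "\<epsilon> \<noteq> 0" for \<epsilon>
    proof -
      have "(norm ((A *\<^sub>v y \<epsilon>) $ k))\<^sup>2 \<le> nsq (A *\<^sub>v y \<epsilon>)"
        unfolding nsq_def using k by (intro member_le_sum) auto
      also have "\<dots> \<le> (\<bar>\<epsilon>\<bar> * sqrt (nsq h))\<^sup>2"
        using nsq_y_bounds(2)[OF that] by (simp add: power_mult_distrib)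
      finally show ?thesis by (rule power2_le_imp_le) simp
    qed
    then show "\<forall>\<^sub>F \<epsilon> in at 0. norm ((A *\<^sub>v y \<epsilon>) $ k) \<le> \<bar>\<epsilon>\<bar> * sqrt (nsq h)"
      by (auto simp: eventually_at_filter)
    have "((\<lambda>\<epsilon>::real. \<bar>\<epsilon>\<bar> * sqrt (nsq h)) \<longlongrightarrow> \<bar>0\<bar> * sqrt (nsq h)) (at 0)"
      by (intro tendsto_intros)
    then show "((\<lambda>\<epsilon>::real. \<bar>\<epsilon>\<bar> * sqrt (nsq h)) \<longlongrightarrow> 0) (at 0)" by simp
  qed
  with mult_y_tendsto[OF A k] have "(A *\<^sub>v y\<^sub>0) $ k = 0"
    by (intro tendsto_unique[of "at (0::real)"]) auto
  then show "(A *\<^sub>v y\<^sub>0) $ k = 0\<^sub>v n $ k" using k by simp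
qed simp

text \<open>In this form the condition does not involve the order of vanishing \<open>l\<close>, which depends on \<open>B\<close>.\<close>
lemma y\<^sub>0_eq_0_iff:
  "y\<^sub>0 = 0\<^sub>v p \<longleftrightarrow> (\<forall>z\<in>carrier_vec p. A *\<^sub>v z = 0\<^sub>v n \<longrightarrow> h \<bullet>c (B *\<^sub>v z) = 0)"
proof -
  \<comment> \<open>The weak form tested on \<open>ker A\<close>, divided by
    \<open>\<epsilon>\<^sup>2\<close>, is constant in \<open>\<epsilon>\<close>. In the limit it
    says that \<open>h - B y\<^sub>0\<close> is orthogonal to \<open>B (ker A)\<close>.\<close>
  have lim: "h \<bullet>c (B *\<^sub>v z) = (B *\<^sub>v y\<^sub>0) \<bullet>c (B *\<^sub>v z)" if z: "z \<in> carrier_vec p" "A *\<^sub>v z = 0\<^sub>v n" for z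
  proof -
    have "(B *\<^sub>v y \<epsilon>) \<bullet>c (B *\<^sub>v z) = h \<bullet>c (B *\<^sub>v z)" if "\<epsilon> \<noteq> 0" for \<epsilon>
    proof -
      have "of_real (\<epsilon>\<^sup>2) * ((B *\<^sub>v y \<epsilon>) \<bullet>c (B *\<^sub>v z)) = of_real (\<epsilon>\<^sup>2) * (h \<bullet>c (B *\<^sub>v z))"
        using smult_mult_cscalar_y[OF that z(1)] mult_mat_vec_carrier[OF A y_carrier(1)] by (simp add: z(2))
      then show ?thesis using that by simp
    qed
    then have "((\<lambda>\<epsilon>. (B *\<^sub>v y \<epsilon>) \<bullet>c (B *\<^sub>v z)) \<longlongrightarrow> h \<bullet>c (B *\<^sub>v z)) (at 0)"
      by (intro tendsto_eventually) (auto simp: eventually_at_filter)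
    with cscalar_mult_y_tendsto[OF B mult_mat_vec_carrier[OF B z(1)]] show ?thesis
      by (intro tendsto_unique[of "at (0::real)"]) auto
  qed
  show ?thesis
  proof
    assume 0: "y\<^sub>0 = 0\<^sub>v p"
    have "B *\<^sub>v y\<^sub>0 = 0\<^sub>v n" unfolding 0 using B by (intro eq_vecI) auto
    then show "\<forall>z\<in>carrier_vec p. A *\<^sub>v z = 0\<^sub>v n \<longrightarrow> h \<bullet>c (B *\<^sub>v z) = 0"
      using lim B by auto
  next
    assume "\<forall>z\<in>carrier_vec p. A *\<^sub>v z = 0\<^sub>v n \<longrightarrow> h \<bullet>c (B *\<^sub>v z) = 0"
    \<comment> \<open>\<open>y\<^sub>0\<close> lies in \<open>ker A\<close>, so it is itself an
      admissible test vector.\<close>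
    then have "(B *\<^sub>v y\<^sub>0) \<bullet>c (B *\<^sub>v y\<^sub>0) = 0" using lim[OF y\<^sub>0_carrier(1) A_y\<^sub>0] A_y\<^sub>0 by simp
    then have "B *\<^sub>v y\<^sub>0 = 0\<^sub>v n"
      using nsq_eq_0_iff[OF mult_mat_vec_carrier[OF B y\<^sub>0_carrier(1)]] by (simp add: cscalar_prod_self)
    then show "y\<^sub>0 = 0\<^sub>v p" by (rule inj[OF y\<^sub>0_carrier(1) A_y\<^sub>0])
  qed
qed

section \<open>Derivatives at 0 as polynomial coefficients\<close>

definition adj_deriv :: "nat \<Rightarrow> 'a mat" where
  "adj_deriv k = mat p p (\<lambda>rs. (deriv ^^ k) (\<lambda>t. adj_mat (gram t) $$ rs) 0)"

lemma adj_deriv_carrier [simp]: "adj_deriv k \<in> carrier_mat p p"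
  by (simp add: adj_deriv_def)

lemma adj_deriv_index:
  assumes "r < p" "s < p"
  shows "adj_deriv k $$ (r, s) = fact k * coeff (adj_mat P $$ (r, s)) k"
proof -
  have "(\<lambda>t. adj_mat (gram t) $$ (r, s)) = poly (adj_mat P $$ (r, s))"
    using assms by (simp add: poly_adj fun_eq_iff)
  then show ?thesis using assms by (simp add: adj_deriv_def higher_deriv_poly_0)
qed

text \<open>Jacobi's formula for \<open>d\<close>, read at the coefficient of \<open>t^k\<close>:
  the entries of \<open>P\<close> are linear in \<open>t\<close>, with derivative
  \<open>B^H B\<close>. The factor \<open>Suc k\<close> from \<open>pderiv\<close> completes the
  factorial.\<close>

lemma trace_adj_deriv:
  "sum_list (diag_mat (adj_deriv k * (mat_adjoint B * B))) = fact (Suc k) * coeff d (Suc k)"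
proof -
  let ?N = "mat_adjoint B * B"
  have N: "?N \<in> carrier_mat p p" by (rule mult_carrier_mat[OF adjoint_carrier(2) B])
  have "sum_list (diag_mat (adj_deriv k * ?N)) = (\<Sum>i<p. (adj_deriv k * ?N) $$ (i, i))"
    by (simp add: diag_mat_def adj_deriv_def interv_sum_list_conv_sum_set_nat atLeast0LessThan)
  also have "\<dots> = (\<Sum>i<p. \<Sum>j<p. adj_deriv k $$ (i, j) * ?N $$ (j, i))"
    by (intro sum.cong refl) (simp only: mult_mat_index_sum[OF adj_deriv_carrier N] lessThan_iff)
  also have "\<dots> = fact k * (\<Sum>i<p. \<Sum>j<p. ?N $$ (j, i) * coeff (adj_mat P $$ (i, j)) k)"
    by (simp add: adj_deriv_index sum_distrib_left mult_ac)
  also have "(\<Sum>i<p. \<Sum>j<p. ?N $$ (j, i) * coeff (adj_mat P $$ (i, j)) k)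
      = (\<Sum>j<p. \<Sum>i<p. ?N $$ (j, i) * coeff (adj_mat P $$ (i, j)) k)"
    by (rule sum.swap)
  also have "\<dots> = coeff (pderiv d) k"
    unfolding d_def pderiv_det[OF P_carrier] by (simp add: P_def pderiv_pCons coeff_sum)
  also have "\<dots> = of_nat (Suc k) * coeff d (Suc k)" by (simp add: coeff_pderiv)
  finally show ?thesis by (simp add: mult_ac)
qed

text \<open>The normal equation for \<open>x\<^sub>0\<close> gives
  \<open>A^H a + t B^H b = gram t x\<^sub>0 + t w\<close>. Multiplying by the adjugate splits
  Cramer's numerator for the whole solution into the parts of \<open>x\<^sub>0\<close> and of the
  deviation.\<close>

lemma adj_numerator:
  assumes i: "i < p"
  shows "(\<Sum>j<p. adj_mat P $$ (i, j) * [:(mat_adjoint A *\<^sub>v a) $ j, (mat_adjoint B *\<^sub>v b) $ j:])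
    = Polynomial.smult (x\<^sub>0 $ i) d + g i" (is "?L = ?R")
proof -
  have "poly ?L t = poly ?R t" for t
  proof -
    let ?r = "mat_adjoint A *\<^sub>v a + t \<cdot>\<^sub>v (mat_adjoint B *\<^sub>v b)"
    have Aa: "mat_adjoint A *\<^sub>v a \<in> carrier_vec p" and Bb: "mat_adjoint B *\<^sub>v b \<in> carrier_vec p"
      using mult_mat_vec_carrier[OF adjoint_carrier(1) a] mult_mat_vec_carrier[OF adjoint_carrier(2) b] by auto
    have Ax: "A *\<^sub>v x\<^sub>0 \<in> carrier_vec n" and Bx: "B *\<^sub>v x\<^sub>0 \<in> carrier_vec n" using A B x\<^sub>0 by auto
    have 1: "mat_adjoint A *\<^sub>v a = mat_adjoint A *\<^sub>v (A *\<^sub>v x\<^sub>0)"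
    proof (rule eq_vecI)
      fix k assume "k < dim_vec (mat_adjoint A *\<^sub>v (A *\<^sub>v x\<^sub>0))"
      then have "k < p" by simp
      then have "(mat_adjoint A *\<^sub>v a - mat_adjoint A *\<^sub>v (A *\<^sub>v x\<^sub>0)) $ k = 0"
        using normal unfolding mult_minus_distrib_mat_vec[OF adjoint_carrier(1) a Ax] by simp
      then show "(mat_adjoint A *\<^sub>v a) $ k = (mat_adjoint A *\<^sub>v (A *\<^sub>v x\<^sub>0)) $ k"
        using \<open>k < p\<close> by (simp del: index_mult_mat_vec)
    qed simp
    have w: "w = mat_adjoint B *\<^sub>v b - mat_adjoint B *\<^sub>v (B *\<^sub>v x\<^sub>0)"
      unfolding w_def h_def by (rule mult_minus_distrib_mat_vec[OF adjoint_carrier(2) b Bx])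
    have r: "?r = gram t *\<^sub>v x\<^sub>0 + t \<cdot>\<^sub>v w"
      unfolding gram_mult_vec[OF x\<^sub>0] 1 w
      by (intro eq_vecI) (auto simp: algebra_simps simp del: index_mult_mat_vec)
    have gx: "gram t *\<^sub>v x\<^sub>0 \<in> carrier_vec p" by (rule mult_mat_vec_carrier[OF gram_carrier x\<^sub>0])
    have "adj_mat (gram t) *\<^sub>v ?r = adj_mat (gram t) *\<^sub>v (gram t *\<^sub>v x\<^sub>0) + adj_mat (gram t) *\<^sub>v (t \<cdot>\<^sub>v w)"
      unfolding r by (rule mult_add_distrib_mat_vec[OF adj_carrier(1) gx iffD2[OF smult_carrier_vec w_carrier]])
    also have "adj_mat (gram t) *\<^sub>v (gram t *\<^sub>v x\<^sub>0) = poly d t \<cdot>\<^sub>v x\<^sub>0"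
      using x\<^sub>0 unfolding assoc_mult_mat_vec[OF adj_carrier(1) gram_carrier x\<^sub>0, symmetric] adj_mat(3)[OF gram_carrier]
      by (simp add: smult_mat_mult_vec poly_d)
    also have "adj_mat (gram t) *\<^sub>v (t \<cdot>\<^sub>v w) = t \<cdot>\<^sub>v (adj_mat (gram t) *\<^sub>v w)"
      by (rule mult_mat_vec[OF adj_carrier(1) w_carrier])
    finally have "(adj_mat (gram t) *\<^sub>v ?r) $ i = poly ?R t"
      using i by (simp add: poly_g del: index_mult_mat_vec)
    moreover have "?r \<in> carrier_vec p" using Aa Bb by simp
    then have "(adj_mat (gram t) *\<^sub>v ?r) $ i = poly ?L t"
      unfolding mult_mat_vec_sum[OF adj_carrier(1) \<open>?r \<in> _\<close> i]
      using i carrier_vecD[OF Aa] carrier_vecD[OF Bb] by (simp add: poly_sum poly_adj algebra_simps sum.distrib del: index_mult_mat_vec)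
    ultimately show ?thesis by simp
  qed
  \<comment> \<open>Polynomials over an infinite field are determined by their values.\<close>
  then show ?thesis by (simp only: flip: poly_eq_poly_eq_iff) (simp add: fun_eq_iff)
qed

text \<open>The \<open>k\<close>-th coefficient of \<open>adj_numerator\<close>, times
  \<open>fact k\<close>. The second summand comes from the part linear in \<open>t\<close>, where
  \<open>k! = k (k - 1)!\<close>; for \<open>k = 0\<close> the factor \<open>of_nat k\<close>
  discards the truncated index \<open>k - 1\<close>.\<close>

lemma adj_deriv_numerator:
  assumes i: "i < p"
  shows "(adj_deriv k *\<^sub>v (mat_adjoint A *\<^sub>v a)) $ i
      + of_nat k * (adj_deriv (k - 1) *\<^sub>v (mat_adjoint B *\<^sub>v b)) $ i
    = fact k * (coeff d k * x\<^sub>0 $ i + coeff (g i) k)"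
proof -
  let ?u = "mat_adjoint A *\<^sub>v a" and ?v = "mat_adjoint B *\<^sub>v b"
  have u: "?u \<in> carrier_vec p" and v: "?v \<in> carrier_vec p"
    using mult_mat_vec_carrier[OF adjoint_carrier(1) a] mult_mat_vec_carrier[OF adjoint_carrier(2) b] by auto
  have "coeff (q * [:c, e:]) k = coeff q k * c + (if k = 0 then 0 else coeff q (k - 1) * e)" for q :: "'a poly" and c e
    by (cases k) (simp_all add: mult.commute)
  then have "fact k * coeff (\<Sum>j<p. adj_mat P $$ (i, j) * [:?u $ j, ?v $ j:]) k
    = (\<Sum>j<p. fact k * (coeff (adj_mat P $$ (i, j)) k * ?u $ j))
      + (\<Sum>j<p. fact k * (if k = 0 then 0 else coeff (adj_mat P $$ (i, j)) (k - 1) * ?v $ j))"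
    by (simp only: coeff_sum sum_distrib_left flip: sum.distrib) (simp add: distrib_left)
  also have "(\<Sum>j<p. fact k * (coeff (adj_mat P $$ (i, j)) k * ?u $ j)) = (adj_deriv k *\<^sub>v ?u) $ i"
    unfolding mult_mat_vec_sum[OF adj_deriv_carrier u i] using i
    by (intro sum.cong refl) (simp add: adj_deriv_index)
  also have "(\<Sum>j<p. fact k * (if k = 0 then 0 else coeff (adj_mat P $$ (i, j)) (k - 1) * ?v $ j))
    = of_nat k * (adj_deriv (k - 1) *\<^sub>v ?v) $ i"
    unfolding mult_mat_vec_sum[OF adj_deriv_carrier v i] sum_distrib_left using i
    by (intro sum.cong refl) (cases k; simp add: adj_deriv_index del: index_mult_mat_vec)
  finally show ?thesis
    unfolding adj_numerator[OF i] by (simp add: mult.commute)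
qed

end

subsection \<open>Maximum likelihood estimates as least squares solutions\<close>

lemma pa_subset: "dag_on m E \<Longrightarrow> pa E i \<subseteq> {..<m}"
  by (auto simp: dag_on_def pa_def)

lemma finite_pa: "dag_on m E \<Longrightarrow> finite (pa E i)"
  by (rule finite_subset[OF pa_subset]) simp_all

lemma not_in_pa_self: "dag_on m E \<Longrightarrow> i \<notin> pa E i"
  by (auto simp: dag_on_def pa_def acyclic_def)

lemma length_parents [simp]: "length (parents E i) = card (pa E i)"
  by (simp add: parents_def)

lemma bij_betw_parents: "dag_on m E \<Longrightarrow> bij_betw ((!) (parents E i)) {..<card (pa E i)} (pa E i)"
  using finite_pa[of m E i] by (intro bij_betw_nth) (simp_all add: parents_def)

lemma parents_nth_in: "dag_on m E \<Longrightarrow> r < card (pa E i) \<Longrightarrow> parents E i ! r \<in> pa E i"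
  using bij_betw_parents[of m E i] by (auto simp: bij_betw_def)

lemma parents_nth_less: "dag_on m E \<Longrightarrow> r < card (pa E i) \<Longrightarrow> parents E i ! r < m"
  using parents_nth_in pa_subset by blast

lemma parent_cols_carrier [simp]:
  "Y \<in> carrier_mat n m \<Longrightarrow> parent_cols E Y i \<in> carrier_mat n (card (pa E i))"
  unfolding parent_cols_def by (metis carrier_matD(1) length_map length_parents mat_of_cols_carrier(1))

lemma edge_vec_carrier [simp]:
  "edge_vec E \<Lambda> i \<in> carrier_vec (card (pa E i))" "dim_vec (edge_vec E \<Lambda> i) = card (pa E i)"
  by (auto simp: edge_vec_def intro: carrier_vecI)

lemma edge_vec_index: "r < card (pa E i) \<Longrightarrow> edge_vec E \<Lambda> i $ r = \<Lambda> $$ (i, parents E i ! r)"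
  by (simp add: edge_vec_def vec_of_list_index)

lemma parent_cols_index:
  assumes "dag_on m E" "Y \<in> carrier_mat n m" "k < n" "r < card (pa E i)"
  shows "parent_cols E Y i $$ (k, r) = Y $$ (k, parents E i ! r)"
  using assms parents_nth_less[OF assms(1,4)] by (simp add: parent_cols_def mat_of_cols_index)

text \<open>Zero extension of a parent-indexed vector to all vertices. It turns statements about
  parent columns into statements about the whole sample matrix, to which the conditions on a
  perturbation refer.\<close>

definition spread :: "nat \<Rightarrow> (nat \<times> nat) set \<Rightarrow> nat \<Rightarrow> 'a::zero vec \<Rightarrow> 'a vec" where
  "spread m E i x = vec m (\<lambda>j. if j \<in> pa E i
     then x $ inv_into {..<card (pa E i)} ((!) (parents E i)) j else 0)"

lemma spread_carrier [simp]: "spread m E i x \<in> carrier_vec m" "dim_vec (spread m E i x) = m"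
  by (simp_all add: spread_def)

lemma spread_index:
  assumes "dag_on m E"
  shows "r < card (pa E i) \<Longrightarrow> spread m E i x $ (parents E i ! r) = x $ r"
    and "j < m \<Longrightarrow> j \<notin> pa E i \<Longrightarrow> spread m E i x $ j = 0"
  using parents_nth_less[OF assms] parents_nth_in[OF assms] bij_betw_parents[OF assms, of i]
  by (auto simp: spread_def bij_betw_def)

lemma sum_parents:
  "dag_on m E \<Longrightarrow> (\<Sum>j\<in>pa E i. F j) = (\<Sum>r<card (pa E i). F (parents E i ! r))"
  by (rule sum.reindex_bij_betw[OF bij_betw_parents, symmetric])

lemma mult_spread:
  fixes Y :: "'a::comm_ring_1 mat"
  assumes E: "dag_on m E" and Y: "Y \<in> carrier_mat n m" and x: "x \<in> carrier_vec (card (pa E i))"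
  shows "Y *\<^sub>v spread m E i x = parent_cols E Y i *\<^sub>v x"
proof (rule eq_vecI)
  have PC: "parent_cols E Y i \<in> carrier_mat n (card (pa E i))" using Y by simp
  fix k assume "k < dim_vec (parent_cols E Y i *\<^sub>v x)"
  then have k: "k < n" using PC by simp
  have "(Y *\<^sub>v spread m E i x) $ k = (\<Sum>j<m. Y $$ (k, j) * spread m E i x $ j)"
    by (rule mult_mat_vec_sum[OF Y spread_carrier(1) k])
  also have "\<dots> = (\<Sum>j\<in>pa E i. Y $$ (k, j) * spread m E i x $ j)"
    using pa_subset[OF E] by (intro sum.mono_neutral_right) (auto simp: spread_index(2)[OF E])
  also have "\<dots> = (\<Sum>r<card (pa E i). parent_cols E Y i $$ (k, r) * x $ r)"
    unfolding sum_parents[OF E] by (simp add: spread_index(1)[OF E] parent_cols_index[OF E Y k])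
  also have "\<dots> = (parent_cols E Y i *\<^sub>v x) $ k"
    by (rule mult_mat_vec_sum[OF PC x k, symmetric])
  finally show "(Y *\<^sub>v spread m E i x) $ k = (parent_cols E Y i *\<^sub>v x) $ k" .
qed (use Y in \<open>simp add: parent_cols_def\<close>)

lemma residual_carrier [simp]: "residual n E \<Lambda> Y i \<in> carrier_vec n" "dim_vec (residual n E \<Lambda> Y i) = n"
  by (simp_all add: residual_def)

lemma residual_eq:
  fixes Y :: "'a::real_or_complex mat"
  assumes E: "dag_on m E" and Y: "Y \<in> carrier_mat n m" and i: "i < m"
  shows "residual n E \<Lambda> Y i = col Y i - parent_cols E Y i *\<^sub>v edge_vec E \<Lambda> i"
proof (rule eq_vecI)
  have PC: "parent_cols E Y i \<in> carrier_mat n (card (pa E i))" using Y by simp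
  then show dim: "dim_vec (residual n E \<Lambda> Y i) = dim_vec (col Y i - parent_cols E Y i *\<^sub>v edge_vec E \<Lambda> i)"
    by simp
  fix k assume "k < dim_vec (col Y i - parent_cols E Y i *\<^sub>v edge_vec E \<Lambda> i)"
  then have k: "k < n" using PC by simp
  have "(parent_cols E Y i *\<^sub>v edge_vec E \<Lambda> i) $ k = (\<Sum>j\<in>pa E i. \<Lambda> $$ (i, j) * Y $$ (k, j))"
    unfolding mult_mat_vec_sum[OF PC edge_vec_carrier(1) k] sum_parents[OF E]
    by (simp add: parent_cols_index[OF E Y k] edge_vec_index mult.commute)
  then show "residual n E \<Lambda> Y i $ k = (col Y i - parent_cols E Y i *\<^sub>v edge_vec E \<Lambda> i) $ k"
    using k Y i carrier_matD[OF PC] by (simp add: residual_def del: index_mult_mat_vec)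
qed

definition edge_matrix :: "nat \<Rightarrow> (nat \<times> nat) set \<Rightarrow> (nat \<Rightarrow> 'a::zero vec) \<Rightarrow> 'a mat" where
  "edge_matrix m E X = mat m m (\<lambda>(i, j). spread m E i (X i) $ j)"

lemma edge_vec_edge_matrix:
  assumes "dag_on m E" "i < m" "X i \<in> carrier_vec (card (pa E i))"
  shows "edge_vec E (edge_matrix m E X) i = X i"
  using assms parents_nth_less[OF assms(1)]
  by (intro eq_vecI) (auto simp: edge_vec_index edge_matrix_def spread_index(1)[OF assms(1)])

lemma edge_matrix_in_dag_params:
  assumes "dag_on m E" "\<omega> \<in> carrier_vec m" "\<And>i. i < m \<Longrightarrow> \<omega> $ i > 0"
  shows "(edge_matrix m E X, \<omega>) \<in> dag_params m E"
  using assms by (auto simp: dag_params_def edge_matrix_def spread_index(2)[OF assms(1)])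

lemma dag_params_eqI:
  assumes E: "dag_on m E" and params: "(\<Lambda>, \<omega>) \<in> dag_params m E" "(\<Lambda>', \<omega>') \<in> dag_params m E"
    and edges: "\<And>i. i < m \<Longrightarrow> edge_vec E \<Lambda> i = edge_vec E \<Lambda>' i"
  shows "\<Lambda> = \<Lambda>'"
proof (rule eq_matI)
  fix i j assume "i < dim_row \<Lambda>'" "j < dim_col \<Lambda>'"
  then have ij: "i < m" "j < m" using params by (auto simp: dag_params_def)
  show "\<Lambda> $$ (i, j) = \<Lambda>' $$ (i, j)"
  proof (cases "j \<in> pa E i")
    case True
    then obtain r where r: "r < card (pa E i)" "j = parents E i ! r"
      using bij_betw_parents[OF E, of i] by (auto simp: bij_betw_def)
    then show ?thesis using edges[OF ij(1)] by (metis edge_vec_index)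
  qed (use params ij in \<open>auto simp: dag_params_def\<close>)
qed (use params in \<open>auto simp: dag_params_def\<close>)

text \<open>For fixed \<open>s\<close> the term is smallest at \<open>w = s / c\<close>; this is
  \<open>ln u \<le> u - 1\<close> at \<open>u = w / w'\<close>.\<close>

lemma log_likelihood_term_le:
  fixes c w w' s :: real
  assumes "c > 0" "w > 0" "w' > 0" "s \<ge> c * w"
  shows "ln w + 1 / (c * w) * (c * w) \<le> ln w' + 1 / (c * w') * s"
proof -
  have "ln w - ln w' \<le> w / w' - 1"
    using assms ln_le_minus_one[of "w / w'"] by (simp add: ln_div)
  also have "w / w' = 1 / (c * w') * (c * w)" using assms by simp
  also have "\<dots> \<le> 1 / (c * w') * s" using assms by (intro mult_left_mono) auto
  finally show ?thesis using assms by simp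
qed

text \<open>If \<open>s = 0\<close>, halving the variance lowers the term. Otherwise, comparison
  with \<open>w' = s / c\<close> forces \<open>ln u \<ge> u - 1\<close> for
  \<open>u = s / (c w)\<close>, which is the equality case of the logarithm inequality.\<close>

lemma variance_of_minimal:
  fixes c w s :: real
  assumes c: "c > 0" and w: "w > 0" and s: "s \<ge> 0"
    and min: "\<And>w'. w' > 0 \<Longrightarrow> ln w + 1 / (c * w) * s \<le> ln w' + 1 / (c * w') * s"
  shows "s = c * w"
proof (cases "s = 0")
  case True
  have "ln w \<le> ln (w / 2)" using min[of "w / 2"] w True by simp
  then show ?thesis using w by simp
next
  case False
  then have s: "s > 0" using s by simp
  let ?u = "s / (c * w)"
  have u: "?u > 0" using s c w by simp
  have "ln w + ?u \<le> ln (s / c) + 1" using min[of "s / c"] s c by simp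
  moreover have "ln ?u = ln (s / c) - ln w" using s c w by (simp add: ln_div ln_mult)
  ultimately have "ln ?u = ?u - 1" using ln_le_minus_one[OF u] by simp
  then have "?u = 1" by (rule ln_eq_minus_one[OF u])
  then show ?thesis using s c w by (auto simp: divide_eq_1_iff)
qed

lemma dag_objective_eq:
  "dag_objective n m E Y (\<Lambda>, \<omega>) =
    (\<Sum>i<m. ln (\<omega> $ i) + 1 / (real n * \<omega> $ i) * nsq (residual n E \<Lambda> Y i))"
  by (simp add: dag_objective_def nsq_def)

text \<open>The objective is a sum over vertices whose parameters vary independently, so each vertex
  is a separate least squares problem together with a one-variable problem for its variance.\<close>

lemma is_MLE_iff:
  fixes Y \<Lambda> :: "'a::real_or_complex mat"
  assumes E: "dag_on m E" and Y: "Y \<in> carrier_mat n m" and mn: "m \<le> n"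
  shows "is_MLE n m E Y (\<Lambda>, \<omega>) \<longleftrightarrow> (\<Lambda>, \<omega>) \<in> dag_params m E \<and>
    (\<forall>i<m. mat_adjoint (parent_cols E Y i) *\<^sub>v residual n E \<Lambda> Y i = 0\<^sub>v (card (pa E i)) \<and>
           nsq (residual n E \<Lambda> Y i) = real n * \<omega> $ i)"
proof (intro iffI conjI allI impI)
  assume "is_MLE n m E Y (\<Lambda>, \<omega>)"
  then have params: "(\<Lambda>, \<omega>) \<in> dag_params m E"
    and min: "\<And>\<beta>. \<beta> \<in> dag_params m E \<Longrightarrow> dag_objective n m E Y (\<Lambda>, \<omega>) \<le> dag_objective n m E Y \<beta>"
    by (auto simp: is_MLE_def)
  then show "(\<Lambda>, \<omega>) \<in> dag_params m E" by simp
  have \<omega>: "\<omega> \<in> carrier_vec m" "\<And>i. i < m \<Longrightarrow> \<omega> $ i > 0" using params by (auto simp: dag_params_def)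
  fix i assume i: "i < m"
  have n: "real n > 0" using i mn by simp
  have PC: "parent_cols E Y i \<in> carrier_mat n (card (pa E i))" using Y by simp
  have cY: "col Y i \<in> carrier_vec n" using Y i by auto
  let ?T = "\<lambda>w s. ln w + 1 / (real n * w) * s"
  \<comment> \<open>Both conditions follow from this inequality, by freezing \<open>x\<close> at the
    current weights or \<open>w\<close> at the current variance.\<close>
  have le: "?T (\<omega> $ i) (nsq (residual n E \<Lambda> Y i)) \<le> ?T w (nsq (col Y i - parent_cols E Y i *\<^sub>v x))"
    if w: "w > 0" and x: "x \<in> carrier_vec (card (pa E i))" for w x
  proof -
    \<comment> \<open>The competitor changes the parameters of vertex \<open>i\<close> alone; all
      other summands of the objective cancel.\<close>
    define \<Lambda>' where "\<Lambda>' = edge_matrix m E (\<lambda>i'. if i' = i then x else edge_vec E \<Lambda> i')"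
    define \<omega>' where "\<omega>' = vec m (\<lambda>i'. if i' = i then w else \<omega> $ i')"
    have edge: "edge_vec E \<Lambda>' i' = (if i' = i then x else edge_vec E \<Lambda> i')" if "i' < m" for i'
      unfolding \<Lambda>'_def using x by (subst edge_vec_edge_matrix[OF E that]) auto
    have "(\<Lambda>', \<omega>') \<in> dag_params m E"
      unfolding \<Lambda>'_def by (rule edge_matrix_in_dag_params[OF E]) (auto simp: \<omega>'_def \<omega> w)
    then have "dag_objective n m E Y (\<Lambda>, \<omega>) \<le> dag_objective n m E Y (\<Lambda>', \<omega>')" by (rule min)
    moreover have "residual n E \<Lambda>' Y i' = residual n E \<Lambda> Y i'" if "i' < m" "i' \<noteq> i" for i'
      using that by (simp add: residual_eq[OF E Y] edge)
    moreover have "residual n E \<Lambda>' Y i = col Y i - parent_cols E Y i *\<^sub>v x"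
      using i by (simp add: residual_eq[OF E Y] edge)
    ultimately show ?thesis using i
      by (simp add: dag_objective_eq sum.remove[of "{..<m}" i] \<omega>'_def)
  qed
  have res: "residual n E \<Lambda> Y i = col Y i - parent_cols E Y i *\<^sub>v edge_vec E \<Lambda> i"
    by (rule residual_eq[OF E Y i])
  show "nsq (residual n E \<Lambda> Y i) = real n * \<omega> $ i"
    using le[OF _ edge_vec_carrier(1), of _ \<Lambda>] unfolding res[symmetric]
    by (rule variance_of_minimal[OF n \<omega>(2)[OF i] nsq_nonneg])
  have "\<forall>x\<in>carrier_vec (card (pa E i)). nsq (col Y i - parent_cols E Y i *\<^sub>v edge_vec E \<Lambda> i)
      \<le> nsq (col Y i - parent_cols E Y i *\<^sub>v x)"
  proof
    fix x :: "'a vec" assume x: "x \<in> carrier_vec (card (pa E i))"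
    show "nsq (col Y i - parent_cols E Y i *\<^sub>v edge_vec E \<Lambda> i) \<le> nsq (col Y i - parent_cols E Y i *\<^sub>v x)"
      using le[OF \<omega>(2)[OF i] x] n \<omega>(2)[OF i] unfolding res by (simp add: divide_le_cancel)
  qed
  then show "mat_adjoint (parent_cols E Y i) *\<^sub>v residual n E \<Lambda> Y i = 0\<^sub>v (card (pa E i))"
    unfolding res normal_equation_iff_minimal[OF PC cY edge_vec_carrier(1)] .
next
  assume *: "(\<Lambda>, \<omega>) \<in> dag_params m E \<and>
    (\<forall>i<m. mat_adjoint (parent_cols E Y i) *\<^sub>v residual n E \<Lambda> Y i = 0\<^sub>v (card (pa E i)) \<and>
           nsq (residual n E \<Lambda> Y i) = real n * \<omega> $ i)"
  have "dag_objective n m E Y (\<Lambda>, \<omega>) \<le> dag_objective n m E Y (\<Lambda>', \<omega>')"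
    if params: "(\<Lambda>', \<omega>') \<in> dag_params m E" for \<Lambda>' \<omega>'
    unfolding dag_objective_eq
  proof (rule sum_mono)
    fix i assume "i \<in> {..<m}"
    then have i: "i < m" by simp
    have PC: "parent_cols E Y i \<in> carrier_mat n (card (pa E i))" using Y by simp
    have cY: "col Y i \<in> carrier_vec n" using Y i by auto
    have "mat_adjoint (parent_cols E Y i) *\<^sub>v residual n E \<Lambda> Y i = 0\<^sub>v (card (pa E i))"
      using * i by blast
    then have "nsq (residual n E \<Lambda> Y i) \<le> nsq (residual n E \<Lambda>' Y i)"
      unfolding residual_eq[OF E Y i] normal_equation_iff_minimal[OF PC cY edge_vec_carrier(1)]
      using edge_vec_carrier(1) by (rule bspec)
    then have "real n * \<omega> $ i \<le> nsq (residual n E \<Lambda>' Y i)" using * i by simp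
    then have "ln (\<omega> $ i) + 1 / (real n * \<omega> $ i) * (real n * \<omega> $ i)
        \<le> ln (\<omega>' $ i) + 1 / (real n * \<omega>' $ i) * nsq (residual n E \<Lambda>' Y i)"
      using * params i mn by (intro log_likelihood_term_le) (auto simp: dag_params_def)
    then show "ln (\<omega> $ i) + 1 / (real n * \<omega> $ i) * nsq (residual n E \<Lambda> Y i)
        \<le> ln (\<omega>' $ i) + 1 / (real n * \<omega>' $ i) * nsq (residual n E \<Lambda>' Y i)"
      using * i by simp
  qed
  with * show "is_MLE n m E Y (\<Lambda>, \<omega>)" by (auto simp: is_MLE_def)
qed

section \<open>Injective samples\<close>

definition mat_injective :: "'a::comm_ring_1 mat \<Rightarrow> bool" where
  "mat_injective Y \<longleftrightarrow> (\<forall>x\<in>carrier_vec (dim_col Y). Y *\<^sub>v x = 0\<^sub>v (dim_row Y) \<longrightarrow> x = 0\<^sub>v (dim_col Y))"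

lemma spread_eq_0:
  fixes x :: "'a::comm_ring_1 vec"
  assumes E: "dag_on m E" and x: "x \<in> carrier_vec (card (pa E i))" and 0: "spread m E i x = 0\<^sub>v m"
  shows "x = 0\<^sub>v (card (pa E i))"
proof (rule eq_vecI)
  fix r assume "r < dim_vec (0\<^sub>v (card (pa E i)))"
  then have r: "r < card (pa E i)" by simp
  then show "x $ r = 0\<^sub>v (card (pa E i)) $ r"
    using spread_index(1)[OF E r, of x] parents_nth_less[OF E r] by (simp add: 0)
qed (use x in simp)

lemma parent_cols_injective:
  fixes Y :: "'a::comm_ring_1 mat"
  assumes E: "dag_on m E" and Y: "Y \<in> carrier_mat n m" and inj: "mat_injective Y"
    and x: "x \<in> carrier_vec (card (pa E i))" and 0: "parent_cols E Y i *\<^sub>v x = 0\<^sub>v n"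
  shows "x = 0\<^sub>v (card (pa E i))"
proof -
  have "Y *\<^sub>v spread m E i x = 0\<^sub>v n" using mult_spread[OF E Y x] 0 by simp
  then have "spread m E i x = 0\<^sub>v m" using inj Y by (auto simp: mat_injective_def)
  then show ?thesis by (rule spread_eq_0[OF E x])
qed

text \<open>A vanishing residual would put \<open>unit_vec m i\<close> minus the extended edge
  weights into the kernel. Its entry at \<open>i\<close> is 1, because a vertex of a DAG is not its
  own parent. Positive residuals yield admissible variances.\<close>

lemma residual_nonzero:
  fixes Y :: "'a::real_or_complex mat"
  assumes E: "dag_on m E" and Y: "Y \<in> carrier_mat n m" and inj: "mat_injective Y" and i: "i < m"
  shows "nsq (residual n E \<Lambda> Y i) > 0"
proof (rule ccontr)
  assume "\<not> nsq (residual n E \<Lambda> Y i) > 0"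
  then have 0: "residual n E \<Lambda> Y i = 0\<^sub>v n"
    using nsq_nonneg[of "residual n E \<Lambda> Y i"] nsq_eq_0_iff[OF residual_carrier(1), of n E \<Lambda> Y i] by linarith
  let ?u = "unit_vec m i - spread m E i (edge_vec E \<Lambda> i)"
  have "Y *\<^sub>v ?u = Y *\<^sub>v unit_vec m i - Y *\<^sub>v spread m E i (edge_vec E \<Lambda> i)"
    by (rule mult_minus_distrib_mat_vec[OF Y]) auto
  also have "Y *\<^sub>v unit_vec m i = col Y i"
    using Y i by (intro eq_vecI) auto
  finally have "Y *\<^sub>v ?u = 0\<^sub>v n"
    unfolding mult_spread[OF E Y edge_vec_carrier(1)] residual_eq[OF E Y i, symmetric] by (simp only: 0)
  then have "?u = 0\<^sub>v m" using inj Y by (auto simp: mat_injective_def)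
  then have "?u $ i = 0" using i by simp
  then show False using i by (simp add: spread_index(2)[OF E i not_in_pa_self[OF E]])
qed

text \<open>For two MLEs, the difference of edge weights at a vertex is annihilated by
  \<open>A^H A\<close>, hence by the injective parent columns \<open>A\<close>. The variances are
  then determined by the residuals.\<close>

lemma is_unique_MLE_of_injective:
  fixes Y :: "'a::real_or_complex mat"
  assumes E: "dag_on m E" and Y: "Y \<in> carrier_mat n m" and mn: "m \<le> n" and inj: "mat_injective Y"
  shows "is_unique_MLE n m E Y \<alpha> \<longleftrightarrow> is_MLE n m E Y \<alpha>"
proof -
  have unique: "\<Lambda> = \<Lambda>' \<and> \<omega> = \<omega>'"
    if "is_MLE n m E Y (\<Lambda>, \<omega>)" "is_MLE n m E Y (\<Lambda>', \<omega>')" for \<Lambda> \<Lambda>' :: "'a mat" and \<omega> \<omega>'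
  proof -
    note M = that[unfolded is_MLE_iff[OF E Y mn]]
    have "edge_vec E \<Lambda> i = edge_vec E \<Lambda>' i" if i: "i < m" for i
    proof -
      let ?A = "parent_cols E Y i" and ?x = "edge_vec E \<Lambda> i" and ?x' = "edge_vec E \<Lambda>' i"
      have A: "?A \<in> carrier_mat n (card (pa E i))" using Y by simp
      have z: "?x - ?x' \<in> carrier_vec (card (pa E i))" by simp
      have Ax: "?A *\<^sub>v ?x \<in> carrier_vec n" "?A *\<^sub>v ?x' \<in> carrier_vec n"
        using mult_mat_vec_carrier[OF A edge_vec_carrier(1)] by auto
      have cY: "col Y i \<in> carrier_vec n" using Y i by auto
      have "?A *\<^sub>v (?x - ?x') = residual n E \<Lambda>' Y i - residual n E \<Lambda> Y i"
        unfolding mult_minus_distrib_mat_vec[OF A edge_vec_carrier(1) edge_vec_carrier(1)] residual_eq[OF E Y i]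
        using Ax cY A by (intro eq_vecI) auto
      then have "mat_adjoint ?A *\<^sub>v (?A *\<^sub>v (?x - ?x')) = 0\<^sub>v (card (pa E i))"
        using M i mult_minus_distrib_mat_vec[OF mat_adjoint_carrier[OF A] residual_carrier(1) residual_carrier(1)] by simp
      then have "(?A *\<^sub>v (?x - ?x')) \<bullet>c (?A *\<^sub>v (?x - ?x')) = 0"
        using adjoint_mult_eq_0_iff[OF A mult_mat_vec_carrier[OF A z]] z by blast
      then have "?A *\<^sub>v (?x - ?x') = 0\<^sub>v n"
        using nsq_eq_0_iff[OF mult_mat_vec_carrier[OF A z]] by (simp add: cscalar_prod_self)
      then have 0: "?x - ?x' = 0\<^sub>v (card (pa E i))" by (rule parent_cols_injective[OF E Y inj z])
      have "?x = (?x - ?x') + ?x'" by (intro eq_vecI) auto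
      also have "\<dots> = ?x'" unfolding 0 by simp
      finally show ?thesis .
    qed
    then have \<Lambda>: "\<Lambda> = \<Lambda>'" using M by (intro dag_params_eqI[OF E, of \<Lambda> \<omega> \<Lambda>' \<omega>']) auto
    have "\<omega> = \<omega>'"
    proof (rule eq_vecI)
      fix i assume "i < dim_vec \<omega>'"
      then have i: "i < m" using M by (auto simp: dag_params_def)
      then have "real n * \<omega> $ i = real n * \<omega>' $ i" using M \<Lambda> by metis
      then show "\<omega> $ i = \<omega>' $ i" using i mn by simp
    qed (use M in \<open>auto simp: dag_params_def\<close>)
    with \<Lambda> show ?thesis by simp
  qed
  then show ?thesis by (cases \<alpha>) (auto simp: is_unique_MLE_def)
qed

subsection \<open>Perturbations\<close>

text \<open>The vector \<open>u\<close> does not depend on \<open>Y\<close>. Hence the residuals of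
  \<open>f\<close> and \<open>f'\<close> are images of the same vector, and lie in the orthogonal
  images of the two maps.\<close>

lemma residual_eq_mult:
  fixes Y :: "'a::real_or_complex mat"
  assumes E: "dag_on m E" and i: "i < m"
  obtains u where "u \<in> carrier_vec m"
    "\<And>Y n. Y \<in> carrier_mat n m \<Longrightarrow> residual n E (\<Lambda> :: 'a mat) Y i = Y *\<^sub>v u"
proof
  let ?s = "spread m E i (edge_vec E \<Lambda> i)"
  show "unit_vec m i - ?s \<in> carrier_vec m" by simp
  fix Y :: "'a mat" and n assume Y: "Y \<in> carrier_mat n m"
  have "Y *\<^sub>v (unit_vec m i - ?s) = Y *\<^sub>v unit_vec m i - Y *\<^sub>v ?s"
    by (rule mult_minus_distrib_mat_vec[OF Y]) auto
  also have "Y *\<^sub>v unit_vec m i = col Y i"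
    using Y i by (intro eq_vecI) auto
  finally show "residual n E \<Lambda> Y i = Y *\<^sub>v (unit_vec m i - ?s)"
    unfolding mult_spread[OF E Y edge_vec_carrier(1)] residual_eq[OF E Y i] by simp
qed

text \<open>Project \<open>x\<close> onto the image of \<open>f^H\<close>: the normal equation of
  this least squares problem says exactly that the remainder lies in \<open>ker f\<close>.\<close>

lemma ex_kernel_decomposition:
  fixes f :: "'a::real_or_complex mat"
  assumes f: "f \<in> carrier_mat n m" and x: "x \<in> carrier_vec m"
  obtains k u where "k \<in> mat_kernel f" "u \<in> carrier_vec n" "x = k + mat_adjoint f *\<^sub>v u"
proof -
  obtain u where u: "u \<in> carrier_vec n"
    and 0: "mat_adjoint (mat_adjoint f) *\<^sub>v (x - mat_adjoint f *\<^sub>v u) = 0\<^sub>v n"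
    using ex_normal_solution[OF mat_adjoint_carrier[OF f] x] by blast
  let ?k = "x - mat_adjoint f *\<^sub>v u"
  have fu: "mat_adjoint f *\<^sub>v u \<in> carrier_vec m" by (rule mult_mat_vec_carrier[OF mat_adjoint_carrier[OF f] u])
  have "?k \<in> mat_kernel f" using 0 fu x by (intro mat_kernelI[OF f]) auto
  moreover have "x = ?k + mat_adjoint f *\<^sub>v u" using x carrier_vecD[OF fu] by (intro eq_vecI) auto
  ultimately show ?thesis using u that by blast
qed

lemma kernel_orthogonal_adjoint:
  fixes f :: "'a::real_or_complex mat"
  assumes f: "f \<in> carrier_mat n m" and k: "k \<in> mat_kernel f" and u: "u \<in> carrier_vec n"
  shows "k \<bullet>c (mat_adjoint f *\<^sub>v u) = 0" "(mat_adjoint f *\<^sub>v u) \<bullet>c k = 0"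
proof -
  have kc: "k \<in> carrier_vec m" and 0: "f *\<^sub>v k = 0\<^sub>v n" using mat_kernelD[OF f k] by auto
  show 1: "k \<bullet>c (mat_adjoint f *\<^sub>v u) = 0"
    using cscalar_prod_mult_mat_vec[OF f kc u] u by (simp add: 0)
  show "(mat_adjoint f *\<^sub>v u) \<bullet>c k = 0"
    using cscalar_prod_eq_0_commute[OF kc mult_mat_vec_carrier[OF mat_adjoint_carrier[OF f] u]] 1 by simp
qed

lemma cscalar_prod_self_eq_0:
  fixes v :: "'a::real_or_complex vec"
  shows "v \<in> carrier_vec n \<Longrightarrow> v \<bullet>c v = 0 \<Longrightarrow> v = 0\<^sub>v n"
  using nsq_eq_0_iff[of v n] by (simp add: cscalar_prod_self)

lemma mat_kernel_sum:
  fixes f X :: "'a::real_or_complex mat"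
  assumes f: "f \<in> carrier_mat n m" and X: "X \<in> carrier_mat n m"
    and orth: "\<And>x z. x \<in> carrier_vec m \<Longrightarrow> z \<in> carrier_vec m \<Longrightarrow> (X *\<^sub>v x) \<bullet>c (f *\<^sub>v z) = 0"
    and x: "x \<in> carrier_vec m" and c: "c \<noteq> 0" and 0: "(f + c \<cdot>\<^sub>m X) *\<^sub>v x = 0\<^sub>v n"
  shows "f *\<^sub>v x = 0\<^sub>v n" "X *\<^sub>v x = 0\<^sub>v n"
proof -
  have fx: "f *\<^sub>v x \<in> carrier_vec n" and Xx: "X *\<^sub>v x \<in> carrier_vec n" using f X x by auto
  have cX: "c \<cdot>\<^sub>m X \<in> carrier_mat n m" using X by simp
  have "(f + c \<cdot>\<^sub>m X) *\<^sub>v x = f *\<^sub>v x + c \<cdot>\<^sub>v (X *\<^sub>v x)"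
    using x X by (simp add: add_mult_distrib_mat_vec[OF f cX x] smult_mat_mult_vec)
  then have sum0: "f *\<^sub>v x + c \<cdot>\<^sub>v (X *\<^sub>v x) = 0\<^sub>v n" using 0 by simp
  have "(f *\<^sub>v x) \<bullet>c (c \<cdot>\<^sub>v (X *\<^sub>v x)) = of_real 0"
    using cscalar_prod_eq_0_commute[OF fx Xx] orth[OF x x] fx Xx
    by (simp add: conjugate_smult_vec scalar_prod_smult_distrib[of _ n])
  then have "nsq (f *\<^sub>v x + c \<cdot>\<^sub>v (X *\<^sub>v x)) = nsq (f *\<^sub>v x) + (norm c)\<^sup>2 * nsq (X *\<^sub>v x)"
    using nsq_add[OF fx, of "c \<cdot>\<^sub>v (X *\<^sub>v x)" 0] Xx by (simp add: nsq_smult)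
  moreover have "nsq (0\<^sub>v n :: 'a vec) = 0" by (simp add: nsq_def)
  ultimately have "nsq (f *\<^sub>v x) + (norm c)\<^sup>2 * nsq (X *\<^sub>v x) = 0" unfolding sum0 by simp
  then have "nsq (f *\<^sub>v x) = 0" "nsq (X *\<^sub>v x) = 0"
    using c by (auto simp: add_nonneg_eq_0_iff)
  then show "f *\<^sub>v x = 0\<^sub>v n" "X *\<^sub>v x = 0\<^sub>v n"
    using nsq_eq_0_iff[OF fx] nsq_eq_0_iff[OF Xx] by auto
qed

text \<open>
  The condition \<open>(ker X)\<^sup>\<bottom> = ker f\<close> amounts to \<open>X\<close> vanishing on \<open>(ker f)\<^sup>\<bottom> = im f\<^sup>*\<close>, which is
  closed, and to \<open>f + X\<close> being injective, which is open.
\<close>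
lemma is_perturbation_iff:
  fixes f X :: "'a::real_or_complex mat"
  assumes f: "f \<in> carrier_mat n m"
  shows "is_perturbation n m f X \<longleftrightarrow> X \<in> carrier_mat n m \<and>
    (\<forall>x\<in>carrier_vec m. \<forall>z\<in>carrier_vec m. (X *\<^sub>v x) \<bullet>c (f *\<^sub>v z) = 0) \<and>
    (\<forall>u\<in>carrier_vec n. X *\<^sub>v (mat_adjoint f *\<^sub>v u) = 0\<^sub>v n) \<and> mat_injective (f + X)"
proof (cases "X \<in> carrier_mat n m \<and>
    (\<forall>x\<in>carrier_vec m. \<forall>z\<in>carrier_vec m. (X *\<^sub>v x) \<bullet>c (f *\<^sub>v z) = 0)")
  case False
  have "X \<in> carrier_mat n m \<Longrightarrow> mat_image X \<subseteq> orth_compl n (mat_image f) \<Longrightarrow>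
      (\<forall>x\<in>carrier_vec m. \<forall>z\<in>carrier_vec m. (X *\<^sub>v x) \<bullet>c (f *\<^sub>v z) = 0)"
    using f by (auto simp: mat_image_def orth_compl_def image_subset_iff)
  with False show ?thesis by (auto simp: is_perturbation_def)
next
  case True
  then have X: "X \<in> carrier_mat n m"
    and orth: "\<And>x z. x \<in> carrier_vec m \<Longrightarrow> z \<in> carrier_vec m \<Longrightarrow> (X *\<^sub>v x) \<bullet>c (f *\<^sub>v z) = 0" by auto
  have fX: "f + X \<in> carrier_mat n m" using f X by simp
  have adj: "mat_adjoint f *\<^sub>v u \<in> carrier_vec m" "mat_adjoint X *\<^sub>v u \<in> carrier_vec m" if "u \<in> carrier_vec n" for u
    using mult_mat_vec_carrier[OF mat_adjoint_carrier[OF f] that] mult_mat_vec_carrier[OF mat_adjoint_carrier[OF X] that] by auto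
  have "mat_image X \<subseteq> orth_compl n (mat_image f)"
    using X f orth by (auto simp: mat_image_def orth_compl_def)
  then have pert: "is_perturbation n m f X \<longleftrightarrow> orth_compl m (mat_kernel X) = mat_kernel f"
    using X by (simp add: is_perturbation_def)
  have "orth_compl m (mat_kernel X) = mat_kernel f \<longleftrightarrow>
    (\<forall>u\<in>carrier_vec n. X *\<^sub>v (mat_adjoint f *\<^sub>v u) = 0\<^sub>v n) \<and> mat_injective (f + X)" (is "?L \<longleftrightarrow> ?R")
  proof
    assume L: ?L
    have "X *\<^sub>v (mat_adjoint f *\<^sub>v u) = 0\<^sub>v n" if u: "u \<in> carrier_vec n" for u
    proof -
      let ?g = "mat_adjoint f *\<^sub>v u"
      \<comment> \<open>Split \<open>f^H u\<close> along \<open>ker X\<close> and the image of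
        \<open>X^H\<close>. The second part is orthogonal to \<open>ker X\<close>, so by assumption
        it lies in \<open>ker f\<close>, which is orthogonal to \<open>f^H u\<close>; hence it is
        orthogonal to itself.\<close>
      obtain k v where k: "k \<in> mat_kernel X" and v: "v \<in> carrier_vec n" and g: "?g = k + mat_adjoint X *\<^sub>v v"
        using ex_kernel_decomposition[OF X adj(1)[OF u]] by blast
      let ?s = "mat_adjoint X *\<^sub>v v"
      have kc: "k \<in> carrier_vec m" using mat_kernelD[OF X k] by simp
      have s: "?s \<in> carrier_vec m" by (rule adj(2)[OF v])
      have "?s \<in> orth_compl m (mat_kernel X)"
        using s kernel_orthogonal_adjoint(2)[OF X _ v] by (auto simp: orth_compl_def)
      then have "?s \<in> mat_kernel f" using L by simp
      then have "?s \<bullet>c (k + ?s) = 0" unfolding g[symmetric] by (rule kernel_orthogonal_adjoint(1)[OF f _ u])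
      then have "?s \<bullet>c ?s = 0"
        using kernel_orthogonal_adjoint(2)[OF X k v] kc s
        by (simp add: conjugate_add_vec[of _ m] scalar_prod_add_distrib[of _ m])
      then have "?s = 0\<^sub>v m" by (rule cscalar_prod_self_eq_0[OF s])
      then show ?thesis using g kc mat_kernelD(2)[OF X k] by simp
    qed
    moreover have "mat_injective (f + X)"
      unfolding mat_injective_def
    proof (intro ballI impI)
      fix x assume "x \<in> carrier_vec (dim_col (f + X))" "(f + X) *\<^sub>v x = 0\<^sub>v (dim_row (f + X))"
      moreover have "1 \<cdot>\<^sub>m X = X" by (intro eq_matI) auto
      ultimately have x: "x \<in> carrier_vec m" and 0: "(f + 1 \<cdot>\<^sub>m X) *\<^sub>v x = 0\<^sub>v n" using fX X by auto
      have "f *\<^sub>v x = 0\<^sub>v n" "X *\<^sub>v x = 0\<^sub>v n"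
        using mat_kernel_sum[OF f X orth x _ 0] by auto
      then have "x \<in> mat_kernel f" "x \<in> mat_kernel X"
        using mat_kernelI[OF f x] mat_kernelI[OF X x] by auto
      \<comment> \<open>\<open>x\<close> lies both in \<open>ker X\<close> and in
        \<open>ker f\<close>, the orthogonal complement of \<open>ker X\<close>.\<close>
      then have "x \<bullet>c x = 0" unfolding L[symmetric] by (simp add: orth_compl_def)
      then show "x = 0\<^sub>v (dim_col (f + X))" using cscalar_prod_self_eq_0[OF x] carrier_matD(2)[OF X] by simp
    qed
    ultimately show ?R by blast
  next
    assume R: ?R
    have kerX: "mat_adjoint f *\<^sub>v u \<in> mat_kernel X" if "u \<in> carrier_vec n" for u
      using R that mat_kernelI[OF X adj(1)[OF that]] by blast
    show ?L
    proof (intro equalityI subsetI)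
      fix v assume "v \<in> orth_compl m (mat_kernel X)"
      then have v: "v \<in> carrier_vec m" and perp: "\<And>z. z \<in> mat_kernel X \<Longrightarrow> v \<bullet>c z = 0"
        by (auto simp: orth_compl_def)
      obtain k u where k: "k \<in> mat_kernel f" and u: "u \<in> carrier_vec n" and v_eq: "v = k + mat_adjoint f *\<^sub>v u"
        using ex_kernel_decomposition[OF f v] by blast
      have kc: "k \<in> carrier_vec m" using mat_kernelD[OF f k] by simp
      have "v \<bullet>c (mat_adjoint f *\<^sub>v u) = 0" by (rule perp[OF kerX[OF u]])
      then have "(mat_adjoint f *\<^sub>v u) \<bullet>c (mat_adjoint f *\<^sub>v u) = 0"
        using kernel_orthogonal_adjoint(1)[OF f k u] kc adj(1)[OF u]
        by (simp add: v_eq add_scalar_prod_distrib[of _ m])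
      then have "mat_adjoint f *\<^sub>v u = 0\<^sub>v m" by (rule cscalar_prod_self_eq_0[OF adj(1)[OF u]])
      then show "v \<in> mat_kernel f" using v_eq k kc by simp
    next
      fix v assume v: "v \<in> mat_kernel f"
      then have vc: "v \<in> carrier_vec m" using mat_kernelD[OF f] by blast
      have "v \<bullet>c z = 0" if z: "z \<in> mat_kernel X" for z
      proof -
        have zc: "z \<in> carrier_vec m" using mat_kernelD[OF X z] by simp
        obtain k u where k: "k \<in> mat_kernel f" and u: "u \<in> carrier_vec n" and z_eq: "z = k + mat_adjoint f *\<^sub>v u"
          using ex_kernel_decomposition[OF f zc] by blast
        have kc: "k \<in> carrier_vec m" and fk: "f *\<^sub>v k = 0\<^sub>v n" using mat_kernelD[OF f k] by auto
        have "X *\<^sub>v z = X *\<^sub>v k + X *\<^sub>v (mat_adjoint f *\<^sub>v u)"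
          unfolding z_eq by (rule mult_add_distrib_mat_vec[OF X kc adj(1)[OF u]])
        \<comment> \<open>Since \<open>X\<close> kills \<open>z\<close> and its part in the image of
          \<open>f^H\<close>, it kills \<open>k\<close>. So \<open>k\<close> is in the kernel of
          both \<open>f\<close> and \<open>X\<close>, and injectivity of \<open>f + X\<close> leaves
          \<open>k = 0\<close>.\<close>
        then have "X *\<^sub>v k = 0\<^sub>v n"
          using mat_kernelD(2)[OF X z] mat_kernelD(2)[OF X kerX[OF u]] X kc by simp
        then have "(f + X) *\<^sub>v k = 0\<^sub>v n"
          by (simp add: add_mult_distrib_mat_vec[OF f X kc] fk)
        then have "k = 0\<^sub>v m" using R f X kc by (auto simp: mat_injective_def)
        then have "z = mat_adjoint f *\<^sub>v u" using z_eq adj(1)[OF u] by simp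
        then show ?thesis using kernel_orthogonal_adjoint(1)[OF f v u] by simp
      qed
      then show "v \<in> orth_compl m (mat_kernel X)" using vc by (auto simp: orth_compl_def)
    qed
  qed
  with pert True show ?thesis by blast
qed

text \<open>With \<open>z = x - x\<^sub>0\<close> and the normal equation for
  \<open>x\<^sub>0\<close>, the left side becomes \<open>t w - gram t z\<close>, whose zero is
  unique.\<close>

lemma (in perturbed_least_squares) normal_equation_iff:
  assumes \<epsilon>: "\<epsilon> \<noteq> 0" and x: "x \<in> carrier_vec p"
  shows "mat_adjoint A *\<^sub>v (a - A *\<^sub>v x) + of_real (\<epsilon>\<^sup>2) \<cdot>\<^sub>v (mat_adjoint B *\<^sub>v (b - B *\<^sub>v x)) = 0\<^sub>v p
    \<longleftrightarrow> x = x\<^sub>0 + y \<epsilon>"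
proof -
  let ?z = "x - x\<^sub>0" and ?t = "of_real (\<epsilon>\<^sup>2) :: 'a"
  have z: "?z \<in> carrier_vec p" using x x\<^sub>0 by simp
  have x_eq: "x = x\<^sub>0 + ?z" using x x\<^sub>0 by (intro eq_vecI) auto
  have c: "A *\<^sub>v x\<^sub>0 \<in> carrier_vec n" "B *\<^sub>v x\<^sub>0 \<in> carrier_vec n" "A *\<^sub>v ?z \<in> carrier_vec n" "B *\<^sub>v ?z \<in> carrier_vec n"
    using mult_mat_vec_carrier[OF A x\<^sub>0] mult_mat_vec_carrier[OF B x\<^sub>0] mult_mat_vec_carrier[OF A z] mult_mat_vec_carrier[OF B z] by auto
  have c': "mat_adjoint A *\<^sub>v (A *\<^sub>v ?z) \<in> carrier_vec p" "mat_adjoint B *\<^sub>v (B *\<^sub>v ?z) \<in> carrier_vec p"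
    using mult_mat_vec_carrier[OF adjoint_carrier(1) c(3)] mult_mat_vec_carrier[OF adjoint_carrier(2) c(4)] by auto
  have "A *\<^sub>v x = A *\<^sub>v x\<^sub>0 + A *\<^sub>v ?z"
    by (subst x_eq) (rule mult_add_distrib_mat_vec[OF A x\<^sub>0 z])
  then have 1: "a - A *\<^sub>v x = (a - A *\<^sub>v x\<^sub>0) - A *\<^sub>v ?z"
    using a c by (intro eq_vecI) (auto simp del: index_mult_mat_vec)
  have "B *\<^sub>v x = B *\<^sub>v x\<^sub>0 + B *\<^sub>v ?z"
    by (subst x_eq) (rule mult_add_distrib_mat_vec[OF B x\<^sub>0 z])
  then have 2: "b - B *\<^sub>v x = h - B *\<^sub>v ?z"
    unfolding h_def using b c by (intro eq_vecI) (auto simp del: index_mult_mat_vec)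
  have ac: "a - A *\<^sub>v x\<^sub>0 \<in> carrier_vec n" using a c by simp
  have "mat_adjoint A *\<^sub>v (a - A *\<^sub>v x) + ?t \<cdot>\<^sub>v (mat_adjoint B *\<^sub>v (b - B *\<^sub>v x)) = ?t \<cdot>\<^sub>v w - gram ?t *\<^sub>v ?z"
    unfolding 1 2 mult_minus_distrib_mat_vec[OF adjoint_carrier(1) ac c(3)] normal
      mult_minus_distrib_mat_vec[OF adjoint_carrier(2) h_carrier c(4)] w_def[symmetric] gram_mult_vec[OF z]
    using c' by (intro eq_vecI) (auto simp: algebra_simps simp del: index_mult_mat_vec)
  also have "\<dots> = 0\<^sub>v p \<longleftrightarrow> gram ?t *\<^sub>v ?z = ?t \<cdot>\<^sub>v w"
  proof
    assume 0: "?t \<cdot>\<^sub>v w - gram ?t *\<^sub>v ?z = 0\<^sub>v p"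
    have gz: "gram ?t *\<^sub>v ?z \<in> carrier_vec p" by (rule mult_mat_vec_carrier[OF gram_carrier z])
    have "?t \<cdot>\<^sub>v w = (?t \<cdot>\<^sub>v w - gram ?t *\<^sub>v ?z) + gram ?t *\<^sub>v ?z"
      using gz by (intro eq_vecI) (auto simp del: index_mult_mat_vec)
    then show "gram ?t *\<^sub>v ?z = ?t \<cdot>\<^sub>v w" unfolding 0 using gz by simp
  next
    assume "gram ?t *\<^sub>v ?z = ?t \<cdot>\<^sub>v w"
    then show "?t \<cdot>\<^sub>v w - gram ?t *\<^sub>v ?z = 0\<^sub>v p"
      by (simp only:) (intro eq_vecI, auto)
  qed
  also have "\<dots> \<longleftrightarrow> ?z = y \<epsilon>"
    using gram_mult_unique[OF \<epsilon> z] gram_mult_y[OF \<epsilon>] by metis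
  also have "\<dots> \<longleftrightarrow> x = x\<^sub>0 + y \<epsilon>"
  proof
    assume "?z = y \<epsilon>"
    then show "x = x\<^sub>0 + y \<epsilon>" by (subst x_eq) simp
  next
    assume "x = x\<^sub>0 + y \<epsilon>"
    then show "?z = y \<epsilon>" using x\<^sub>0 by (intro eq_vecI) auto
  qed
  finally show ?thesis .
qed

section \<open>The perturbed sample, all vertices together\<close>

locale perturbed_sample =
  fixes n m :: nat and E :: "(nat \<times> nat) set" and f f' \<Lambda> :: "'a::real_or_complex mat" and \<omega> :: "real vec"
  assumes mn: "m \<le> n" and E: "dag_on m E" and f: "f \<in> carrier_mat n m"
    and MLE: "is_MLE n m E f (\<Lambda>, \<omega>)" and pert: "is_perturbation n m f f'"
begin

lemma f': "f' \<in> carrier_mat n m"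
  using pert by (simp add: is_perturbation_def)

lemma orth:
  "x \<in> carrier_vec m \<Longrightarrow> z \<in> carrier_vec m \<Longrightarrow> (f' *\<^sub>v x) \<bullet>c (f *\<^sub>v z) = 0"
  "x \<in> carrier_vec m \<Longrightarrow> z \<in> carrier_vec m \<Longrightarrow> (f *\<^sub>v x) \<bullet>c (f' *\<^sub>v z) = 0"
  using pert is_perturbation_iff[OF f] cscalar_prod_eq_0_commute[of "f' *\<^sub>v z" n "f *\<^sub>v x"] f f' by auto

definition sample :: "real \<Rightarrow> 'a mat" where
  "sample \<epsilon> = f + of_real \<epsilon> \<cdot>\<^sub>m f'"

lemma sample_carrier [simp]: "sample \<epsilon> \<in> carrier_mat n m"
  using f f' by (simp add: sample_def)

lemma sample_mult_vec: "x \<in> carrier_vec m \<Longrightarrow> sample \<epsilon> *\<^sub>v x = f *\<^sub>v x + of_real \<epsilon> \<cdot>\<^sub>v (f' *\<^sub>v x)"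
  unfolding sample_def using add_mult_distrib_mat_vec[OF f smult_carrier_mat[OF f'], of x "of_real \<epsilon>"] f'
  by (simp add: smult_mat_mult_vec)

lemma sample_1: "sample 1 = f + f'"
  using f' by (intro eq_matI) (auto simp: sample_def)

lemma sample_injective:
  assumes "\<epsilon> \<noteq> 0"
  shows "mat_injective (sample \<epsilon>)"
  unfolding mat_injective_def
proof (intro ballI impI)
  fix x assume "x \<in> carrier_vec (dim_col (sample \<epsilon>))" "sample \<epsilon> *\<^sub>v x = 0\<^sub>v (dim_row (sample \<epsilon>))"
  then have x: "x \<in> carrier_vec m" and 0: "sample \<epsilon> *\<^sub>v x = 0\<^sub>v n"
    using carrier_matD[OF sample_carrier] by auto
  have "f *\<^sub>v x = 0\<^sub>v n" "f' *\<^sub>v x = 0\<^sub>v n"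
    using mat_kernel_sum[OF f f' orth(1) x _ 0[unfolded sample_def]] assms by auto
  then have "(f + f') *\<^sub>v x = 0\<^sub>v n" by (simp add: add_mult_distrib_mat_vec[OF f f' x])
  moreover have "mat_injective (f + f')" using pert is_perturbation_iff[OF f] by blast
  ultimately have "x = 0\<^sub>v m" using x f f' by (auto simp: mat_injective_def)
  then show "x = 0\<^sub>v (dim_col (sample \<epsilon>))" using carrier_matD[OF sample_carrier] by simp
qed

lemma residual_sample:
  assumes i: "i < m"
  shows "residual n E L (sample \<epsilon>) i = residual n E L f i + of_real \<epsilon> \<cdot>\<^sub>v residual n E L f' i"
    and "nsq (residual n E L (sample \<epsilon>) i) = nsq (residual n E L f i) + \<epsilon>\<^sup>2 * nsq (residual n E L f' i)"
proof -
  obtain u where u: "u \<in> carrier_vec m" "\<And>Y n. Y \<in> carrier_mat n m \<Longrightarrow> residual n E L Y i = Y *\<^sub>v u"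
    using residual_eq_mult[OF E i, of L] by blast
  show 1: "residual n E L (sample \<epsilon>) i = residual n E L f i + of_real \<epsilon> \<cdot>\<^sub>v residual n E L f' i"
    by (simp add: u(2)[OF f] u(2)[OF f'] u(2)[OF sample_carrier] sample_mult_vec[OF u(1)])
  have "residual n E L f i \<bullet>c (of_real \<epsilon> \<cdot>\<^sub>v residual n E L f' i) = of_real \<epsilon> * (residual n E L f i \<bullet>c residual n E L f' i)"
    by (simp add: conjugate_smult_vec)
  also have "residual n E L f i \<bullet>c residual n E L f' i = 0"
    by (simp add: u(2)[OF f] u(2)[OF f'] orth(2)[OF u(1) u(1)])
  finally have "residual n E L f i \<bullet>c (of_real \<epsilon> \<cdot>\<^sub>v residual n E L f' i) = of_real 0" by simp
  then show "nsq (residual n E L (sample \<epsilon>) i) = nsq (residual n E L f i) + \<epsilon>\<^sup>2 * nsq (residual n E L f' i)"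
    unfolding 1 using nsq_add[of "residual n E L f i" n "of_real \<epsilon> \<cdot>\<^sub>v residual n E L f' i" 0] by (simp add: nsq_smult)
qed

text \<open>The parent columns of \<open>f\<close> are orthogonal to the residual of
  \<open>f'\<close>, and vice versa, so both terms linear in \<open>\<epsilon>\<close> vanish. This
  is the origin of \<open>\<epsilon>\<^sup>2\<close> as the parameter of
  \<open>gram\<close>.\<close>

lemma adjoint_residual_sample:
  assumes i: "i < m"
  shows "mat_adjoint (parent_cols E (sample \<epsilon>) i) *\<^sub>v residual n E L (sample \<epsilon>) i =
    mat_adjoint (parent_cols E f i) *\<^sub>v residual n E L f i
    + of_real (\<epsilon>\<^sup>2) \<cdot>\<^sub>v (mat_adjoint (parent_cols E f' i) *\<^sub>v residual n E L f' i)"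
proof -
  let ?A = "parent_cols E f i" and ?B = "parent_cols E f' i" and ?p = "card (pa E i)" and ?e = "of_real \<epsilon> :: 'a"
  let ?r = "residual n E L f i" and ?s = "residual n E L f' i"
  have A: "?A \<in> carrier_mat n ?p" and B: "?B \<in> carrier_mat n ?p" using f f' by simp_all
  have A': "mat_adjoint ?A \<in> carrier_mat ?p n" and B': "mat_adjoint ?B \<in> carrier_mat ?p n" using A B by simp_all
  have eB': "?e \<cdot>\<^sub>m mat_adjoint ?B \<in> carrier_mat ?p n" using B' by simp
  obtain u where u: "u \<in> carrier_vec m" "\<And>Y n. Y \<in> carrier_mat n m \<Longrightarrow> residual n E L Y i = Y *\<^sub>v u"
    using residual_eq_mult[OF E i, of L] by blast
  have PC: "parent_cols E (sample \<epsilon>) i = ?A + ?e \<cdot>\<^sub>m ?B"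
  proof (rule eq_matI)
    fix k r assume "k < dim_row (?A + ?e \<cdot>\<^sub>m ?B)" "r < dim_col (?A + ?e \<cdot>\<^sub>m ?B)"
    then have kr: "k < n" "r < ?p" using B by auto
    then show "parent_cols E (sample \<epsilon>) i $$ (k, r) = (?A + ?e \<cdot>\<^sub>m ?B) $$ (k, r)"
      using carrier_matD[OF A] carrier_matD[OF B] f f' parents_nth_less[OF E kr(2)]
      by (simp add: parent_cols_index[OF E _ kr] parent_cols_index[OF E f kr] parent_cols_index[OF E f' kr] sample_def)
  qed (use B carrier_matD[OF parent_cols_carrier[OF sample_carrier]] in auto)
  have cross: "mat_adjoint ?A *\<^sub>v ?s = 0\<^sub>v ?p" "mat_adjoint ?B *\<^sub>v ?r = 0\<^sub>v ?p"
    unfolding adjoint_mult_eq_0_iff[OF A residual_carrier(1)] adjoint_mult_eq_0_iff[OF B residual_carrier(1)]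
    by (simp_all add: u(2)[OF f] u(2)[OF f'] mult_spread[OF E f, symmetric] mult_spread[OF E f', symmetric] orth u(1))
  have c: "mat_adjoint ?A *\<^sub>v ?r \<in> carrier_vec ?p" "mat_adjoint ?B *\<^sub>v ?s \<in> carrier_vec ?p"
    using mult_mat_vec_carrier[OF A' residual_carrier(1)] mult_mat_vec_carrier[OF B' residual_carrier(1)] by auto
  have es: "?e \<cdot>\<^sub>v ?s \<in> carrier_vec n" by simp
  have e0: "?e \<cdot>\<^sub>v 0\<^sub>v ?p = 0\<^sub>v ?p" by (intro eq_vecI) auto
  have "mat_adjoint (?A + ?e \<cdot>\<^sub>m ?B) *\<^sub>v (?r + ?e \<cdot>\<^sub>v ?s)
      = (mat_adjoint ?A + ?e \<cdot>\<^sub>m mat_adjoint ?B) *\<^sub>v (?r + ?e \<cdot>\<^sub>v ?s)"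
    using mat_adjoint_add[OF A smult_carrier_mat[OF B]] by (simp add: mat_adjoint_smult)
  also have "\<dots> = mat_adjoint ?A *\<^sub>v (?r + ?e \<cdot>\<^sub>v ?s) + (?e \<cdot>\<^sub>m mat_adjoint ?B) *\<^sub>v (?r + ?e \<cdot>\<^sub>v ?s)"
    by (rule add_mult_distrib_mat_vec[OF A' eB']) simp
  also have "mat_adjoint ?A *\<^sub>v (?r + ?e \<cdot>\<^sub>v ?s) = mat_adjoint ?A *\<^sub>v ?r"
    using c by (simp add: mult_add_distrib_mat_vec[OF A' residual_carrier(1) es] mult_mat_vec[OF A' residual_carrier(1)] cross e0)
  also have "(?e \<cdot>\<^sub>m mat_adjoint ?B) *\<^sub>v (?r + ?e \<cdot>\<^sub>v ?s) = ?e \<cdot>\<^sub>v (?e \<cdot>\<^sub>v (mat_adjoint ?B *\<^sub>v ?s))"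
    using B c by (simp add: smult_mat_mult_vec mult_add_distrib_mat_vec[OF B' residual_carrier(1) es] mult_mat_vec[OF B' residual_carrier(1)] cross)
  also have "\<dots> = of_real (\<epsilon>\<^sup>2) \<cdot>\<^sub>v (mat_adjoint ?B *\<^sub>v ?s)"
    by (simp add: smult_smult_assoc power2_eq_square)
  finally show ?thesis unfolding PC residual_sample(1)[OF i] .
qed

text \<open>The variances decide: the squared residual of \<open>f + f'\<close> exceeds that of
  \<open>f\<close> by the squared residual of \<open>f'\<close>, yet both must equal
  \<open>n\<close> times the same variance. Conversely, with vanishing residuals of
  \<open>f'\<close> the normal equations and variances of \<open>f\<close> carry over.\<close>

lemma is_unique_MLE_sample_1_iff:
  "is_unique_MLE n m E (f + f') (\<Lambda>, \<omega>) \<longleftrightarrow> (\<forall>i<m. residual n E \<Lambda> f' i = 0\<^sub>v n)"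
proof -
  note M = MLE[unfolded is_MLE_iff[OF E f mn]]
  have B: "parent_cols E f' i \<in> carrier_mat n (card (pa E i))" for i using f' by simp
  have "is_unique_MLE n m E (sample 1) (\<Lambda>, \<omega>) \<longleftrightarrow> is_MLE n m E (sample 1) (\<Lambda>, \<omega>)"
    by (rule is_unique_MLE_of_injective[OF E sample_carrier mn sample_injective]) simp
  also have "\<dots> \<longleftrightarrow> (\<forall>i<m. residual n E \<Lambda> f' i = 0\<^sub>v n)"
  proof
    assume "is_MLE n m E (sample 1) (\<Lambda>, \<omega>)"
    then have "nsq (residual n E \<Lambda> f' i) = 0" if "i < m" for i
      using that M unfolding is_MLE_iff[OF E sample_carrier mn] by (simp add: residual_sample(2))
    then show "\<forall>i<m. residual n E \<Lambda> f' i = 0\<^sub>v n" using nsq_eq_0_iff[OF residual_carrier(1)] by blast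
  next
    assume 0: "\<forall>i<m. residual n E \<Lambda> f' i = 0\<^sub>v n"
    have "mat_adjoint (parent_cols E f' i) *\<^sub>v 0\<^sub>v n = 0\<^sub>v (card (pa E i))" for i
      using B[of i] by (intro eq_vecI) (auto simp: mat_adjoint_carrier)
    moreover have "nsq (0\<^sub>v n :: 'a vec) = 0" by (simp add: nsq_def)
    ultimately show "is_MLE n m E (sample 1) (\<Lambda>, \<omega>)"
      using M 0 unfolding is_MLE_iff[OF E sample_carrier mn]
      by (simp add: residual_sample(2) adjoint_residual_sample)
  qed
  finally show ?thesis by (simp add: sample_1)
qed

lemma least_squares:
  assumes i: "i < m"
  shows "perturbed_least_squares n (card (pa E i)) (parent_cols E f i) (parent_cols E f' i)
    (col f i) (col f' i) (edge_vec E \<Lambda> i)"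
proof
  show "parent_cols E f i \<in> carrier_mat n (card (pa E i))" "parent_cols E f' i \<in> carrier_mat n (card (pa E i))"
    using f f' by simp_all
  show "col f i \<in> carrier_vec n" "col f' i \<in> carrier_vec n" using f f' i by auto
  show "edge_vec E \<Lambda> i \<in> carrier_vec (card (pa E i))" by simp
  show "mat_adjoint (parent_cols E f i) *\<^sub>v (col f i - parent_cols E f i *\<^sub>v edge_vec E \<Lambda> i) = 0\<^sub>v (card (pa E i))"
    using MLE i unfolding is_MLE_iff[OF E f mn] by (simp flip: residual_eq[OF E f i])
  fix x :: "'a vec" assume x: "x \<in> carrier_vec (card (pa E i))"
    and 0: "parent_cols E f i *\<^sub>v x = 0\<^sub>v n" "parent_cols E f' i *\<^sub>v x = 0\<^sub>v n"
  have "(f + f') *\<^sub>v spread m E i x = 0\<^sub>v n"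
    using 0 by (simp add: add_mult_distrib_mat_vec[OF f f' spread_carrier(1)] mult_spread[OF E f x] mult_spread[OF E f' x])
  then have "spread m E i x = 0\<^sub>v m"
    using sample_injective[of 1] f f' unfolding sample_1 mat_injective_def by auto
  then show "x = 0\<^sub>v (card (pa E i))" by (rule spread_eq_0[OF E x])
qed

definition deviation :: "nat \<Rightarrow> real \<Rightarrow> 'a vec" where
  "deviation i = perturbed_least_squares.y (card (pa E i)) (parent_cols E f i) (parent_cols E f' i) (col f' i) (edge_vec E \<Lambda> i)"

definition limit_deviation :: "nat \<Rightarrow> 'a vec" where
  "limit_deviation i = perturbed_least_squares.y\<^sub>0 (card (pa E i)) (parent_cols E f i) (parent_cols E f' i) (col f' i) (edge_vec E \<Lambda> i)"

lemma deviation_carrier: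
  "i < m \<Longrightarrow> deviation i \<epsilon> \<in> carrier_vec (card (pa E i))"
  "i < m \<Longrightarrow> limit_deviation i \<in> carrier_vec (card (pa E i))"
  using perturbed_least_squares.y_carrier(1)[OF least_squares] perturbed_least_squares.y\<^sub>0_carrier(1)[OF least_squares]
  by (simp_all add: deviation_def limit_deviation_def)

lemma deviation_tendsto:
  "i < m \<Longrightarrow> r < card (pa E i) \<Longrightarrow> ((\<lambda>\<epsilon>. deviation i \<epsilon> $ r) \<longlongrightarrow> limit_deviation i $ r) (at 0)"
  unfolding deviation_def limit_deviation_def by (rule perturbed_least_squares.y_tendsto[OF least_squares])

lemma is_MLE_sample_iff:
  assumes "\<epsilon> \<noteq> 0"
  shows "is_MLE n m E (sample \<epsilon>) (L, w) \<longleftrightarrow> (L, w) \<in> dag_params m E \<and>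
    (\<forall>i<m. edge_vec E L i = edge_vec E \<Lambda> i + deviation i \<epsilon> \<and>
           nsq (residual n E L (sample \<epsilon>) i) = real n * w $ i)"
proof -
  have "mat_adjoint (parent_cols E (sample \<epsilon>) i) *\<^sub>v residual n E L (sample \<epsilon>) i = 0\<^sub>v (card (pa E i))
      \<longleftrightarrow> edge_vec E L i = edge_vec E \<Lambda> i + deviation i \<epsilon>" if i: "i < m" for i
    unfolding adjoint_residual_sample[OF i] residual_eq[OF E f i] residual_eq[OF E f' i] deviation_def
    by (rule perturbed_least_squares.normal_equation_iff[OF least_squares[OF i] assms edge_vec_carrier(1)])
  then show ?thesis unfolding is_MLE_iff[OF E sample_carrier mn] by blast
qed

definition estimate :: "real \<Rightarrow> 'a mat \<times> real vec" where
  "estimate \<epsilon> = (let L = edge_matrix m E (\<lambda>i. edge_vec E \<Lambda> i + deviation i \<epsilon>)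
     in (L, vec m (\<lambda>i. nsq (residual n E L (sample \<epsilon>) i) / real n)))"

lemma is_MLE_estimate:
  assumes "\<epsilon> \<noteq> 0"
  shows "is_MLE n m E (sample \<epsilon>) (estimate \<epsilon>)"
proof -
  have "edge_vec E \<Lambda> i + deviation i \<epsilon> \<in> carrier_vec (card (pa E i))" if "i < m" for i
    using deviation_carrier(1)[OF that] by simp
  then show ?thesis
    unfolding estimate_def Let_def is_MLE_sample_iff[OF assms]
    using mn residual_nonzero[OF E sample_carrier sample_injective[OF assms]]
    by (auto intro!: edge_matrix_in_dag_params[OF E] simp: edge_vec_edge_matrix[OF E])
qed

text \<open>Along parent edges the deviation is the difference between the MLE at
  \<open>\<epsilon>\<close> and \<open>\<Lambda>\<close>. The variances follow: they depend
  continuously on the edge weights and the sample, and the residual variances of \<open>f\<close>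
  are \<open>\<omega>\<close>.\<close>

lemma is_limit_MLE_iff:
  "is_limit_MLE n m E f (f + f') (\<Lambda>, \<omega>) \<longleftrightarrow> (\<forall>i<m. limit_deviation i = 0\<^sub>v (card (pa E i)))"
proof -
  note M = MLE[unfolded is_MLE_iff[OF E f mn]]
  have \<Lambda>: "\<Lambda> \<in> carrier_mat m m" "\<And>i j. i < m \<Longrightarrow> j < m \<Longrightarrow> j \<notin> pa E i \<Longrightarrow> \<Lambda> $$ (i, j) = 0" "\<omega> \<in> carrier_vec m"
    using M by (auto simp: dag_params_def)
  have diff: "f + f' - f = f'" using f f' by (intro eq_matI) auto
  have unique: "is_unique_MLE n m E (f + of_real \<epsilon> \<cdot>\<^sub>m (f + f' - f)) \<alpha> \<longleftrightarrow> is_MLE n m E (sample \<epsilon>) \<alpha>" if "\<epsilon> \<noteq> 0" for \<epsilon> \<alpha>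
    unfolding diff sample_def[symmetric]
    by (rule is_unique_MLE_of_injective[OF E sample_carrier mn sample_injective[OF that]])
  show ?thesis
  proof
    assume "is_limit_MLE n m E f (f + f') (\<Lambda>, \<omega>)"
    then obtain S where *: "\<forall>\<epsilon>::real. \<epsilon> \<noteq> 0 \<longrightarrow> is_unique_MLE n m E (f + of_real \<epsilon> \<cdot>\<^sub>m (f + f' - f)) (S \<epsilon>)"
      "\<forall>i<m. \<forall>j<m. ((\<lambda>\<epsilon>. fst (S \<epsilon>) $$ (i, j)) \<longlongrightarrow> \<Lambda> $$ (i, j)) (at 0)"
      unfolding is_limit_MLE_def fst_conv by blast
    have S: "is_MLE n m E (sample \<epsilon>) (S \<epsilon>)" if "\<epsilon> \<noteq> 0" for \<epsilon> using *(1) unique[OF that] that by blast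
    have lim: "((\<lambda>\<epsilon>. fst (S \<epsilon>) $$ (i, j)) \<longlongrightarrow> \<Lambda> $$ (i, j)) (at 0)" if "i < m" "j < m" for i j
      using *(2) that by blast
    show "\<forall>i<m. limit_deviation i = 0\<^sub>v (card (pa E i))"
    proof (intro allI impI eq_vecI)
      fix i r assume i: "i < m" and "r < dim_vec (0\<^sub>v (card (pa E i)))"
      then have r: "r < card (pa E i)" by simp
      have eq: "deviation i \<epsilon> $ r = fst (S \<epsilon>) $$ (i, parents E i ! r) - \<Lambda> $$ (i, parents E i ! r)" if "\<epsilon> \<noteq> 0" for \<epsilon>
      proof -
        have "edge_vec E (fst (S \<epsilon>)) i = edge_vec E \<Lambda> i + deviation i \<epsilon>"
          using S[OF that] i is_MLE_sample_iff[OF that, of "fst (S \<epsilon>)" "snd (S \<epsilon>)"] by simp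
        then have "edge_vec E (fst (S \<epsilon>)) i $ r = edge_vec E \<Lambda> i $ r + deviation i \<epsilon> $ r"
          using r carrier_vecD[OF deviation_carrier(1)[OF i, of \<epsilon>]] by simp
        then show ?thesis using r by (simp add: edge_vec_index)
      qed
      have "((\<lambda>\<epsilon>. fst (S \<epsilon>) $$ (i, parents E i ! r) - \<Lambda> $$ (i, parents E i ! r)) \<longlongrightarrow>
          \<Lambda> $$ (i, parents E i ! r) - \<Lambda> $$ (i, parents E i ! r)) (at 0)"
        by (intro tendsto_intros lim i parents_nth_less[OF E r])
      then have "((\<lambda>\<epsilon>. deviation i \<epsilon> $ r) \<longlongrightarrow> 0) (at 0)"
        by (simp, elim Lim_transform_eventually) (auto simp: eventually_at_filter eq)
      with deviation_tendsto[OF i r] have "limit_deviation i $ r = 0"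
        by (intro tendsto_unique[of "at (0::real)"]) auto
      then show "limit_deviation i $ r = 0\<^sub>v (card (pa E i)) $ r" using r by simp
    qed (use deviation_carrier(2) in auto)
  next
    assume 0: "\<forall>i<m. limit_deviation i = 0\<^sub>v (card (pa E i))"
    have edges: "((\<lambda>\<epsilon>. fst (estimate \<epsilon>) $$ (i, j)) \<longlongrightarrow> \<Lambda> $$ (i, j)) (at 0)" if ij: "i < m" "j < m" for i j
    proof (cases "j \<in> pa E i")
      case False
      then show ?thesis using ij by (simp add: estimate_def Let_def edge_matrix_def spread_index(2)[OF E] \<Lambda>(2))
    next
      case True
      then obtain r where r: "r < card (pa E i)" "j = parents E i ! r"
        using bij_betw_parents[OF E, of i] by (auto simp: bij_betw_def)
      have "fst (estimate \<epsilon>) $$ (i, j) = \<Lambda> $$ (i, j) + deviation i \<epsilon> $ r" for \<epsilon>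
        using r ij carrier_vecD[OF deviation_carrier(1)[OF ij(1), of \<epsilon>]]
        by (simp add: estimate_def Let_def edge_matrix_def edge_vec_index spread_index(1)[OF E r(1)])
      moreover have "((\<lambda>\<epsilon>. \<Lambda> $$ (i, j) + deviation i \<epsilon> $ r) \<longlongrightarrow> \<Lambda> $$ (i, j) + 0) (at 0)"
        using deviation_tendsto[OF ij(1) r(1)] 0 ij(1) r(1) by (intro tendsto_intros) simp
      ultimately show ?thesis by simp
    qed
    have variances: "((\<lambda>\<epsilon>. snd (estimate \<epsilon>) $ i) \<longlongrightarrow> \<omega> $ i) (at 0)" if i: "i < m" for i
    proof -
      have sample: "((\<lambda>\<epsilon>. sample \<epsilon> $$ (k, j)) \<longlongrightarrow> f $$ (k, j)) (at 0)" if "k < n" "j < m" for k j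
      proof -
        have "((\<lambda>\<epsilon>::real. f $$ (k, j) + of_real \<epsilon> * f' $$ (k, j)) \<longlongrightarrow> f $$ (k, j) + of_real 0 * f' $$ (k, j)) (at 0)"
          by (intro tendsto_intros)
        then show ?thesis using that f f' by (simp add: sample_def)
      qed
      have "((\<lambda>\<epsilon>. residual n E (fst (estimate \<epsilon>)) (sample \<epsilon>) i $ k) \<longlongrightarrow> residual n E \<Lambda> f i $ k) (at 0)" if k: "k < n" for k
        using k i pa_subset[OF E, of i] unfolding residual_def
        by (simp, intro tendsto_intros edges sample) auto
      then have "((\<lambda>\<epsilon>. nsq (residual n E (fst (estimate \<epsilon>)) (sample \<epsilon>) i) / real n) \<longlongrightarrow> nsq (residual n E \<Lambda> f i) / real n) (at 0)"
        using i mn unfolding nsq_def by (simp, intro tendsto_intros) auto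
      moreover have "nsq (residual n E \<Lambda> f i) / real n = \<omega> $ i" using M i mn by simp
      ultimately show ?thesis using i by (simp add: estimate_def Let_def)
    qed
    show "is_limit_MLE n m E f (f + f') (\<Lambda>, \<omega>)"
      unfolding is_limit_MLE_def using \<Lambda> unique is_MLE_estimate edges variances
      by (simp, intro exI[of _ estimate]) auto
  qed
qed

end

subsection \<open>The derivatives of the adjugate\<close>

lemma span_cols_eq:
  fixes A :: "'a::field mat"
  assumes A: "A \<in> carrier_mat n p"
  shows "LinearCombinations.module.span class_ring (module_vec TYPE('a) n) (set (cols A)) = (*\<^sub>v) A ` carrier_vec p"
  using vec_space.col_space_eq[OF A] A unfolding vec_space.col_space_def by auto

text \<open>The normal equation says that \<open>a - A x\<close> is orthogonal to the range. Two
  such points of the range differ by a vector of the range orthogonal to it, hence by 0.\<close>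

lemma orth_proj_range:
  fixes A :: "'a::real_or_complex mat"
  assumes A: "A \<in> carrier_mat n p" and a: "a \<in> carrier_vec n" and x: "x \<in> carrier_vec p"
    and normal: "mat_adjoint A *\<^sub>v (a - A *\<^sub>v x) = 0\<^sub>v p"
  shows "orth_proj n ((*\<^sub>v) A ` carrier_vec p) a = A *\<^sub>v x"
  unfolding orth_proj_def
proof (rule the_equality)
  have Ax: "A *\<^sub>v z \<in> carrier_vec n" if "z \<in> carrier_vec p" for z
    by (rule mult_mat_vec_carrier[OF A that])
  have orth: "a - A *\<^sub>v z \<in> orth_compl n ((*\<^sub>v) A ` carrier_vec p) \<longleftrightarrow> mat_adjoint A *\<^sub>v (a - A *\<^sub>v z) = 0\<^sub>v p"
    if "z \<in> carrier_vec p" for z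
    using Ax[OF that] a adjoint_mult_eq_0_iff[OF A, of "a - A *\<^sub>v z"] by (auto simp: orth_compl_def)
  show "A *\<^sub>v x \<in> (*\<^sub>v) A ` carrier_vec p \<and> a - A *\<^sub>v x \<in> orth_compl n ((*\<^sub>v) A ` carrier_vec p)"
    using orth[OF x] normal x by blast
  fix v assume v: "v \<in> (*\<^sub>v) A ` carrier_vec p \<and> a - v \<in> orth_compl n ((*\<^sub>v) A ` carrier_vec p)"
  then obtain z where z: "z \<in> carrier_vec p" and v_eq: "v = A *\<^sub>v z" by blast
  have xz: "x - z \<in> carrier_vec p" using x z by simp
  have "(a - v) \<bullet>c (A *\<^sub>v (x - z)) = 0" "(a - A *\<^sub>v x) \<bullet>c (A *\<^sub>v (x - z)) = 0"
    using v orth[OF x] normal xz by (auto simp: orth_compl_def)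
  moreover have "A *\<^sub>v (x - z) = (a - v) - (a - A *\<^sub>v x)"
    unfolding v_eq mult_minus_distrib_mat_vec[OF A x z] using a Ax[OF x] Ax[OF z]
    by (intro eq_vecI) (auto simp del: index_mult_mat_vec)
  ultimately have "(A *\<^sub>v (x - z)) \<bullet>c (A *\<^sub>v (x - z)) = 0"
    using minus_scalar_prod_distrib[of "a - v" n "a - A *\<^sub>v x" "conjugate (A *\<^sub>v (x - z))"] a Ax[OF x] Ax[OF z] Ax[OF xz]
    by (simp add: v_eq)
  then have 0: "A *\<^sub>v x - A *\<^sub>v z = 0\<^sub>v n"
    using cscalar_prod_self_eq_0[OF Ax[OF xz]] mult_minus_distrib_mat_vec[OF A x z] by simp
  have "A *\<^sub>v x = (A *\<^sub>v x - A *\<^sub>v z) + A *\<^sub>v z"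
    using Ax[OF x] Ax[OF z] by (intro eq_vecI) (auto simp del: index_mult_mat_vec)
  then show "v = A *\<^sub>v x" unfolding 0 v_eq using Ax[OF z] by simp
qed

lemma conjugate_unit_vec: "conjugate (unit_vec p r :: 'a::real_or_complex vec) = unit_vec p r"
  using conjugate_of_real[of 1, where 'a = 'a] by (intro eq_vecI) (auto simp: unit_vec_def)

text \<open>Replacing a column by its projection onto the span of its parents does not change its
  inner products with them, so these are the right-hand sides of the normal equations.\<close>

lemma proj_products_eq:
  fixes Y :: "'a::real_or_complex mat"
  assumes E: "dag_on m E" and Y: "Y \<in> carrier_mat n m" and i: "i < m"
  shows "proj_products E Y i = mat_adjoint (parent_cols E Y i) *\<^sub>v col Y i"
proof -
  let ?A = "parent_cols E Y i" and ?p = "card (pa E i)"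
  have A: "?A \<in> carrier_mat n ?p" using Y by simp
  have a: "col Y i \<in> carrier_vec n" using Y i by auto
  obtain x where x: "x \<in> carrier_vec ?p" and normal: "mat_adjoint ?A *\<^sub>v (col Y i - ?A *\<^sub>v x) = 0\<^sub>v ?p"
    using ex_normal_solution[OF A a] by blast
  have Ax: "?A *\<^sub>v x \<in> carrier_vec n" by (rule mult_mat_vec_carrier[OF A x])
  have set: "set (parents E i) = pa E i" using finite_pa[OF E] by (simp add: parents_def)
  have "set (cols ?A) = col Y ` pa E i"
    unfolding parent_cols_def using Y by (subst cols_mat_of_cols) (auto simp: set)
  then have proj: "orth_proj (dim_row Y) (LinearCombinations.module.span class_ring
      (module_vec TYPE('a) (dim_row Y)) (col Y ` pa E i)) (col Y i) = ?A *\<^sub>v x"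
    using orth_proj_range[OF A a x normal] span_cols_eq[OF A] Y by simp
  have colA: "col ?A r = col Y (parents E i ! r)" if "r < ?p" for r
    using that Y unfolding parent_cols_def by (subst col_mat_of_cols) auto
  show ?thesis
  proof (rule eq_vecI)
    show "dim_vec (proj_products E Y i) = dim_vec (mat_adjoint ?A *\<^sub>v col Y i)"
      using carrier_matD[OF A] by (simp add: proj_products_def Let_def)
    fix r assume "r < dim_vec (mat_adjoint ?A *\<^sub>v col Y i)"
    then have r: "r < ?p" using carrier_matD[OF A] by simp
    have unit: "?A *\<^sub>v unit_vec ?p r = col ?A r" using A r by (intro eq_vecI) auto
    have entry: "(mat_adjoint ?A *\<^sub>v v) $ r = v \<bullet>c col ?A r" if v: "v \<in> carrier_vec n" for v
      using cscalar_prod_mult_mat_vec_right[OF A unit_vec_carrier v, of r] r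
        mult_mat_vec_carrier[OF mat_adjoint_carrier[OF A] v]
      unfolding unit by (simp add: conjugate_unit_vec scalar_prod_right_unit)
    have "mat_adjoint ?A *\<^sub>v (?A *\<^sub>v x) = mat_adjoint ?A *\<^sub>v col Y i"
    proof (rule eq_vecI)
      fix k assume "k < dim_vec (mat_adjoint ?A *\<^sub>v col Y i)"
      then have k: "k < ?p" using carrier_matD[OF A] by simp
      have "(mat_adjoint ?A *\<^sub>v col Y i - mat_adjoint ?A *\<^sub>v (?A *\<^sub>v x)) $ k = 0"
        using normal k unfolding mult_minus_distrib_mat_vec[OF mat_adjoint_carrier[OF A] a Ax] by simp
      then show "(mat_adjoint ?A *\<^sub>v (?A *\<^sub>v x)) $ k = (mat_adjoint ?A *\<^sub>v col Y i) $ k"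
        using k carrier_matD[OF A] by (simp del: index_mult_mat_vec)
    qed simp
    then have "(?A *\<^sub>v x) \<bullet>c col ?A r = (mat_adjoint ?A *\<^sub>v col Y i) $ r" using entry[OF Ax] by simp
    then show "proj_products E Y i $ r = (mat_adjoint ?A *\<^sub>v col Y i) $ r"
      using r by (simp add: proj_products_def Let_def proj vec_of_list_index colA)
  qed
qed

context perturbed_sample
begin

text \<open>\<open>c_coeff\<close> is \<open>fact k\<close> times a coefficient of the determinant,
  and \<open>D_coeff\<close> at \<open>k\<close> has entries \<open>fact k\<close> times
  coefficients of Cramer's numerator. The contribution of \<open>edge_vec E \<Lambda> i\<close>
  cancels, which leaves the numerator of the limiting deviation.\<close>

lemma limit_equation_iff:
  assumes i: "i < m"
  shows "(let l = vanishing_order E f f' i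
      in c_coeff E f f' i l \<cdot>\<^sub>v edge_vec E \<Lambda> i - D_coeff E f f' i l = 0\<^sub>v (card (pa E i)))
    \<longleftrightarrow> limit_deviation i = 0\<^sub>v (card (pa E i))"
proof -
  let ?p = "card (pa E i)"
  interpret L: perturbed_least_squares n ?p "parent_cols E f i" "parent_cols E f' i" "col f i" "col f' i" "edge_vec E \<Lambda> i"
    by (rule least_squares[OF i])
  have gram: "C' E f f' i t = L.gram t" for t by (simp add: C'_def L.gram_def)
  have adj: "deriv_adj E f f' i k = L.adj_deriv k" for k
    by (simp add: deriv_adj_def L.adj_deriv_def gram)
  have c: "c_coeff E f f' i k = fact k * coeff L.d k" for k
  proof (cases k)
    case 0
    then show ?thesis using L.poly_d[of 0] by (simp add: c_coeff_def gram poly_0_coeff_0)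
  next
    case (Suc k')
    then show ?thesis using L.trace_adj_deriv[of k'] by (simp add: c_coeff_def adj)
  qed
  \<comment> \<open>Beyond the degree all coefficients vanish, so the bound in
    \<open>vanishing_order\<close> does not change the least index.\<close>
  have "coeff L.d k \<noteq> 0 \<Longrightarrow> k \<le> ?p" for k
    using le_degree[of L.d k] L.degree_d by simp
  then have l: "vanishing_order E f f' i = L.l"
    unfolding vanishing_order_def L.l_def c by (intro arg_cong[of _ _ Least] ext) auto
  have D: "(c_coeff E f f' i k \<cdot>\<^sub>v edge_vec E \<Lambda> i - D_coeff E f f' i k) $ r = - (fact k * coeff (L.g r) k)"
    if r: "r < ?p" for r k
  proof -
    have "D_coeff E f f' i k $ r = fact k * (coeff L.d k * edge_vec E \<Lambda> i $ r + coeff (L.g r) k)"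
      unfolding L.adj_deriv_numerator[OF r, symmetric] D_coeff_def adj
        proj_products_eq[OF E f i] proj_products_eq[OF E f' i]
      using r carrier_matD[OF L.adj_deriv_carrier] by (simp del: index_mult_mat_vec)
    moreover have "dim_vec (D_coeff E f f' i k) = ?p"
      using carrier_matD[OF L.adj_deriv_carrier] by (simp add: D_coeff_def adj)
    ultimately show ?thesis using r by (simp add: c algebra_simps)
  qed
  have dimD: "dim_vec (D_coeff E f f' i k) = ?p" for k
    using carrier_matD[OF L.adj_deriv_carrier] by (simp add: D_coeff_def adj)
  have "(c_coeff E f f' i L.l \<cdot>\<^sub>v edge_vec E \<Lambda> i - D_coeff E f f' i L.l = 0\<^sub>v ?p)
      \<longleftrightarrow> (\<forall>r<?p. (c_coeff E f f' i L.l \<cdot>\<^sub>v edge_vec E \<Lambda> i - D_coeff E f f' i L.l) $ r = 0)"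
    using dimD by (auto simp: vec_eq_iff)
  also have "\<dots> \<longleftrightarrow> (\<forall>r<?p. coeff (L.g r) L.l = 0)"
  proof -
    have "(c_coeff E f f' i L.l \<cdot>\<^sub>v edge_vec E \<Lambda> i - D_coeff E f f' i L.l) $ r = 0 \<longleftrightarrow> coeff (L.g r) L.l = 0"
      if "r < ?p" for r
      unfolding D[OF that] by simp
    then show ?thesis by blast
  qed
  also have "\<dots> \<longleftrightarrow> L.y\<^sub>0 = 0\<^sub>v ?p"
    using L.coeff_d_l(1) by (auto simp: L.y\<^sub>0_def vec_eq_iff)
  finally show ?thesis by (simp add: l limit_deviation_def)
qed

lemma limit_deviation_eq_0_iff:
  assumes i: "i < m"
  shows "limit_deviation i = 0\<^sub>v (card (pa E i)) \<longleftrightarrow>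
    (\<forall>z\<in>carrier_vec (card (pa E i)). parent_cols E f i *\<^sub>v z = 0\<^sub>v n \<longrightarrow>
      residual n E \<Lambda> f' i \<bullet>c (parent_cols E f' i *\<^sub>v z) = 0)"
proof -
  interpret L: perturbed_least_squares n "card (pa E i)" "parent_cols E f i" "parent_cols E f' i" "col f i" "col f' i" "edge_vec E \<Lambda> i"
    by (rule least_squares[OF i])
  show ?thesis
    using L.y\<^sub>0_eq_0_iff unfolding limit_deviation_def residual_eq[OF E f' i] L.h_def .
qed

end

subsection \<open>Zariski closed sets\<close>

lemma polynomials_in_sum:
  assumes "\<And>k. k \<in> S \<Longrightarrow> F k \<in> polynomials_in G"
  shows "(\<lambda>x. \<Sum>k\<in>S. F k x) \<in> polynomials_in G"
  using assms by (induction S rule: infinite_finite_induct)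
    (auto intro: polynomials_in.const polynomials_in.add[of "F _" _ "\<lambda>x. \<Sum>k\<in>_. F k x"])

lemma polynomials_in_prod:
  assumes "\<And>k. k \<in> S \<Longrightarrow> F k \<in> polynomials_in G"
  shows "(\<lambda>x. \<Prod>k\<in>S. F k x) \<in> polynomials_in G"
  using assms by (induction S rule: infinite_finite_induct)
    (auto intro: polynomials_in.const polynomials_in.mult[of "F _" _ "\<lambda>x. \<Prod>k\<in>_. F k x"])

lemma polynomials_in_diff:
  assumes "p \<in> polynomials_in G" "q \<in> polynomials_in G"
  shows "(\<lambda>x. p x - q x) \<in> polynomials_in G"
proof -
  have "(\<lambda>x. p x + (- 1) * q x) \<in> polynomials_in G"
    by (intro polynomials_in.add polynomials_in.mult polynomials_in.const assms)
  then show ?thesis by simp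
qed

lemma polynomials_in_det:
  assumes "\<And>i j. i < m \<Longrightarrow> j < m \<Longrightarrow> (\<lambda>x. M x (i, j)) \<in> polynomials_in G"
  shows "(\<lambda>x. Determinant.det (mat m m (M x))) \<in> polynomials_in G"
proof -
  have "Determinant.det (mat m m (M x)) =
      (\<Sum>q\<in>{q. q permutes {0..<m}}. signof q * (\<Prod>i=0..<m. M x (i, q i)))" for x
  proof -
    have "(\<Prod>i=0..<m. mat m m (M x) $$ (i, q i)) = (\<Prod>i=0..<m. M x (i, q i))" if "q permutes {0..<m}" for q
      using permutes_in_image[OF that] by (intro prod.cong) auto
    then show ?thesis by (simp add: det_def'[of _ m])
  qed
  moreover have "(\<lambda>x. \<Sum>q\<in>{q. q permutes {0..<m}}. signof q * (\<Prod>i=0..<m. M x (i, q i))) \<in> polynomials_in G"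
  proof (intro polynomials_in_sum polynomials_in.mult polynomials_in.const polynomials_in_prod)
    fix q i assume "q \<in> {q. q permutes {0..<m}}" "i \<in> {0..<m}"
    then show "(\<lambda>x. M x (i, q i)) \<in> polynomials_in G"
      using permutes_in_image[of q "{0..<m}" i] by (intro assms) auto
  qed
  ultimately show ?thesis by simp
qed

lemma entry_in_entries: "k < n \<Longrightarrow> j < m \<Longrightarrow> (\<lambda>X. X $$ (k, j)) \<in> polynomials_in (entries n m)"
  by (rule polynomials_in.gen) (auto simp: entries_def)

lemma entry_in_real_entries:
  "k < n \<Longrightarrow> j < m \<Longrightarrow> (\<lambda>X. X $$ (k, j)) \<in> polynomials_in (real_entries n m)"
  "k < n \<Longrightarrow> j < m \<Longrightarrow> (\<lambda>X. conjugate (X $$ (k, j))) \<in> polynomials_in (real_entries n m)"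
  by (rule polynomials_in.gen; auto simp: entries_def real_entries_def)+

text \<open>The index set \<open>S\<close> may be infinite. Orthogonality can thus be imposed for
  all test vectors, without choosing bases.\<close>

lemma zariski_closedI:
  assumes "\<And>s. s \<in> S \<Longrightarrow> p s \<in> polynomials_in G"
    and "\<And>X. X \<in> carrier_mat n m \<Longrightarrow> X \<in> Z \<longleftrightarrow> (\<forall>s\<in>S. p s X = 0)" and "Z \<subseteq> carrier_mat n m"
  shows "zariski_closed G n m Z"
  unfolding zariski_closed_def using assms by (intro exI[of _ "p ` S"]) auto

lemma zariski_closed_Int:
  assumes "zariski_closed G n m V" "zariski_closed G n m W"
  shows "zariski_closed G n m (V \<inter> W)"
proof -
  obtain P Q where "P \<subseteq> polynomials_in G" "V = {X \<in> carrier_mat n m. \<forall>p\<in>P. p X = 0}"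
    and "Q \<subseteq> polynomials_in G" "W = {X \<in> carrier_mat n m. \<forall>p\<in>Q. p X = 0}"
    using assms unfolding zariski_closed_def by blast
  then show ?thesis unfolding zariski_closed_def by (intro exI[of _ "P \<union> Q"]) auto
qed

text \<open>The adjoint of \<open>Y\<close> would do as \<open>B\<close>, but its Gram determinant
  involves conjugates. Letting \<open>B\<close> range over all constant matrices makes injectivity
  an open condition that is polynomial in the entries of \<open>Y\<close> alone.\<close>

lemma mat_injective_iff_det:
  fixes Y :: "'a::real_or_complex mat"
  assumes Y: "Y \<in> carrier_mat n m"
  shows "mat_injective Y \<longleftrightarrow> (\<exists>B\<in>carrier_mat m n. Determinant.det (B * Y) \<noteq> 0)"
proof
  assume inj: "mat_injective Y"
  let ?B = "mat_adjoint Y"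
  have B: "?B \<in> carrier_mat m n" using Y by simp
  have BY: "?B * Y \<in> carrier_mat m m" by (rule mult_carrier_mat[OF B Y])
  have "Determinant.det (?B * Y) \<noteq> 0"
  proof
    assume "Determinant.det (?B * Y) = 0"
    then obtain v where v: "v \<in> carrier_vec m" "v \<noteq> 0\<^sub>v m" "(?B * Y) *\<^sub>v v = 0\<^sub>v m"
      using det_0_iff_vec_prod_zero_field[OF BY] by blast
    have Yv: "Y *\<^sub>v v \<in> carrier_vec n" by (rule mult_mat_vec_carrier[OF Y v(1)])
    have "?B *\<^sub>v (Y *\<^sub>v v) = 0\<^sub>v m" using v(3) by (simp only: assoc_mult_mat_vec[OF B Y v(1)])
    then have "(Y *\<^sub>v v) \<bullet>c (Y *\<^sub>v v) = 0" using adjoint_mult_eq_0_iff[OF Y Yv] v(1) by blast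
    then have "Y *\<^sub>v v = 0\<^sub>v n" by (rule cscalar_prod_self_eq_0[OF Yv])
    then show False using inj Y v by (auto simp: mat_injective_def)
  qed
  then show "\<exists>B\<in>carrier_mat m n. Determinant.det (B * Y) \<noteq> 0" using B by blast
next
  assume "\<exists>B\<in>carrier_mat m n. Determinant.det (B * Y) \<noteq> 0"
  then obtain B where B: "B \<in> carrier_mat m n" and det: "Determinant.det (B * Y) \<noteq> 0" by blast
  have "x = 0\<^sub>v m" if x: "x \<in> carrier_vec m" and 0: "Y *\<^sub>v x = 0\<^sub>v n" for x
  proof (rule ccontr)
    assume "x \<noteq> 0\<^sub>v m"
    moreover have "(B * Y) *\<^sub>v x = 0\<^sub>v m"
      unfolding assoc_mult_mat_vec[OF B Y x] 0 using B by (intro eq_vecI) auto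
    ultimately show False using det det_0_iff_vec_prod_zero_field[OF mult_carrier_mat[OF B Y]] x by blast
  qed
  then show "mat_injective Y" using Y by (auto simp: mat_injective_def)
qed

lemma zariski_locally_closed_X_pert:
  fixes f :: "'a::real_or_complex mat"
  assumes f: "f \<in> carrier_mat n m"
  shows "zariski_locally_closed (entries n m) n m (X_pert n m f)"
proof -
  define V\<^sub>1 where "V\<^sub>1 = {X \<in> carrier_mat n m. \<forall>x\<in>carrier_vec m. \<forall>z\<in>carrier_vec m. (X *\<^sub>v x) \<bullet>c (f *\<^sub>v z) = 0}"
  define V\<^sub>2 where "V\<^sub>2 = {X \<in> carrier_mat n m. \<forall>u\<in>carrier_vec n. X *\<^sub>v (mat_adjoint f *\<^sub>v u) = 0\<^sub>v n}"
  define W where "W = {X \<in> carrier_mat n m. \<not> mat_injective (f + X)}"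
  have X: "X_pert n m f = V\<^sub>1 \<inter> V\<^sub>2 - W"
    unfolding X_pert_def is_perturbation_iff[OF f] V\<^sub>1_def V\<^sub>2_def W_def by blast
  have "zariski_closed (entries n m) n m V\<^sub>1"
  proof (rule zariski_closedI)
    show "(case s of (x, z) \<Rightarrow> \<lambda>X. \<Sum>k<n. (\<Sum>j<m. X $$ (k, j) * x $ j) * conjugate ((f *\<^sub>v z) $ k)) \<in> polynomials_in (entries n m)"
      for s :: "'a vec \<times> 'a vec"
      by (cases s, simp only: prod.case)
        (intro polynomials_in_sum polynomials_in.mult polynomials_in.const entry_in_entries; simp)
    fix X :: "'a mat" assume X: "X \<in> carrier_mat n m"
    have "(X *\<^sub>v x) \<bullet>c (f *\<^sub>v z) = (\<Sum>k<n. (\<Sum>j<m. X $$ (k, j) * x $ j) * conjugate ((f *\<^sub>v z) $ k))"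
      if "x \<in> carrier_vec m" "z \<in> carrier_vec m" for x z
      unfolding cscalar_prod_sum[OF mult_mat_vec_carrier[OF X that(1)] mult_mat_vec_carrier[OF f that(2)]]
      by (intro sum.cong refl) (simp only: mult_mat_vec_sum[OF X that(1)] lessThan_iff)
    then show "X \<in> V\<^sub>1 \<longleftrightarrow> (\<forall>s\<in>carrier_vec m \<times> carrier_vec m.
        (case s of (x, z) \<Rightarrow> \<lambda>X. \<Sum>k<n. (\<Sum>j<m. X $$ (k, j) * x $ j) * conjugate ((f *\<^sub>v z) $ k)) X = 0)"
      using X by (auto simp: V\<^sub>1_def simp del: index_mult_mat_vec)
  qed (auto simp: V\<^sub>1_def)
  moreover have "zariski_closed (entries n m) n m V\<^sub>2"
  proof (rule zariski_closedI)
    show "(case s of (u, k) \<Rightarrow> \<lambda>X. \<Sum>j<m. X $$ (k, j) * (mat_adjoint f *\<^sub>v u) $ j) \<in> polynomials_in (entries n m)"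
      if "s \<in> carrier_vec n \<times> {..<n}" for s :: "'a vec \<times> nat"
      using that by (cases s, simp only: prod.case)
        (intro polynomials_in_sum polynomials_in.mult polynomials_in.const entry_in_entries; simp)
    fix X :: "'a mat" assume X: "X \<in> carrier_mat n m"
    have "X *\<^sub>v (mat_adjoint f *\<^sub>v u) = 0\<^sub>v n \<longleftrightarrow> (\<forall>k<n. (\<Sum>j<m. X $$ (k, j) * (mat_adjoint f *\<^sub>v u) $ j) = 0)"
      if u: "u \<in> carrier_vec n" for u
    proof -
      have v: "mat_adjoint f *\<^sub>v u \<in> carrier_vec m" by (rule mult_mat_vec_carrier[OF mat_adjoint_carrier[OF f] u])
      have "X *\<^sub>v (mat_adjoint f *\<^sub>v u) = 0\<^sub>v n \<longleftrightarrow> (\<forall>k<n. (X *\<^sub>v (mat_adjoint f *\<^sub>v u)) $ k = 0)"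
        using X by (auto simp: vec_eq_iff simp del: index_mult_mat_vec)
      then show ?thesis by (simp only: mult_mat_vec_sum[OF X v] cong: all_cong)
    qed
    then show "X \<in> V\<^sub>2 \<longleftrightarrow> (\<forall>s\<in>carrier_vec n \<times> {..<n}.
        (case s of (u, k) \<Rightarrow> \<lambda>X. \<Sum>j<m. X $$ (k, j) * (mat_adjoint f *\<^sub>v u) $ j) X = 0)"
      using X by (auto simp: V\<^sub>2_def simp del: index_mult_mat_vec)
  qed (auto simp: V\<^sub>2_def)
  moreover have "zariski_closed (entries n m) n m W"
  proof (rule zariski_closedI)
    show "(\<lambda>X. Determinant.det (mat m m (\<lambda>(i, j). \<Sum>k<n. B $$ (i, k) * (f $$ (k, j) + X $$ (k, j))))) \<in> polynomials_in (entries n m)"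
      for B :: "'a mat"
      by (rule polynomials_in_det, simp only: prod.case)
        (intro polynomials_in_sum polynomials_in.mult polynomials_in.add polynomials_in.const entry_in_entries; simp)
    fix X :: "'a mat" assume X: "X \<in> carrier_mat n m"
    have fX: "f + X \<in> carrier_mat n m" using f X by simp
    have "mat m m (\<lambda>(i, j). \<Sum>k<n. B $$ (i, k) * (f $$ (k, j) + X $$ (k, j))) = B * (f + X)"
      if B: "B \<in> carrier_mat m n" for B
      using B f X fX by (intro eq_matI) (auto simp: mult_mat_index_sum[OF B fX] simp del: index_mult_mat(1))
    then show "X \<in> W \<longleftrightarrow> (\<forall>B\<in>carrier_mat m n.
        Determinant.det (mat m m (\<lambda>(i, j). \<Sum>k<n. B $$ (i, k) * (f $$ (k, j) + X $$ (k, j)))) = 0)"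
      using X mat_injective_iff_det[OF fX] by (auto simp: W_def)
  qed (auto simp: W_def)
  ultimately show ?thesis
    unfolding zariski_locally_closed_def X using zariski_closed_Int by blast
qed

text \<open>Stated for any generators that yield the entries, as it serves both Zariski
  topologies.\<close>

lemma residual_polynomial:
  assumes "\<And>k j. k < n \<Longrightarrow> j < m \<Longrightarrow> (\<lambda>X. X $$ (k, j)) \<in> polynomials_in G"
    and "dag_on m E" "i < m" "k < n"
  shows "(\<lambda>X. residual n E \<Lambda> X i $ k) \<in> polynomials_in G"
proof -
  have "(\<lambda>X. X $$ (k, i) - (\<Sum>j\<in>pa E i. \<Lambda> $$ (i, j) * X $$ (k, j))) \<in> polynomials_in G"
    using pa_subset[OF assms(2), of i] assms(3,4)
    by (intro polynomials_in_diff polynomials_in_sum polynomials_in.mult polynomials_in.const assms(1)) auto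
  then show ?thesis using assms(4) by (simp add: residual_def)
qed

lemma zariski_closed_in_X_MLE:
  fixes f :: "'a::real_or_complex mat"
  assumes E: "dag_on m E"
  shows "zariski_closed_in (entries n m) n m (X_pert n m f) (X_MLE n m E f \<Lambda>)"
proof -
  define V where "V = {X \<in> carrier_mat n m. \<forall>i<m. residual n E \<Lambda> X i = 0\<^sub>v n}"
  have "zariski_closed (entries n m) n m V"
  proof (rule zariski_closedI)
    show "(case s of (i, k) \<Rightarrow> \<lambda>X. residual n E \<Lambda> X i $ k) \<in> polynomials_in (entries n m)"
      if "s \<in> {..<m} \<times> {..<n}" for s
      using that residual_polynomial[OF entry_in_entries E] by auto
    show "X \<in> V \<longleftrightarrow> (\<forall>s\<in>{..<m} \<times> {..<n}. (case s of (i, k) \<Rightarrow> \<lambda>X. residual n E \<Lambda> X i $ k) X = 0)"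
      if "X \<in> carrier_mat n m" for X
      using that by (auto simp: V_def vec_eq_iff)
  qed (auto simp: V_def)
  moreover have "X_MLE n m E f \<Lambda> = X_pert n m f \<inter> V"
    by (auto simp: X_MLE_def V_def X_pert_def is_perturbation_def)
  ultimately show ?thesis unfolding zariski_closed_in_def by blast
qed

lemma X_lim_iff:
  fixes f \<Lambda> :: "'a::real_or_complex mat"
  assumes "m \<le> n" "dag_on m E" "f \<in> carrier_mat n m" "is_MLE n m E f (\<Lambda>, \<omega>)" "X \<in> X_pert n m f"
  shows "X \<in> X_lim n m E f \<Lambda> \<longleftrightarrow> is_limit_MLE n m E f (f + X) (\<Lambda>, \<omega>)"
    and "X \<in> X_lim n m E f \<Lambda> \<longleftrightarrow> (\<forall>i<m. \<forall>z\<in>carrier_vec (card (pa E i)).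
      parent_cols E f i *\<^sub>v z = 0\<^sub>v n \<longrightarrow> residual n E \<Lambda> X i \<bullet>c (parent_cols E X i *\<^sub>v z) = 0)"
proof -
  interpret perturbed_sample n m E f X \<Lambda> \<omega>
    using assms by unfold_locales (auto simp: X_pert_def)
  \<comment> \<open>At a vertex without parents the vector is empty, so quantifying over child
    vertices amounts to quantifying over all vertices.\<close>
  have "limit_deviation i = 0\<^sub>v (card (pa E i))" if "i < m" "pa E i = {}" for i
    using deviation_carrier(2)[OF that(1)] that(2) by auto
  then have "X \<in> X_lim n m E f \<Lambda> \<longleftrightarrow> (\<forall>i<m. limit_deviation i = 0\<^sub>v (card (pa E i)))"
    unfolding X_lim_def using assms(5) limit_equation_iff by blast
  then show "X \<in> X_lim n m E f \<Lambda> \<longleftrightarrow> is_limit_MLE n m E f (f + X) (\<Lambda>, \<omega>)"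
    and "X \<in> X_lim n m E f \<Lambda> \<longleftrightarrow> (\<forall>i<m. \<forall>z\<in>carrier_vec (card (pa E i)).
      parent_cols E f i *\<^sub>v z = 0\<^sub>v n \<longrightarrow> residual n E \<Lambda> X i \<bullet>c (parent_cols E X i *\<^sub>v z) = 0)"
    using is_limit_MLE_iff limit_deviation_eq_0_iff by simp_all
qed

text \<open>The test vectors range over the kernel of the parent columns of \<open>f\<close>, a set
  that does not move with \<open>X\<close>. Each equation is a residual, affine in nothing but the
  entries of \<open>X\<close>, paired with a conjugated combination of columns of
  \<open>X\<close>.\<close>

lemma zariski_closed_in_X_lim:
  fixes f \<Lambda> :: "'a::real_or_complex mat"
  assumes mn: "m \<le> n" and E: "dag_on m E" and f: "f \<in> carrier_mat n m" and MLE: "is_MLE n m E f (\<Lambda>, \<omega>)"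
  shows "zariski_closed_in (real_entries n m) n m (X_pert n m f) (X_lim n m E f \<Lambda>)"
proof -
  define S where "S = (SIGMA i:{..<m}. {z \<in> carrier_vec (card (pa E i)). parent_cols E f i *\<^sub>v z = 0\<^sub>v n})"
  define p where "p s = (case s of (i, z) \<Rightarrow> \<lambda>X. \<Sum>k<n. residual n E \<Lambda> X i $ k *
      (\<Sum>r<card (pa E i). conjugate (X $$ (k, parents E i ! r)) * conjugate (z $ r)))" for s :: "nat \<times> 'a vec"
  define V where "V = {X \<in> carrier_mat n m. \<forall>(i, z)\<in>S. residual n E \<Lambda> X i \<bullet>c (parent_cols E X i *\<^sub>v z) = 0}"
  have "zariski_closed (real_entries n m) n m V"
  proof (rule zariski_closedI)
    show "p s \<in> polynomials_in (real_entries n m)" if sS: "s \<in> S" for s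
    proof -
      obtain i z where s: "s = (i, z)" and i: "i < m" using sS by (auto simp: S_def)
      show ?thesis unfolding p_def s prod.case
        by (intro polynomials_in_sum polynomials_in.mult polynomials_in.const entry_in_real_entries(2)
            residual_polynomial[OF entry_in_real_entries(1) E i]) (auto intro: parents_nth_less[OF E])
    qed
    fix X :: "'a mat" assume X: "X \<in> carrier_mat n m"
    have "residual n E \<Lambda> X i \<bullet>c (parent_cols E X i *\<^sub>v z) = p (i, z) X" if "(i, z) \<in> S" for i z
    proof -
      have PC: "parent_cols E X i \<in> carrier_mat n (card (pa E i))" using X by simp
      have z: "z \<in> carrier_vec (card (pa E i))" using that by (simp add: S_def)
      show ?thesis
        unfolding cscalar_prod_sum[OF residual_carrier(1) mult_mat_vec_carrier[OF PC z]] p_def prod.case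
      proof (intro sum.cong refl)
        fix k assume "k \<in> {..<n}"
        then have k: "k < n" by simp
        show "residual n E \<Lambda> X i $ k * conjugate ((parent_cols E X i *\<^sub>v z) $ k) = residual n E \<Lambda> X i $ k *
            (\<Sum>r<card (pa E i). conjugate (X $$ (k, parents E i ! r)) * conjugate (z $ r))"
          unfolding mult_mat_vec_sum[OF PC z k]
          by (simp add: sum_conjugate conjugate_dist_mul parent_cols_index[OF E X k])
      qed
    qed
    then show "X \<in> V \<longleftrightarrow> (\<forall>s\<in>S. p s X = 0)" using X by (auto simp: V_def)
  qed (auto simp: V_def)
  moreover have "X_lim n m E f \<Lambda> = X_pert n m f \<inter> V"
  proof -
    have "X \<in> X_lim n m E f \<Lambda> \<longleftrightarrow> X \<in> V" if X: "X \<in> X_pert n m f" for X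
    proof -
      have "X \<in> carrier_mat n m" using X by (simp add: X_pert_def is_perturbation_def)
      then show ?thesis unfolding X_lim_iff(2)[OF mn E f MLE X] V_def S_def by auto
    qed
    moreover have "X_lim n m E f \<Lambda> \<subseteq> X_pert n m f" by (auto simp: X_lim_def)
    ultimately show ?thesis by blast
  qed
  ultimately show ?thesis unfolding zariski_closed_in_def by blast
qed

section \<open>From perturbations to stabilisations\<close>

lemma bij_betw_stabilisations:
  fixes f :: "'a::real_or_complex mat"
  assumes f: "f \<in> carrier_mat n m" and "\<And>X. X \<in> X_pert n m f \<Longrightarrow> X \<in> Z \<longleftrightarrow> Q (f + X)" and "Z \<subseteq> X_pert n m f"
  shows "bij_betw (\<lambda>X. f + X) Z {f\<^sub>s. is_stabilisation n m f f\<^sub>s \<and> Q f\<^sub>s}"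
  unfolding bij_betw_def
proof
  have carrier: "X \<in> carrier_mat n m" if "X \<in> Z" for X
    using that assms(3) by (auto simp: X_pert_def is_perturbation_def)
  show "inj_on (\<lambda>X. f + X) Z"
  proof (rule inj_onI)
    fix X Y assume XY: "X \<in> Z" "Y \<in> Z" and eq: "f + X = f + Y"
    note c = carrier[OF XY(1)] carrier[OF XY(2)]
    show "X = Y"
    proof (rule eq_matI)
      fix i j assume ij: "i < dim_row Y" "j < dim_col Y"
      have "(f + X) $$ (i, j) = (f + Y) $$ (i, j)" by (simp only: eq)
      then show "X $$ (i, j) = Y $$ (i, j)" using ij c by simp
    qed (use c in auto)
  qed
  show "(\<lambda>X. f + X) ` Z = {f\<^sub>s. is_stabilisation n m f f\<^sub>s \<and> Q f\<^sub>s}"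
    using assms by (auto simp: is_stabilisation_def X_pert_def)
qed

theorem theorem1p2:
  fixes n m :: nat
    and E :: "(nat \<times> nat) set"
    and f \<Lambda> :: "'a::real_or_complex mat"
    and \<omega> :: "real vec"
  assumes "m \<le> n"
    and "dag_on m E"
    and "f \<in> carrier_mat n m"
    and "is_MLE n m E f (\<Lambda>, \<omega>)"
  shows
    "(zariski_locally_closed (entries n m) n m (X_pert n m f) \<and>
      bij_betw (\<lambda>f'. f + f') (X_pert n m f) {f\<^sub>s. is_stabilisation n m f f\<^sub>s}) \<and>
     (zariski_closed_in (entries n m) n m (X_pert n m f) (X_MLE n m E f \<Lambda>) \<and>
      bij_betw (\<lambda>f'. f + f') (X_MLE n m E f \<Lambda>)
        {f\<^sub>s. is_stabilisation n m f f\<^sub>s \<and> is_unique_MLE n m E f\<^sub>s (\<Lambda>, \<omega>)} \<and>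
      (X_MLE n m E f \<Lambda> \<noteq> {} \<longleftrightarrow>
        (\<exists>f\<^sub>s. is_stabilisation n m f f\<^sub>s \<and> is_unique_MLE n m E f\<^sub>s (\<Lambda>, \<omega>)))) \<and>
     (zariski_closed_in (real_entries n m) n m (X_pert n m f) (X_lim n m E f \<Lambda>) \<and>
      bij_betw (\<lambda>f'. f + f') (X_lim n m E f \<Lambda>)
        {f\<^sub>s. is_stabilisation n m f f\<^sub>s \<and> is_limit_MLE n m E f f\<^sub>s (\<Lambda>, \<omega>)} \<and>
      (X_lim n m E f \<Lambda> \<noteq> {} \<longleftrightarrow>
        (\<exists>f\<^sub>s. is_stabilisation n m f f\<^sub>s \<and> is_limit_MLE n m E f f\<^sub>s (\<Lambda>, \<omega>))))"
  proof (intro conjI)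
  have MLE_iff: "X \<in> X_MLE n m E f \<Lambda> \<longleftrightarrow> is_unique_MLE n m E (f + X) (\<Lambda>, \<omega>)" if "X \<in> X_pert n m f" for X
  proof -
    interpret perturbed_sample n m E f X \<Lambda> \<omega>
      using assms that by unfold_locales (auto simp: X_pert_def)
    show ?thesis using that by (simp add: X_MLE_def is_unique_MLE_sample_1_iff)
  qed
  show "zariski_locally_closed (entries n m) n m (X_pert n m f)"
    by (rule zariski_locally_closed_X_pert[OF assms(3)])
  show "bij_betw (\<lambda>f'. f + f') (X_pert n m f) {f\<^sub>s. is_stabilisation n m f f\<^sub>s}"
    using bij_betw_stabilisations[OF assms(3), of "X_pert n m f" "\<lambda>_. True"] by simp
  show "zariski_closed_in (entries n m) n m (X_pert n m f) (X_MLE n m E f \<Lambda>)"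
    by (rule zariski_closed_in_X_MLE[OF assms(2)])
  show bij_MLE: "bij_betw (\<lambda>f'. f + f') (X_MLE n m E f \<Lambda>)
      {f\<^sub>s. is_stabilisation n m f f\<^sub>s \<and> is_unique_MLE n m E f\<^sub>s (\<Lambda>, \<omega>)}"
    by (rule bij_betw_stabilisations[OF assms(3) MLE_iff]) (auto simp: X_MLE_def)
  show "X_MLE n m E f \<Lambda> \<noteq> {} \<longleftrightarrow>
      (\<exists>f\<^sub>s. is_stabilisation n m f f\<^sub>s \<and> is_unique_MLE n m E f\<^sub>s (\<Lambda>, \<omega>))"
    using bij_betw_imp_surj_on[OF bij_MLE] by blast
  show "zariski_closed_in (real_entries n m) n m (X_pert n m f) (X_lim n m E f \<Lambda>)"
    by (rule zariski_closed_in_X_lim[OF assms])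
  show bij_lim: "bij_betw (\<lambda>f'. f + f') (X_lim n m E f \<Lambda>)
      {f\<^sub>s. is_stabilisation n m f f\<^sub>s \<and> is_limit_MLE n m E f f\<^sub>s (\<Lambda>, \<omega>)}"
    by (rule bij_betw_stabilisations[OF assms(3) X_lim_iff(1)[OF assms]]) (auto simp: X_lim_def)
  show "X_lim n m E f \<Lambda> \<noteq> {} \<longleftrightarrow>
      (\<exists>f\<^sub>s. is_stabilisation n m f f\<^sub>s \<and> is_limit_MLE n m E f f\<^sub>s (\<Lambda>, \<omega>))"
    using bij_betw_imp_surj_on[OF bij_lim] by blast
qed

end
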